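(* Let $n\ge2$. There exist a $C^\infty$ pseudoconvex real hypersurface $M$ in $\mathbb{C}^{n+1}$ and a point $p\in M$ such that $\Delta_1(M,p)=\infty$ and $\Delta_1^{\rm reg}(M,p)<\infty$ (in particular $M$ is of Bloom-Graham finite type at $p$), and such that there is no $\gamma\in\Gamma$ tangent to $M$ at $p$ to infinite order.
   Context: A local defining function $r$ for $M$ near $p$ is a real-valued $C^\infty$ function with $M=\{r=0\}$ near $p$ and $\nabla r\ne0$ on $M$. $\operatorname{ord}(h)$ is order of vanishing at $0$. $\Gamma$ is the set of germs of nonconstant holomorphic maps $\gamma:(\mathbb{C},0)\to(\mathbb{C}^{n+1},p)$ (good parametrization). $\Delta_1(M,p)=\sup_{\gamma\in\Gamma}\operatorname{ord}(r\circ\gamma)/\operatorname{ord}(\gamma-p)$; $\Delta_1^{\rm reg}(M,p)=\sup\{\operatorname{ord}(r\circ\gamma):\gamma\in\Gamma,\ \operatorname{ord}(\gamma-p)=1\}$. $\gamma$ is tangent to $M$ at $p$ to infinite order if $(r\circ\gamma)(t)=O(t^N)$ for all $N$. Bloom-Graham type of $M$ at $p$ is finite if there is a maximal $m<\infty$ such that some $n$-dimensional complex submanifold $X\ni p$ has $r|_X$ vanishing to order at least $m$ at $p$. *)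

theory Defs
  imports "HOL-Analysis.Analysis"
begin

fun iter_dd :: "'a::real_normed_vector list \<Rightarrow> ('a \<Rightarrow> real) \<Rightarrow> 'a \<Rightarrow> real" where
  "iter_dd [] f x = f x"
| "iter_dd (v # vs) f x = deriv (\<lambda>t::real. iter_dd vs f (x + t *\<^sub>R v)) 0"

definition Cinf_on :: "'a::real_normed_vector set \<Rightarrow> ('a \<Rightarrow> real) \<Rightarrow> bool" where
  "Cinf_on U f \<longleftrightarrow> open U \<and>
     (\<forall>vs. continuous_on U (iter_dd vs f) \<and>
        (\<forall>v. \<forall>x\<in>U. (\<lambda>t::real. iter_dd vs f (x + t *\<^sub>R v)) differentiable (at 0)))"

definition local_defining_function ::
  "(complex^'n) set \<Rightarrow> complex^'n \<Rightarrow> (complex^'n) set \<Rightarrow> (complex^'n \<Rightarrow> real) \<Rightarrow> bool" where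
  "local_defining_function M q U r \<longleftrightarrow> open U \<and> q \<in> U \<and> Cinf_on U r \<and>
     M \<inter> U = {z \<in> U. r z = 0} \<and> (\<forall>z \<in> M \<inter> U. \<exists>v. iter_dd [v] r z \<noteq> 0)"

definition smooth_real_hypersurface :: "(complex^'n) set \<Rightarrow> bool" where
  "smooth_real_hypersurface M \<longleftrightarrow> (\<forall>q\<in>M. \<exists>U r. local_defining_function M q U r)"

text \<open>Wirtinger derivatives, via real partial derivatives along x_j (axis j 1) and y_j (axis j i).\<close>
definition dz :: "(complex^'n \<Rightarrow> real) \<Rightarrow> 'n \<Rightarrow> complex^'n \<Rightarrow> complex" where
  "dz r j x = (complex_of_real (iter_dd [axis j 1] r x)
                 - \<i> * complex_of_real (iter_dd [axis j \<i>] r x)) / 2"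

definition dzdzbar :: "(complex^'n \<Rightarrow> real) \<Rightarrow> 'n \<Rightarrow> 'n \<Rightarrow> complex^'n \<Rightarrow> complex" where
  "dzdzbar r j k x = (complex_of_real (iter_dd [axis j 1, axis k 1] r x)
                 + \<i> * complex_of_real (iter_dd [axis j 1, axis k \<i>] r x)
                 - \<i> * complex_of_real (iter_dd [axis j \<i>, axis k 1] r x)
                 + complex_of_real (iter_dd [axis j \<i>, axis k \<i>] r x)) / 4"

definition complex_tangent :: "(complex^'n \<Rightarrow> real) \<Rightarrow> complex^'n \<Rightarrow> complex^'n \<Rightarrow> bool" where
  "complex_tangent r x w \<longleftrightarrow> (\<Sum>j\<in>UNIV. dz r j x * w $ j) = 0"

definition levi_form :: "(complex^'n \<Rightarrow> real) \<Rightarrow> complex^'n \<Rightarrow> complex^'n \<Rightarrow> complex" where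
  "levi_form r x w = (\<Sum>j\<in>UNIV. \<Sum>k\<in>UNIV. dzdzbar r j k x * w $ j * cnj (w $ k))"

definition pseudoconvex :: "(complex^'n) set \<Rightarrow> bool" where
  "pseudoconvex M \<longleftrightarrow> (\<forall>q\<in>M. \<exists>U r. local_defining_function M q U r \<and>
      (\<forall>z \<in> M \<inter> U. \<forall>w. complex_tangent r z w \<longrightarrow> 0 \<le> Re (levi_form r z w)))"

definition vanishes_to :: "nat \<Rightarrow> (complex \<Rightarrow> 'b::real_normed_vector) \<Rightarrow> bool" where
  "vanishes_to k f \<longleftrightarrow> (\<exists>C \<delta>. \<delta> > 0 \<and> (\<forall>t. norm t < \<delta> \<longrightarrow> norm (f t) \<le> C * norm t ^ k))"

definition ord :: "(complex \<Rightarrow> 'b::real_normed_vector) \<Rightarrow> enat" where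
  "ord f = Sup {enat k | k. vanishes_to k f}"

definition Gamma :: "complex^'n \<Rightarrow> (complex \<Rightarrow> complex^'n) set" where
  "Gamma p = {\<gamma>. \<gamma> 0 = p \<and>
      (\<exists>\<epsilon>>0. \<forall>i. (\<lambda>t. \<gamma> t $ i) holomorphic_on ball 0 \<epsilon>) \<and>
      (\<forall>\<epsilon>>0. \<exists>t. norm t < \<epsilon> \<and> \<gamma> t \<noteq> p)}"

definition Delta1 :: "complex^'n \<Rightarrow> (complex^'n \<Rightarrow> real) \<Rightarrow> ereal" where
  "Delta1 p r = (SUP \<gamma>\<in>Gamma p. ereal_of_enat (ord (r \<circ> \<gamma>)) / ereal_of_enat (ord (\<lambda>t. \<gamma> t - p)))"

definition Delta1_reg :: "complex^'n \<Rightarrow> (complex^'n \<Rightarrow> real) \<Rightarrow> enat" where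
  "Delta1_reg p r = (SUP \<gamma>\<in>{\<gamma> \<in> Gamma p. ord (\<lambda>t. \<gamma> t - p) = 1}. ord (r \<circ> \<gamma>))"

definition tangent_infinite_order :: "(complex^'n \<Rightarrow> real) \<Rightarrow> (complex \<Rightarrow> complex^'n) \<Rightarrow> bool" where
  "tangent_infinite_order r \<gamma> \<longleftrightarrow> (\<forall>N. vanishes_to N (r \<circ> \<gamma>))"

definition cholo_on :: "(complex^'n) set \<Rightarrow> (complex^'n \<Rightarrow> complex) \<Rightarrow> bool" where
  "cholo_on U h \<longleftrightarrow> open U \<and> (\<forall>z\<in>U. h differentiable (at z) \<and>
      (\<forall>c v. frechet_derivative h (at z) (c *s v) = c * frechet_derivative h (at z) v))"

text \<open>Some n-dimensional complex submanifold X = {h = 0} (h holomorphic, dh(p) nonzero) through p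
  on which r vanishes to order at least m at p.\<close>
definition bg_vanish :: "complex^'n \<Rightarrow> (complex^'n \<Rightarrow> real) \<Rightarrow> nat \<Rightarrow> bool" where
  "bg_vanish p r m \<longleftrightarrow> (\<exists>U h. cholo_on U h \<and> p \<in> U \<and> h p = 0 \<and>
      (\<exists>v. frechet_derivative h (at p) v \<noteq> 0) \<and>
      (\<exists>C \<delta>. \<delta> > 0 \<and> (\<forall>z\<in>U. h z = 0 \<and> norm (z - p) < \<delta> \<longrightarrow> \<bar>r z\<bar> \<le> C * norm (z - p) ^ m)))"

definition bloom_graham_finite :: "complex^'n \<Rightarrow> (complex^'n \<Rightarrow> real) \<Rightarrow> bool" where
  "bloom_graham_finite p r \<longleftrightarrow> (\<exists>m. bg_vanish p r m \<and> (\<forall>m'. bg_vanish p r m' \<longrightarrow> m' \<le> m))"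

end

theory Submission
  imports Defs "HOL-Complex_Analysis.Complex_Analysis"
begin

text \<open>
  For \<open>n + 1 = 3\<close> take \<open>r0 = Re w + u(z_a) + |z_b^2 - z_a^3|^2\<close> and the hypersurface \<open>r0 = 0\<close>; further
  coordinates contribute \<open>|z_j|^2\<close>. Here \<open>u\<close> is smooth and subharmonic, so that \<open>r0\<close> is
  plurisubharmonic, and its formal Taylor series at \<open>0\<close> is \<open>Re (\<Sum> c_j z^j)\<close> with \<open>\<Sum> c_j z^j\<close> divergent.

  The curves \<open>(t^2, t^3, - \<Sum>j<N. c_j t^(2j))\<close> have contact at least \<open>2 N\<close> but multiplicity \<open>2\<close>. Conversely,
  if \<open>r0 \<circ> \<gamma>\<close> vanishes to order \<open>N\<close>, averaging over \<open>N\<close>-th roots of unity separates the pluriharmonic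
  part: both \<open>|z_b^2 - z_a^3|^2\<close> and the holomorphic function \<open>w + \<Sum>j<N. c_j z_a^j\<close> are \<open>O(t^N)\<close> along
  \<open>\<gamma>\<close>. For \<open>N = 8\<close> the first excludes regular curves; for all \<open>N\<close> the second makes \<open>\<Sum> c_j z^j\<close> converge.

  The function is \<open>u(z) = \<Sum>k. \<epsilon>_k \<phi>(\<lambda>_k z)\<close> with \<open>\<epsilon>_k = \<lambda>_k^(-k)\<close> and \<open>\<lambda>_k\<close> growing very fast, where
  \<open>\<phi>(x + i y) = exp (- m(y)) cos x + \<psi>(y) - 1\<close> equals \<open>Re (exp (i z) - 1)\<close> for \<open>y \<ge> 0\<close>; for \<open>y < 0\<close> the
  exponential is damped by a flat correction and the flat convex \<open>\<psi>\<close> restores subharmonicity.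
\<close>

text \<open>The formal curve (t^2, t^3, - \<Sum> c_j t^(2j)) has infinite contact with the
  hypersurface, and divergence of the series keeps it from being holomorphic. A smooth formal curve
  in its place would have regular truncations of unbounded contact; the cusp makes every such
  truncation singular.

  The obstacle is \<open>u\<close>. A function harmonic near 0 has a convergent Taylor series, so
  \<open>u\<close> can be harmonic only to infinite order at 0. The functions Re (exp (i \<lambda>_k
  z)) grow exponentially in \<lambda>_k below the real axis, so their superposition with the chosen
  weights has no reason to converge there; damping leaves quadratic growth, which the weights can
  absorb. The choice \<epsilon>_k = \<lambda>_k^(-k) makes \<Sum> \<epsilon>_k \<lambda>_k^m finite
  for every m, while for m = k + 1 the single term of index k is \<lambda>_k, which may be
  prescribed as large as desired.

  All invariants take a defining function as argument, so the results for \<open>r0\<close> are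
  carried to an arbitrary \<open>r\<close> by a two-sided bound between |r| and |r0|. Finite
  Bloom-Graham type follows because a complex hypersurface of high contact contains a regular curve
  of the same contact.\<close>

no_notation fps_nth (infixl "$" 75)

section \<open>Smoothness relative to an algebra of functions\<close>

text \<open>A relation between globally defined functions, so that existence of the derivative is
  part of the statement; \<open>deriv\<close> inside \<open>iter_dd\<close> always returns some
  value.\<close>

definition has_dd :: "('a::real_normed_vector \<Rightarrow> real) \<Rightarrow> 'a \<Rightarrow> ('a \<Rightarrow> real) \<Rightarrow> bool" where
  "has_dd f v g \<longleftrightarrow> (\<forall>x. ((\<lambda>t. f (x + t *\<^sub>R v)) has_real_derivative g x) (at 0))"

text \<open>The class \<open>B\<close> carries a side condition through all derivatives: continuity
  for the final smoothness claim, polynomial growth for the summands of the series, where it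
  justifies termwise differentiation.\<close>

fun smoothK :: "('a::real_normed_vector \<Rightarrow> real) set \<Rightarrow> nat \<Rightarrow> ('a \<Rightarrow> real) \<Rightarrow> bool" where
  "smoothK B 0 f \<longleftrightarrow> f \<in> B"
| "smoothK B (Suc k) f \<longleftrightarrow> f \<in> B \<and> (\<forall>v. \<exists>g. smoothK B k g \<and> has_dd f v g)"

definition smooth_in :: "('a::real_normed_vector \<Rightarrow> real) set \<Rightarrow> ('a \<Rightarrow> real) \<Rightarrow> bool" where
  "smooth_in B f \<longleftrightarrow> (\<forall>k. smoothK B k f)"

definition fun_algebra :: "('a \<Rightarrow> real) set \<Rightarrow> bool" where
  "fun_algebra B \<longleftrightarrow> (\<forall>c. (\<lambda>_. c) \<in> B) \<and> (\<forall>f\<in>B. \<forall>g\<in>B. (\<lambda>x. f x + g x) \<in> B \<and> (\<lambda>x. f x * g x) \<in> B)"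

lemma iter_dd_Cons: "iter_dd (v # vs) f = iter_dd [v] (iter_dd vs f)"
  by (rule ext) simp

lemma has_dd_imp_iter_dd: "has_dd f v g \<Longrightarrow> iter_dd [v] f = g"
  unfolding has_dd_def by (intro ext) (auto intro: DERIV_imp_deriv)

declare iter_dd.simps(2) [simp del]

lemma has_dd_at:
  assumes "has_dd f v g"
  shows "((\<lambda>t. f (x + t *\<^sub>R v)) has_real_derivative g (x + s *\<^sub>R v)) (at s)"
proof -
  have "((\<lambda>t. f ((x + s *\<^sub>R v) + t *\<^sub>R v)) has_real_derivative g (x + s *\<^sub>R v)) (at 0)"
    using assms by (simp add: has_dd_def)
  then have "((\<lambda>t. f ((x + s *\<^sub>R v) + (t - s) *\<^sub>R v)) has_real_derivative g (x + s *\<^sub>R v)) (at s)"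
    using DERIV_shift[of "\<lambda>t. f ((x + s *\<^sub>R v) + (t - s) *\<^sub>R v)" "g (x + s *\<^sub>R v)" 0 s]
    by (simp add: add.commute)
  then show ?thesis
    by (simp add: algebra_simps)
qed

lemma has_dd_const: "has_dd (\<lambda>_. c) v (\<lambda>_. 0)"
  by (simp add: has_dd_def)

lemma has_dd_bounded_linear: "bounded_linear L \<Longrightarrow> has_dd L v (\<lambda>_. L v)"
  by (auto simp: has_dd_def linear_simps intro!: derivative_eq_intros)

lemma has_dd_add:
  "has_dd f v f' \<Longrightarrow> has_dd g v g' \<Longrightarrow> has_dd (\<lambda>x. f x + g x) v (\<lambda>x. f' x + g' x)"
  unfolding has_dd_def by (auto intro!: derivative_eq_intros)

lemma has_dd_mult:
  "has_dd f v f' \<Longrightarrow> has_dd g v g' \<Longrightarrow> has_dd (\<lambda>x. f x * g x) v (\<lambda>x. f' x * g x + f x * g' x)"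
  unfolding has_dd_def by (auto intro!: derivative_eq_intros)

lemma has_dd_compose:
  assumes "\<And>s. (G has_real_derivative G' s) (at s)" "has_dd f v f'"
  shows "has_dd (\<lambda>x. G (f x)) v (\<lambda>x. G' (f x) * f' x)"
  unfolding has_dd_def
proof
  fix x
  have f: "((\<lambda>t. f (x + t *\<^sub>R v)) has_real_derivative f' x) (at 0)"
    using assms(2) by (simp add: has_dd_def)
  have "(G has_real_derivative G' (f (x + 0 *\<^sub>R v))) (at (f (x + 0 *\<^sub>R v)))"
    by (rule assms)
  from DERIV_chain'[OF f this]
  show "((\<lambda>t. G (f (x + t *\<^sub>R v))) has_real_derivative G' (f x) * f' x) (at 0)"
    by simp
qed

lemma has_dd_linear_comp:
  assumes "has_dd u (L v) g" "linear L"
  shows "has_dd (\<lambda>x. u (L x)) v (\<lambda>x. g (L x))"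
  using assms by (simp add: has_dd_def linear_add linear_scale)

lemma smoothK_mem: "smoothK B k f \<Longrightarrow> f \<in> B"
  by (cases k) auto

lemma smoothK_Suc_D: "smoothK B (Suc k) f \<Longrightarrow> smoothK B k f"
  by (induction k arbitrary: f) (auto, blast)

lemma smoothK_const: "fun_algebra B \<Longrightarrow> smoothK B k (\<lambda>_. c)"
  by (induction k arbitrary: c) (auto simp: fun_algebra_def intro!: exI[of _ "\<lambda>_. 0"] has_dd_const)

lemma smoothK_add:
  assumes "fun_algebra B"
  shows "smoothK B k f \<Longrightarrow> smoothK B k g \<Longrightarrow> smoothK B k (\<lambda>x. f x + g x)"
proof (induction k arbitrary: f g)
  case 0
  then show ?case using assms by (auto simp: fun_algebra_def)
next
  case (Suc k)
  show ?case
    unfolding smoothK.simps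
  proof (intro conjI allI)
    show "(\<lambda>x. f x + g x) \<in> B"
      using Suc.prems assms by (auto simp: fun_algebra_def)
    fix v
    obtain f' g' where *: "smoothK B k f'" "has_dd f v f'" "smoothK B k g'" "has_dd g v g'"
      using Suc.prems by (auto; blast)
    show "\<exists>h. smoothK B k h \<and> has_dd (\<lambda>x. f x + g x) v h"
      by (rule exI[of _ "\<lambda>x. f' x + g' x"], rule conjI[OF Suc.IH has_dd_add]) (use * in auto)
  qed
qed

lemma smoothK_mult:
  assumes "fun_algebra B"
  shows "smoothK B k f \<Longrightarrow> smoothK B k g \<Longrightarrow> smoothK B k (\<lambda>x. f x * g x)"
proof (induction k arbitrary: f g)
  case 0
  then show ?case using assms by (auto simp: fun_algebra_def)
next
  case (Suc k)
  show ?case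
    unfolding smoothK.simps
  proof (intro conjI allI)
    show "(\<lambda>x. f x * g x) \<in> B"
      using Suc.prems assms by (auto simp: fun_algebra_def)
    fix v
    obtain f' g' where *: "smoothK B k f'" "has_dd f v f'" "smoothK B k g'" "has_dd g v g'"
      using Suc.prems by (auto; blast)
    have "smoothK B k (\<lambda>x. f' x * g x + f x * g' x)"
      using Suc.IH[OF *(1) smoothK_Suc_D[OF Suc.prems(2)]] Suc.IH[OF smoothK_Suc_D[OF Suc.prems(1)] *(3)]
      by (rule smoothK_add[OF assms])
    then show "\<exists>h. smoothK B k h \<and> has_dd (\<lambda>x. f x * g x) v h"
      using has_dd_mult[OF *(2,4)] by (intro exI conjI)
  qed
qed

lemma smooth_in_mem: "smooth_in B f \<Longrightarrow> f \<in> B"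
  using smoothK_mem by (auto simp: smooth_in_def)

lemma smooth_in_deriv:
  assumes "smooth_in B f"
  shows "smooth_in B (iter_dd [v] f)" "has_dd f v (iter_dd [v] f)"
proof -
  have *: "\<exists>g. smoothK B k g \<and> has_dd f v g" for k
    using assms unfolding smooth_in_def by (metis smoothK.simps(2))
  then show "has_dd f v (iter_dd [v] f)"
    using has_dd_imp_iter_dd by metis
  show "smooth_in B (iter_dd [v] f)"
    unfolding smooth_in_def using * has_dd_imp_iter_dd by metis
qed

lemma smooth_in_iter_dd: "smooth_in B f \<Longrightarrow> smooth_in B (iter_dd vs f)"
proof (induction vs)
  case Nil
  have "iter_dd [] f = f" by (rule ext) simp
  with Nil show ?case by simp
next
  case (Cons v vs)
  then show ?case using smooth_in_deriv(1) iter_dd_Cons by metis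
qed

lemma smooth_in_const: "fun_algebra B \<Longrightarrow> smooth_in B (\<lambda>_. c)"
  by (simp add: smooth_in_def smoothK_const)

lemma smooth_in_add:
  "fun_algebra B \<Longrightarrow> smooth_in B f \<Longrightarrow> smooth_in B g \<Longrightarrow> smooth_in B (\<lambda>x. f x + g x)"
  by (simp add: smooth_in_def smoothK_add)

lemma smooth_in_mult:
  "fun_algebra B \<Longrightarrow> smooth_in B f \<Longrightarrow> smooth_in B g \<Longrightarrow> smooth_in B (\<lambda>x. f x * g x)"
  by (simp add: smooth_in_def smoothK_mult)

lemma smooth_in_diff:
  assumes "fun_algebra B" "smooth_in B f" "smooth_in B g"
  shows "smooth_in B (\<lambda>x. f x - g x)"
  using smooth_in_add[OF assms(1,2) smooth_in_mult[OF assms(1) smooth_in_const[OF assms(1)] assms(3)], of "-1"]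
  by simp

lemma smooth_in_sum:
  assumes "fun_algebra B" "\<And>i. i \<in> A \<Longrightarrow> smooth_in B (f i)"
  shows "smooth_in B (\<lambda>x. \<Sum>i\<in>A. f i x)"
  using assms(2)
  by (induction A rule: infinite_finite_induct)
     (auto simp: smooth_in_const[OF assms(1)] intro!: smooth_in_add[OF assms(1)])

lemma smooth_in_power:
  "fun_algebra B \<Longrightarrow> smooth_in B f \<Longrightarrow> smooth_in B (\<lambda>x. f x ^ n)"
  by (induction n) (auto intro: smooth_in_mult smooth_in_const)

lemma smooth_in_bounded_linear:
  assumes "fun_algebra B" "bounded_linear L" "L \<in> B"
  shows "smooth_in B L"
  unfolding smooth_in_def
proof
  fix k show "smoothK B k L"
    by (cases k) (use assms smoothK_const[OF assms(1)] has_dd_bounded_linear[OF assms(2)] in auto)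
qed

text \<open>A one-variable function is given together with all its derivatives \<open>G 0, G 1, \<dots>\<close>, so that
  only the compositions have to lie in the algebra.\<close>
lemma smooth_in_tower:
  assumes B: "fun_algebra B" and G: "\<And>i s. (G i has_real_derivative G (Suc i) s) (at s)"
    and mem: "\<And>i. (\<lambda>x. G i (f x)) \<in> B" and f: "smooth_in B f"
  shows "smooth_in B (\<lambda>x. G i (f x))"
proof -
  have "smoothK B k (\<lambda>x. G i (f x))" for k i
  proof (induction k arbitrary: i)
    case 0
    then show ?case using mem by simp
  next
    case (Suc k)
    have "smoothK B k (\<lambda>x. G (Suc i) (f x) * iter_dd [v] f x)" for v
      by (rule smoothK_mult[OF B Suc.IH]) (use smooth_in_deriv(1)[OF f] in \<open>simp add: smooth_in_def\<close>)
    moreover have "has_dd (\<lambda>x. G i (f x)) v (\<lambda>x. G (Suc i) (f x) * iter_dd [v] f x)" for v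
      by (rule has_dd_compose[OF G smooth_in_deriv(2)[OF f]])
    ultimately show ?case
      unfolding smoothK.simps using mem by (intro conjI allI exI)
  qed
  then show ?thesis by (simp add: smooth_in_def)
qed

definition cont_funs :: "('a::real_normed_vector \<Rightarrow> real) set" where
  "cont_funs = {f. continuous_on UNIV f}"

lemma fun_algebra_cont_funs: "fun_algebra cont_funs"
  by (auto simp: fun_algebra_def cont_funs_def intro: continuous_intros)

lemma smooth_in_linear_comp:
  fixes L :: "'a::real_normed_vector \<Rightarrow> 'b::real_normed_vector"
  assumes L: "bounded_linear L" and u: "smooth_in cont_funs u"
  shows "smooth_in cont_funs (\<lambda>x. u (L x))"
proof -
  have mem: "(\<lambda>x. u (L x)) \<in> cont_funs" if "u \<in> cont_funs" for u
    using that L unfolding cont_funs_def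
    by (auto intro: continuous_on_compose2 linear_continuous_on)
  have "smoothK cont_funs k (\<lambda>x. u (L x))" if "smooth_in cont_funs u" for k u
    using that
  proof (induction k arbitrary: u)
    case 0
    then show ?case using mem smooth_in_mem by auto
  next
    case (Suc k)
    show ?case unfolding smoothK.simps
    proof (intro conjI allI)
      show "(\<lambda>x. u (L x)) \<in> cont_funs" using mem smooth_in_mem Suc.prems by auto
      fix v
      show "\<exists>g. smoothK cont_funs k g \<and> has_dd (\<lambda>x. u (L x)) v g"
        using Suc.IH[OF smooth_in_deriv(1)[OF Suc.prems]]
          has_dd_linear_comp[OF smooth_in_deriv(2)[OF Suc.prems] bounded_linear.linear[OF L]]
        by blast
    qed
  qed
  then show ?thesis using u by (simp add: smooth_in_def)
qed

lemma smooth_in_imp_Cinf_on: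
  assumes "smooth_in cont_funs f"
  shows "Cinf_on UNIV f"
  unfolding Cinf_on_def
proof (intro conjI allI ballI)
  fix vs
  show "continuous_on UNIV (iter_dd vs f)"
    using smooth_in_mem[OF smooth_in_iter_dd[OF assms]] by (simp add: cont_funs_def)
  fix v x
  show "(\<lambda>t::real. iter_dd vs f (x + t *\<^sub>R v)) differentiable (at 0)"
    using smooth_in_deriv(2)[OF smooth_in_iter_dd[OF assms]]
    unfolding has_dd_def real_differentiable_def by blast
qed simp

section \<open>The flat function exp (-1/t)\<close>

text \<open>Allowing a polynomial factor in 1/t makes the family closed under differentiation, so
  all derivatives of exp (-1/t) are treated at once.\<close>

definition flat_fun :: "real poly \<Rightarrow> real \<Rightarrow> real" where
  "flat_fun p t = (if t > 0 then poly p (1 / t) * exp (- (1 / t)) else 0)"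

lemma poly_times_exp_tendsto_0:
  "((\<lambda>s::real. poly p s * exp (- s)) \<longlongrightarrow> 0) at_top"
proof -
  have "((\<lambda>s. \<Sum>i\<le>degree p. coeff p i * (s ^ i / exp s)) \<longlongrightarrow> (\<Sum>i\<le>degree p. coeff p i * 0)) at_top"
    by (intro tendsto_intros tendsto_power_div_exp_0)
  moreover have "(\<Sum>i\<le>degree p. coeff p i * (s ^ i / exp s)) = poly p s * exp (- s)" for s :: real
    unfolding poly_altdef sum_distrib_right
    by (intro sum.cong refl) (simp add: exp_minus field_simps)
  ultimately show ?thesis by simp
qed

text \<open>This is the difference quotient at 0. Dividing by t multiplies the polynomial by its
  variable, so the quotient is again a polynomial in 1/t times exp (-1/t).\<close>

lemma flat_fun_tendsto_0: "((\<lambda>t. flat_fun p t / t) \<longlongrightarrow> 0) (at 0)"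
proof -
  have "((\<lambda>t::real. poly (pCons 0 p) (inverse t) * exp (- inverse t)) \<longlongrightarrow> 0) (at_right 0)"
    by (rule filterlim_compose[OF poly_times_exp_tendsto_0 filterlim_inverse_at_top_right])
  moreover have "eventually (\<lambda>t. poly (pCons 0 p) (inverse t) * exp (- inverse t) = flat_fun p t / t) (at_right 0)"
    by (auto simp: eventually_at_filter flat_fun_def field_simps)
  ultimately have r: "((\<lambda>t. flat_fun p t / t) \<longlongrightarrow> 0) (at_right 0)"
    using tendsto_cong by force
  have "eventually (\<lambda>t. 0 = flat_fun p t / t) (at_left 0)"
    by (auto simp: eventually_at_filter flat_fun_def)
  then have "((\<lambda>t. flat_fun p t / t) \<longlongrightarrow> 0) (at_left 0)"
    by (rule Lim_transform_eventually[OF tendsto_const])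
  with r show ?thesis by (simp add: filterlim_split_at)
qed

text \<open>In the variable s = 1/t one has d/dt = - s^2 d/ds, which sends p(s) exp (-s) to s^2 (p -
  p')(s) exp (-s).\<close>

lemma flat_fun_deriv:
  "(flat_fun p has_real_derivative flat_fun ([:0,0,1:] * (p - pderiv p)) t) (at t)"
proof (cases t "0::real" rule: linorder_cases)
  case less
  have "((\<lambda>_. 0) has_real_derivative 0) (at t)" by simp
  then show ?thesis
    by (rule has_field_derivative_transform_within_open[of _ _ _ "{..<0}", THEN DERIV_cong])
       (use less in \<open>auto simp: flat_fun_def\<close>)
next
  case equal
  have "((\<lambda>t. (flat_fun p t - flat_fun p 0) / (t - 0)) \<longlongrightarrow> 0) (at 0)"
    using flat_fun_tendsto_0[of p] by (simp add: flat_fun_def[of _ 0])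
  then show ?thesis using equal by (simp add: has_field_derivative_iff flat_fun_def[of _ 0])
next
  case greater
  have inv: "((\<lambda>t. 1 / t) has_real_derivative - (1 / t ^ 2)) (at t)"
    using greater by (auto intro!: derivative_eq_intros simp: power2_eq_square)
  have "((\<lambda>t. poly p (1 / t)) has_real_derivative poly (pderiv p) (1 / t) * - (1 / t ^ 2)) (at t)"
    by (rule DERIV_chain2[OF poly_DERIV inv])
  moreover have "((\<lambda>t. exp (- (1 / t))) has_real_derivative exp (- (1 / t)) * - (- (1 / t ^ 2))) (at t)"
    by (rule DERIV_chain2[OF DERIV_exp DERIV_minus[OF inv]])
  ultimately have "((\<lambda>t. poly p (1 / t) * exp (- (1 / t))) has_real_derivative
     poly (pderiv p) (1 / t) * - (1 / t ^ 2) * exp (- (1 / t)) + exp (- (1 / t)) * - (- (1 / t ^ 2)) * poly p (1 / t)) (at t)"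
    by (rule DERIV_mult)
  then have "((\<lambda>t. poly p (1 / t) * exp (- (1 / t))) has_real_derivative
     flat_fun ([:0,0,1:] * (p - pderiv p)) t) (at t)"
    by (rule DERIV_cong) (use greater in \<open>simp add: flat_fun_def field_simps power2_eq_square\<close>)
  then show ?thesis
    by (rule has_field_derivative_transform_within_open[of _ _ _ "{0<..}"])
       (use greater in \<open>auto simp: flat_fun_def\<close>)
qed

lemma power_mult_exp_neg_le: "(s::real) \<ge> 0 \<Longrightarrow> s ^ i * exp (- s) \<le> fact i"
proof -
  assume s: "s \<ge> 0"
  have "(\<Sum>n\<in>{i}. inverse (fact n) *\<^sub>R s ^ n) \<le> (\<Sum>n. inverse (fact n) *\<^sub>R s ^ n)"
    using s by (intro sum_le_suminf summable_exp_generic) auto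
  then have "s ^ i / fact i \<le> exp s"
    by (simp add: exp_def field_simps)
  then show ?thesis by (simp add: exp_minus field_simps)
qed

lemma flat_fun_bounded: "\<exists>C. \<forall>t. \<bar>flat_fun p t\<bar> \<le> C"
proof (intro exI allI)
  fix t
  show "\<bar>flat_fun p t\<bar> \<le> (\<Sum>i\<le>degree p. \<bar>coeff p i\<bar> * fact i)"
  proof (cases "t > 0")
    case True
    have "\<bar>flat_fun p t\<bar> \<le> (\<Sum>i\<le>degree p. \<bar>coeff p i * (1 / t) ^ i\<bar>) * exp (- (1 / t))"
      using True sum_abs[of "\<lambda>i. coeff p i * (1 / t) ^ i" "{..degree p}"]
      by (simp only: flat_fun_def abs_mult poly_altdef if_True abs_exp_cancel) (intro mult_right_mono, auto)
    also have "\<dots> = (\<Sum>i\<le>degree p. \<bar>coeff p i\<bar> * ((1 / t) ^ i * exp (- (1 / t))))"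
      using True by (simp add: sum_distrib_right abs_mult power_abs mult.assoc)
    also have "\<dots> \<le> (\<Sum>i\<le>degree p. \<bar>coeff p i\<bar> * fact i)"
      using True by (intro sum_mono mult_left_mono power_mult_exp_neg_le) auto
    finally show ?thesis .
  qed (simp add: flat_fun_def sum_nonneg)
qed

lemma flat_fun_flat:
  assumes "t > 0"
  shows "flat_fun 1 t \<le> fact i * t ^ i"
  using power_mult_exp_neg_le[of "1/t" i] assms by (simp add: flat_fun_def field_simps)

primrec flat_poly :: "nat \<Rightarrow> real poly" where
  "flat_poly 0 = 1"
| "flat_poly (Suc i) = [:0,0,1:] * (flat_poly i - pderiv (flat_poly i))"

section \<open>A subharmonic function that is formally harmonic at the origin\<close>

text \<open>Polynomial growth is what a dilation by \<open>l k\<close> turns into a power of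
  \<open>l k\<close>. Boundedness would be too narrow, since \<open>fix_up\<close> grows
  quadratically.\<close>

definition tempered :: "(complex \<Rightarrow> real) set" where
  "tempered = {f. continuous_on UNIV f \<and> (\<exists>C m. \<forall>z. \<bar>f z\<bar> \<le> C * (1 + norm z) ^ m)}"

lemma tempered_bounded:
  assumes "continuous_on UNIV f" "\<And>z. \<bar>f z\<bar> \<le> C"
  shows "f \<in> tempered"
proof -
  have "\<bar>f z\<bar> \<le> C * (1 + norm z) ^ 0" for z using assms(2)[of z] by simp
  then show ?thesis unfolding tempered_def using assms(1) by blast
qed

lemma tempered_linear_growth:
  assumes "continuous_on UNIV f" "\<And>z. \<bar>f z\<bar> \<le> norm z"
  shows "f \<in> tempered"
proof -
  have "\<bar>f z\<bar> \<le> 1 * (1 + norm z) ^ 1" for z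
    using assms(2)[of z] by simp
  then show ?thesis unfolding tempered_def using assms(1) by blast
qed

lemma fun_algebra_tempered: "fun_algebra tempered"
  unfolding fun_algebra_def
proof (intro conjI allI ballI)
  show "(\<lambda>_. c) \<in> tempered" for c
    by (rule tempered_bounded[of _ "\<bar>c\<bar>"]) auto
  fix f g assume f: "f \<in> tempered" and g: "g \<in> tempered"
  obtain C m D n where C: "\<And>z. \<bar>f z\<bar> \<le> C * (1 + norm z) ^ m" and D: "\<And>z. \<bar>g z\<bar> \<le> D * (1 + norm z) ^ n"
    using f g unfolding tempered_def by blast
  have cf: "continuous_on UNIV f" and cg: "continuous_on UNIV g"
    using f g by (auto simp: tempered_def)
  have "C \<ge> 0" "D \<ge> 0" using C[of 0] D[of 0] by auto
  have "\<bar>f z + g z\<bar> \<le> (C + D) * (1 + norm z) ^ (m + n)" for z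
  proof -
    have "\<bar>f z + g z\<bar> \<le> C * (1 + norm z) ^ m + D * (1 + norm z) ^ n"
      using C[of z] D[of z] by linarith
    also have "\<dots> \<le> C * (1 + norm z) ^ (m + n) + D * (1 + norm z) ^ (m + n)"
      using \<open>C \<ge> 0\<close> \<open>D \<ge> 0\<close> by (intro add_mono mult_left_mono power_increasing) auto
    finally show ?thesis by (simp add: distrib_right)
  qed
  then show "(\<lambda>x. f x + g x) \<in> tempered"
    unfolding tempered_def using cf cg by (auto intro: continuous_intros)
  have "\<bar>f z * g z\<bar> \<le> (C * D) * (1 + norm z) ^ (m + n)" for z
    using mult_mono[OF C[of z] D[of z]] \<open>C \<ge> 0\<close> by (simp add: abs_mult power_add mult_ac)
  then show "(\<lambda>x. f x * g x) \<in> tempered"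
    unfolding tempered_def using cf cg by (auto intro: continuous_intros)
qed

section \<open>The damped exponential profile: smoothness and growth\<close>

lemma smooth_tempered_Re: "smooth_in tempered Re" and smooth_tempered_Im: "smooth_in tempered Im"
  by (auto intro!: smooth_in_bounded_linear fun_algebra_tempered bounded_linear_Re bounded_linear_Im
      tempered_linear_growth continuous_intros abs_Re_le_cmod abs_Im_le_cmod)

lemma continuous_flat_fun [continuous_intros]:
  assumes "continuous_on S f"
  shows "continuous_on S (\<lambda>x. flat_fun p (f x))"
proof -
  have "continuous_on UNIV (flat_fun p)"
    by (auto intro!: continuous_at_imp_continuous_on DERIV_isCont flat_fun_deriv)
  then show ?thesis by (rule continuous_on_compose2[OF _ assms]) auto
qed

lemma smooth_tempered_flat:
  assumes "smooth_in tempered f" "continuous_on UNIV f"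
  shows "smooth_in tempered (\<lambda>z. flat_fun 1 (f z))"
proof -
  have "smooth_in tempered (\<lambda>z. (\<lambda>i. flat_fun (flat_poly i)) 0 (f z))"
  proof (rule smooth_in_tower[OF fun_algebra_tempered _ _ assms(1)])
    show "(flat_fun (flat_poly i) has_real_derivative flat_fun (flat_poly (Suc i)) s) (at s)" for i s
      using flat_fun_deriv[of "flat_poly i" s] by simp
    show "(\<lambda>z. flat_fun (flat_poly i) (f z)) \<in> tempered" for i
      using flat_fun_bounded[of "flat_poly i"] assms(2)
      by (auto intro!: tempered_bounded continuous_intros)
  qed
  then show ?thesis by simp
qed

text \<open>For y < 0 this is y (1 - exp (1/y)). It agrees with y to infinite order at 0 but tends
  to -1 as y tends to minus infinity, so exp (- \<open>damp y\<close>) stays bounded where exp (-y)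
  would blow up.\<close>

definition damp :: "real \<Rightarrow> real" where
  "damp y = y - y * flat_fun 1 (- y)"

text \<open>With t = -y, s = 1/t and E = exp (-s), the second derivative of t^2 E is E (2 + 2 s +
  s^2) and that of t E is E s^3. These are matched to the two quantities 2 E (1 + s) and E s^3 by
  which the damped exponential can fail to be subharmonic. The factor \<open>exp 1\<close> is the
  bound on exp (- \<open>damp y\<close>).\<close>

definition fix_up :: "real \<Rightarrow> real" where
  "fix_up y = exp 1 * ((y\<^sup>2 - y) * flat_fun 1 (- y))"

definition phi :: "complex \<Rightarrow> real" where
  "phi z = exp (- damp (Im z)) * cos (Re z) + fix_up (Im z) - 1"

lemma damp_ge: "- damp y \<le> 1" if "y \<le> 0"
proof (cases "y = 0")
  case False
  with that have y: "y < 0" by simp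
  have "1 - exp (1 / y) \<le> - 1 / y"
    using exp_ge_add_one_self[of "1 / y"] by (simp only: minus_divide_left[symmetric])
  then have "- y * (1 - exp (1 / y)) \<le> - y * (- 1 / y)"
    using y by (intro mult_left_mono) auto
  then show ?thesis using y by (simp add: damp_def flat_fun_def algebra_simps)
qed (simp add: damp_def)

lemma exp_damp_le: "exp (- damp y) \<le> exp 1"
  using damp_ge[of y] by (cases "y \<le> 0") (auto simp: damp_def flat_fun_def)

lemma smooth_damp: "smooth_in tempered (\<lambda>z. damp (Im z))"
  and smooth_flat_Im: "smooth_in tempered (\<lambda>z. flat_fun 1 (- Im z))"
proof -
  have "smooth_in tempered (\<lambda>z. 0 - Im z)"
    by (intro smooth_in_diff smooth_in_const fun_algebra_tempered smooth_tempered_Im)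
  then show *: "smooth_in tempered (\<lambda>z. flat_fun 1 (- Im z))"
    by (intro smooth_tempered_flat continuous_intros) simp
  show "smooth_in tempered (\<lambda>z. damp (Im z))"
    unfolding damp_def
    by (intro smooth_in_diff smooth_in_mult fun_algebra_tempered smooth_tempered_Im *)
qed

lemma smooth_phi: "smooth_in tempered phi"
proof -
  note alg = fun_algebra_tempered
  have dc: "continuous_on UNIV (\<lambda>z. damp (Im z))"
    using smooth_in_mem[OF smooth_damp] by (simp add: tempered_def)
  have e: "smooth_in tempered (\<lambda>z. (\<lambda>i s. (-1) ^ i * exp (- s)) 0 (damp (Im z)))"
  proof (rule smooth_in_tower[OF alg _ _ smooth_damp])
    show "((\<lambda>s. (-1) ^ i * exp (- s)) has_real_derivative (-1) ^ Suc i * exp (- s)) (at s)" for i :: nat and s :: real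
      by (auto intro!: derivative_eq_intros)
    show "(\<lambda>z. (-1) ^ i * exp (- damp (Im z))) \<in> tempered" for i
      using dc exp_damp_le by (intro tempered_bounded[of _ "exp 1"]) (auto simp: abs_mult intro!: continuous_intros)
  qed
  \<comment> \<open>Differentiating cosine is a shift by a quarter period, so all its derivatives
    form one indexed family.\<close>
  have shift: "cos (s + (1 + real i) * pi / 2) = - sin (s + real i * pi / 2)" for i :: nat and s :: real
    using cos_add[of "s + real i * pi / 2" "pi / 2"] by (simp add: add_divide_distrib distrib_right add_ac)
  have c: "smooth_in tempered (\<lambda>z. (\<lambda>i s. cos (s + real i * (pi / 2))) 0 (Re z))"
  proof (rule smooth_in_tower[OF alg _ _ smooth_tempered_Re])
    show "((\<lambda>s. cos (s + real i * (pi / 2))) has_real_derivative cos (s + real (Suc i) * (pi / 2))) (at s)" for i :: nat and s :: real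
      by (auto intro!: derivative_eq_intros simp: shift)
    show "(\<lambda>z. cos (Re z + real i * (pi / 2))) \<in> tempered" for i
      by (intro tempered_bounded[of _ 1] continuous_intros) auto
  qed
  have "smooth_in tempered (\<lambda>z. exp (- damp (Im z)) * cos (Re z) +
      exp 1 * (((Im z)\<^sup>2 - Im z) * flat_fun 1 (- Im z)) - 1)"
    using e c
    by (intro smooth_in_diff smooth_in_add smooth_in_mult smooth_in_const smooth_in_power alg
        smooth_tempered_Im smooth_flat_Im) simp_all
  then show ?thesis
    by (simp add: phi_def[abs_def] fix_up_def)
qed

section \<open>The Laplacian of the profile\<close>

lemma flat_fun_reflect_deriv:
  "((\<lambda>y. flat_fun p (- y)) has_real_derivative - flat_fun ([:0,0,1:] * (p - pderiv p)) (- y)) (at y)"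
  using DERIV_chain2[OF flat_fun_deriv DERIV_minus[OF DERIV_ident], of p y] by simp

text \<open>Minus the first derivative of y \<mapsto> exp (1/y) (extended by 0), while
  \<open>flat4\<close> is its second derivative; the numerals are the degrees of the polynomial
  factors.\<close>

definition flat2 :: "real \<Rightarrow> real" where "flat2 y = flat_fun [:0,0,1:] (- y)"
definition flat4 :: "real \<Rightarrow> real" where "flat4 y = flat_fun [:0,0,0,-2,1:] (- y)"

lemma flat_derivs:
  "((\<lambda>y. flat_fun 1 (- y)) has_real_derivative - flat2 y) (at y)"
  "(flat2 has_real_derivative - flat4 y) (at y)"
  using flat_fun_reflect_deriv[of 1 y] flat_fun_reflect_deriv[of "[:0,0,1:]" y]
  by (simp_all add: flat2_def[abs_def] flat4_def pderiv_pCons)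

definition damp1 :: "real \<Rightarrow> real" where
  "damp1 y = 1 - flat_fun 1 (- y) + y * flat2 y"
definition damp2 :: "real \<Rightarrow> real" where
  "damp2 y = 2 * flat2 y - y * flat4 y"
definition fix_up1 :: "real \<Rightarrow> real" where
  "fix_up1 y = exp 1 * ((2 * y - 1) * flat_fun 1 (- y) - (y\<^sup>2 - y) * flat2 y)"
definition fix_up2 :: "real \<Rightarrow> real" where
  "fix_up2 y = exp 1 * (2 * flat_fun 1 (- y) - 2 * (2 * y - 1) * flat2 y + (y\<^sup>2 - y) * flat4 y)"

lemma profile_derivs:
  "(damp has_real_derivative damp1 y) (at y)"
  "(damp1 has_real_derivative damp2 y) (at y)"
  "(fix_up has_real_derivative fix_up1 y) (at y)"
  "(fix_up1 has_real_derivative fix_up2 y) (at y)"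
  unfolding damp_def[abs_def] damp1_def[abs_def] damp2_def[abs_def] fix_up_def[abs_def]
    fix_up1_def[abs_def] fix_up2_def[abs_def]
  by (auto intro!: derivative_eq_intros flat_derivs simp: algebra_simps power2_eq_square)

text \<open>With \<open>t = -y > 0\<close>, \<open>s = 1/t\<close> and \<open>E = exp (-s)\<close> one has \<open>1 - damp' = E (1 + s) \<in> [0, 1]\<close>,
  \<open>damp'' = E s^3\<close> and \<open>fix_up'' = e E (2 + 2 s + s^2 + s^3)\<close>.\<close>
lemma profile_curvature:
  "\<bar>((damp1 y)\<^sup>2 - damp2 y - 1) * exp (- damp y)\<bar> \<le> fix_up2 y"
proof (cases "y < 0")
  case True
  define s where "s = - 1 / y"
  define E where "E = exp (- s)"
  have s: "s > 0" and ys: "y = - 1 / s" using True by (auto simp: s_def)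
  have f1: "flat_fun 1 (- y) = E" and f2: "flat2 y = s\<^sup>2 * E"
    and f4: "flat4 y = (s ^ 4 - 2 * s ^ 3) * E"
    using s unfolding E_def flat2_def flat4_def flat_fun_def ys
    by (auto simp: power2_eq_square power_numeral_reduce algebra_simps)
  have E: "E > 0" by (simp add: E_def)
  have EE: "E * (1 + s) \<le> 1"
  proof -
    have "E * (1 + s) \<le> E * exp s" using E by (intro mult_left_mono exp_ge_add_one_self) auto
    also have "\<dots> = 1" by (simp add: E_def exp_minus)
    finally show ?thesis .
  qed
  have d1: "damp1 y = 1 - E * (1 + s)"
    using s unfolding damp1_def f1 f2 unfolding ys by (simp add: field_simps power2_eq_square)
  have d2: "damp2 y = E * s ^ 3"
    using s unfolding damp2_def f4 f2 unfolding ys by (simp add: field_simps power_numeral_reduce)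
  have u2: "fix_up2 y = exp 1 * (E * (2 + 2 * s + s\<^sup>2 + s ^ 3))"
    using s unfolding fix_up2_def f1 f4 f2 unfolding ys by (simp add: field_simps power_numeral_reduce)
  \<comment> \<open>Since \<open>k\<close> is 1 - \<open>damp1 y\<close>, the difference of squares
    is k^2 - 2 k, nonpositive for k in [0, 1]. The term - \<open>damp2 y\<close> is nonpositive as
    well, so the absolute value is a mere change of sign.\<close>
  define k where "k = E * (1 + s)"
  have k: "0 \<le> k" "k \<le> 1" using EE E s by (auto simp: k_def)
  have "\<bar>(damp1 y)\<^sup>2 - damp2 y - 1\<bar> = 2 * k - k\<^sup>2 + E * s ^ 3"
  proof -
    have "k\<^sup>2 \<le> 2 * k" using k by (simp add: power2_eq_square) (smt (verit) mult_left_le)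
    moreover have "E * s ^ 3 \<ge> 0" using E s by simp
    ultimately show ?thesis
      unfolding d1 d2 k_def[symmetric] by (simp add: power2_eq_square algebra_simps)
  qed
  also have "\<dots> \<le> 2 * k + E * s ^ 3" by simp
  also have "\<dots> = E * (2 + 2 * s + s ^ 3)" by (simp add: k_def algebra_simps)
  also have "\<dots> \<le> E * (2 + 2 * s + s\<^sup>2 + s ^ 3)" using E by (intro mult_left_mono) auto
  finally have "\<bar>(damp1 y)\<^sup>2 - damp2 y - 1\<bar> \<le> E * (2 + 2 * s + s\<^sup>2 + s ^ 3)" .
  then have "\<bar>(damp1 y)\<^sup>2 - damp2 y - 1\<bar> * exp (- damp y) \<le> E * (2 + 2 * s + s\<^sup>2 + s ^ 3) * exp 1"
    using E s by (intro mult_mono exp_damp_le) auto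
  then show ?thesis by (simp add: u2 abs_mult mult_ac)
next
  case False
  then have "flat_fun p (- y) = 0" for p by (simp add: flat_fun_def)
  then show ?thesis
    by (simp add: damp1_def damp2_def fix_up2_def flat2_def flat4_def)
qed

lemma has_dd_Im:
  assumes "\<And>y. (G has_real_derivative G' y) (at y)"
  shows "has_dd (\<lambda>z. G (Im z)) v (\<lambda>z. G' (Im z) * Im v)"
  by (rule has_dd_compose[OF assms has_dd_bounded_linear[OF bounded_linear_Im]])

lemma has_dd_Re:
  assumes "\<And>y. (G has_real_derivative G' y) (at y)"
  shows "has_dd (\<lambda>z. G (Re z)) v (\<lambda>z. G' (Re z) * Re v)"
  by (rule has_dd_compose[OF assms has_dd_bounded_linear[OF bounded_linear_Re]])

lemma phi_dd_1: "iter_dd [1, 1] phi = (\<lambda>z. - exp (- damp (Im z)) * cos (Re z))"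
proof -
  have e: "((\<lambda>y. exp (- damp y)) has_real_derivative - damp1 y * exp (- damp y)) (at y)" for y
    by (auto intro!: derivative_eq_intros profile_derivs)
  have c: "(fix_up has_real_derivative fix_up1 y) (at y)" for y by (rule profile_derivs)
  have "has_dd phi 1 (\<lambda>z. exp (- damp (Im z)) * (- sin (Re z)))"
    unfolding phi_def[abs_def] diff_conv_add_uminus
    using has_dd_add[OF has_dd_add[OF has_dd_mult[OF has_dd_Im[OF e, of 1] has_dd_Re[OF DERIV_cos]] has_dd_Im[OF c]] has_dd_const[of "-1"]]
    by simp
  then have 1: "iter_dd [1] phi = (\<lambda>z. exp (- damp (Im z)) * (- sin (Re z)))"
    by (rule has_dd_imp_iter_dd)
  have "((\<lambda>x. - sin x) has_real_derivative - cos x) (at x)" for x :: real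
    by (auto intro!: derivative_eq_intros)
  from has_dd_mult[OF has_dd_Im[OF e, of 1] has_dd_Re[OF this]]
  have "has_dd (\<lambda>z. exp (- damp (Im z)) * (- sin (Re z))) 1 (\<lambda>z. - exp (- damp (Im z)) * cos (Re z))"
    by simp
  then show ?thesis
    by (simp only: iter_dd_Cons[of _ "[1]"] 1 has_dd_imp_iter_dd)
qed

lemma phi_dd_i: "iter_dd [\<i>, \<i>] phi =
   (\<lambda>z. ((damp1 (Im z))\<^sup>2 - damp2 (Im z)) * exp (- damp (Im z)) * cos (Re z) + fix_up2 (Im z))"
proof -
  have e: "((\<lambda>y. exp (- damp y)) has_real_derivative - damp1 y * exp (- damp y)) (at y)" for y
    by (auto intro!: derivative_eq_intros profile_derivs)
  have e2: "((\<lambda>y. - damp1 y * exp (- damp y)) has_real_derivative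
      ((damp1 y)\<^sup>2 - damp2 y) * exp (- damp y)) (at y)" for y
    by (auto intro!: derivative_eq_intros profile_derivs simp: power2_eq_square algebra_simps)
  have c: "(fix_up has_real_derivative fix_up1 y) (at y)" for y by (rule profile_derivs)
  have c2: "(fix_up1 has_real_derivative fix_up2 y) (at y)" for y by (rule profile_derivs)
  have "has_dd phi \<i> (\<lambda>z. - damp1 (Im z) * exp (- damp (Im z)) * cos (Re z) + fix_up1 (Im z))"
    unfolding phi_def[abs_def] diff_conv_add_uminus
    using has_dd_add[OF has_dd_add[OF has_dd_mult[OF has_dd_Im[OF e, of \<i>] has_dd_Re[OF DERIV_cos]] has_dd_Im[OF c]] has_dd_const[of "-1"]]
    by simp
  then have 1: "iter_dd [\<i>] phi = (\<lambda>z. - damp1 (Im z) * exp (- damp (Im z)) * cos (Re z) + fix_up1 (Im z))"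
    by (rule has_dd_imp_iter_dd)
  from has_dd_add[OF has_dd_mult[OF has_dd_Im[OF e2, of \<i>] has_dd_Re[OF DERIV_cos]] has_dd_Im[OF c2]]
  have "has_dd (\<lambda>z. - damp1 (Im z) * exp (- damp (Im z)) * cos (Re z) + fix_up1 (Im z)) \<i>
    (\<lambda>z. ((damp1 (Im z))\<^sup>2 - damp2 (Im z)) * exp (- damp (Im z)) * cos (Re z) + fix_up2 (Im z))"
    by simp
  then show ?thesis
    by (simp only: iter_dd_Cons[of _ "[\<i>]"] 1 has_dd_imp_iter_dd)
qed

text \<open>The x-derivatives contribute - exp (- damp) cos x, which is the "- 1" in
  \<open>profile_curvature\<close>. Hence the Laplacian is K cos x + \<open>fix_up2\<close> with |K|
  at most \<open>fix_up2\<close>.\<close>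

lemma phi_subharmonic: "iter_dd [1, 1] phi z + iter_dd [\<i>, \<i>] phi z \<ge> 0"
proof -
  define K where "K = ((damp1 (Im z))\<^sup>2 - damp2 (Im z) - 1) * exp (- damp (Im z))"
  have "\<bar>K * cos (Re z)\<bar> \<le> \<bar>K\<bar> * 1"
    unfolding abs_mult by (intro mult_left_mono) auto
  also have "\<dots> \<le> fix_up2 (Im z)"
    using profile_curvature by (simp add: K_def)
  finally have "K * cos (Re z) + fix_up2 (Im z) \<ge> 0" by linarith
  then show ?thesis
    unfolding phi_dd_1 phi_dd_i K_def by (simp add: algebra_simps)
qed

section \<open>Formal harmonicity of the profile at the origin\<close>

lemma phi_upper_half_plane: "Im z \<ge> 0 \<Longrightarrow> phi z = Re (exp (\<i> * z) - 1)"
  by (simp add: phi_def damp_def fix_up_def flat_fun_def Re_exp)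

lemma phi_quadratic_growth: "\<bar>phi z\<bar> \<le> (3 * exp 1 + 1) * norm z ^ 2" if "norm z \<ge> 1"
proof -
  define y where "y = Im z"
  have y: "\<bar>y\<bar> \<le> norm z" unfolding y_def by (rule abs_Im_le_cmod)
  have E: "0 \<le> flat_fun 1 (- y)" "flat_fun 1 (- y) \<le> 1" by (auto simp: flat_fun_def)
  have n2: "1 \<le> norm z ^ 2" "norm z \<le> norm z ^ 2"
    using that self_le_power[of "norm z" 2] by auto
  have "\<bar>exp (- damp y) * cos (Re z)\<bar> \<le> exp 1 * 1"
    unfolding abs_mult by (intro mult_mono) (use exp_damp_le[of y] in \<open>auto simp del: exp_le_cancel_iff\<close>)
  also have "\<dots> \<le> exp 1 * norm z ^ 2" using n2 by simp
  finally have 1: "\<bar>exp (- damp y) * cos (Re z)\<bar> \<le> exp 1 * norm z ^ 2" .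
  have "\<bar>(y\<^sup>2 - y) * flat_fun 1 (- y)\<bar> \<le> (2 * norm z ^ 2) * 1"
  proof -
    have "\<bar>y\<^sup>2 - y\<bar> \<le> \<bar>y\<bar>\<^sup>2 + \<bar>y\<bar>" by (simp add: abs_le_iff) (smt (verit) zero_le_power2)
    also have "\<dots> \<le> norm z ^ 2 + norm z ^ 2"
      using y n2 by (intro add_mono power_mono) auto
    finally show ?thesis unfolding abs_mult using E by (intro mult_mono) auto
  qed
  then have "\<bar>fix_up y\<bar> \<le> exp 1 * (2 * norm z ^ 2)"
    by (simp add: fix_up_def abs_mult)
  with 1 n2 show ?thesis unfolding phi_def y_def by (simp add: algebra_simps)
qed

text \<open>The discrepancy lives in the lower half-plane, and both of its summands contain the flat
  factor exp (-1/t) with t = - Im z \<le> |z|, which is at most N! t^N.\<close>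

lemma phi_almost_harmonic:
  assumes "norm z \<le> 1"
  shows "\<bar>phi z - Re (exp (\<i> * z) - 1)\<bar> \<le> 3 * exp 1 * fact N * norm z ^ N"
proof (cases "Im z \<ge> 0")
  case False
  define t where "t = - Im z"
  have t: "0 < t" "t \<le> norm z" "t \<le> 1"
    using False abs_Im_le_cmod[of z] assms by (auto simp: t_def)
  define E where "E = flat_fun 1 t"
  have "E \<le> fact N * t ^ N" unfolding E_def by (rule flat_fun_flat[OF t(1)])
  also have "\<dots> \<le> fact N * norm z ^ N" using t by (intro mult_left_mono power_mono) auto
  finally have E: "0 \<le> E" "E \<le> fact N * norm z ^ N"
    using t by (auto simp: E_def flat_fun_def)
  have "t * E \<le> E" using t E by (simp add: mult_left_le_one_le)
  \<comment> \<open>Here - \<open>damp (Im z)\<close> = t - t E, so the damped exponential is exp t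
    exp (- t E) and the difference factors.\<close>
  have "phi z - Re (exp (\<i> * z) - 1) = exp t * (exp (- (t * E)) - 1) * cos (Re z) + exp 1 * ((t\<^sup>2 + t) * E)"
    unfolding phi_def damp_def fix_up_def
    by (simp add: Re_exp t_def E_def algebra_simps exp_diff exp_add exp_minus divide_simps)
  also have "\<bar>\<dots>\<bar> \<le> exp 1 * E * 1 + exp 1 * (2 * E)"
  proof (intro order_trans[OF abs_triangle_ineq] add_mono)
    have "\<bar>exp (- (t * E)) - 1\<bar> \<le> E"
      using exp_ge_add_one_self[of "- (t * E)"] \<open>t * E \<le> E\<close> t E by simp
    then show "\<bar>exp t * (exp (- (t * E)) - 1) * cos (Re z)\<bar> \<le> exp 1 * E * 1"
      unfolding abs_mult using t E by (intro mult_mono) auto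
    have "t\<^sup>2 + t \<le> 2" using t by (simp add: power2_eq_square) (smt (verit) mult_left_le)
    then show "\<bar>exp 1 * ((t\<^sup>2 + t) * E)\<bar> \<le> exp 1 * (2 * E)"
      using t E by (simp add: abs_mult mult_right_mono)
  qed
  also have "\<dots> = 3 * exp 1 * E" by simp
  also have "\<dots> \<le> 3 * exp 1 * (fact N * norm z ^ N)" using E by (intro mult_left_mono) auto
  finally show ?thesis by (simp add: mult_ac)
qed (simp add: phi_upper_half_plane)

text \<open>The bound has to hold on the entire plane, because the arguments \<open>lam k\<close> z
  leave every neighbourhood of 0. In the unit disc it combines flatness with the Taylor formula of
  exp; outside, \<open>phi\<close> and the polynomial are separately dominated by |z|^N. The
  quadratic growth of \<open>phi\<close> is the reason for N \<ge> 2.\<close>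

lemma phi_taylor:
  assumes "N \<ge> 2"
  shows "\<exists>C. \<forall>z. \<bar>phi z - Re (\<Sum>j\<in>{1..<N}. (\<i> * z) ^ j / fact j)\<bar> \<le> C * norm z ^ N"
proof (intro exI allI)
  fix z :: complex
  define P where "P = (\<Sum>j\<in>{1..<N}. (\<i> * z) ^ j / fact j)"
  have rng: "{..N - 1} = insert 0 {1..<N}" using assms by auto
  have full: "(\<Sum>j\<le>N - 1. (\<i> * z) ^ j / fact j) = 1 + P"
    unfolding rng P_def by simp
  show "\<bar>phi z - Re (\<Sum>j\<in>{1..<N}. (\<i> * z) ^ j / fact j)\<bar> \<le>
      (3 * exp 1 * fact N + exp 1 + (3 * exp 1 + 1) + N) * norm z ^ N"
  proof (cases "norm z \<le> 1")
    case True
    have "norm (exp (\<i> * z) - (1 + P)) \<le> exp \<bar>Re (\<i> * z)\<bar> * norm (\<i> * z) ^ Suc (N - 1) / fact (N - 1)"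
      unfolding full[symmetric] by (rule Taylor_exp)
    also have "\<dots> \<le> exp 1 * norm z ^ N / 1"
      using assms True abs_Im_le_cmod[of z] by (intro frac_le mult_mono) (auto simp: norm_mult)
    finally have "\<bar>Re (exp (\<i> * z) - (1 + P))\<bar> \<le> exp 1 * norm z ^ N"
      using abs_Re_le_cmod[of "exp (\<i> * z) - (1 + P)"] by simp
    then have "\<bar>phi z - Re P\<bar> \<le> 3 * exp 1 * fact N * norm z ^ N + exp 1 * norm z ^ N"
      using phi_almost_harmonic[OF True, of N] by simp
    also have "\<dots> \<le> (3 * exp 1 * fact N + exp 1 + (3 * exp 1 + 1) + N) * norm z ^ N"
      by (simp add: distrib_right)
    finally show ?thesis unfolding P_def .
  next
    case False
    then have z: "norm z \<ge> 1" by simp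
    have "\<bar>Re P\<bar> \<le> norm P" by (rule abs_Re_le_cmod)
    also have "\<dots> \<le> (\<Sum>j\<in>{1..<N}. norm z ^ N)"
      unfolding P_def
    proof (rule sum_norm_le)
      fix j assume "j \<in> {1..<N}"
      then have "norm z ^ j / fact j \<le> norm z ^ N / 1"
        using z by (intro frac_le power_increasing) auto
      then show "norm ((\<i> * z) ^ j / fact j) \<le> norm z ^ N"
        by (simp add: norm_divide norm_power norm_mult)
    qed
    also have "\<dots> \<le> N * norm z ^ N" by (simp add: mult_right_mono)
    finally have P: "\<bar>Re P\<bar> \<le> N * norm z ^ N" .
    have "\<bar>phi z\<bar> \<le> (3 * exp 1 + 1) * norm z ^ 2" by (rule phi_quadratic_growth[OF z])
    also have "\<dots> \<le> (3 * exp 1 + 1) * norm z ^ N"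
      using z assms by (intro mult_left_mono power_increasing) (auto intro!: add_nonneg_nonneg)
    finally have "\<bar>phi z - Re P\<bar> \<le> (3 * exp 1 + 1) * norm z ^ N + N * norm z ^ N"
      using P by linarith
    also have "\<dots> \<le> (3 * exp 1 * fact N + exp 1 + (3 * exp 1 + 1) + N) * norm z ^ N"
      by (simp add: distrib_right)
    finally show ?thesis unfolding P_def .
  qed
qed

section \<open>Superposition of dilations\<close>

text \<open>Summability against every power absorbs both the polynomial growth of the summands and
  the factor \<open>l k\<close> produced by each differentiation.\<close>

definition rapid :: "(nat \<Rightarrow> real) \<Rightarrow> (nat \<Rightarrow> real) \<Rightarrow> bool" where
  "rapid a l \<longleftrightarrow> (\<forall>k. l k \<ge> 1) \<and> (\<forall>m. summable (\<lambda>k. \<bar>a k\<bar> * l k ^ m))"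

definition dsum :: "(nat \<Rightarrow> real) \<Rightarrow> (nat \<Rightarrow> real) \<Rightarrow> (complex \<Rightarrow> real) \<Rightarrow> complex \<Rightarrow> real" where
  "dsum a l f z = (\<Sum>k. a k * f (l k *\<^sub>R z))"

lemma rapid_times: "rapid a l \<Longrightarrow> rapid (\<lambda>k. a k * l k) l"
  unfolding rapid_def
proof (intro conjI allI; elim conjE)
  fix m
  assume l: "\<forall>k. l k \<ge> 1" and "\<forall>m. summable (\<lambda>k. \<bar>a k\<bar> * l k ^ m)"
  then have "summable (\<lambda>k. \<bar>a k\<bar> * l k ^ Suc m)" by blast
  moreover have "\<bar>l k\<bar> = l k" for k using l[rule_format, of k] by simp
  ultimately show "summable (\<lambda>k. \<bar>a k * l k\<bar> * l k ^ m)"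
    by (simp add: abs_mult mult.assoc)
qed auto

text \<open>Since \<open>l k\<close> \<ge> 1, one has 1 + \<open>l k\<close> |z| \<le>
  \<open>l k\<close> (1 + R), so polynomial growth costs a fixed power of \<open>l k\<close>. The
  resulting majorant serves the Weierstrass test for the series and for its termwise
  derivative.\<close>

lemma rapid_dominated:
  assumes "rapid a l" "f \<in> tempered" "R \<ge> 0"
  shows "\<exists>M. summable M \<and> (\<forall>k z. norm z \<le> R \<longrightarrow> norm (a k * f (l k *\<^sub>R z)) \<le> M k)"
proof -
  obtain C m where C: "\<And>z. \<bar>f z\<bar> \<le> C * (1 + norm z) ^ m"
    using assms(2) by (auto simp: tempered_def)
  have "C \<ge> 0" using C[of 0] by simp
  show ?thesis
  proof (intro exI conjI allI impI)
    show "summable (\<lambda>k. \<bar>a k\<bar> * l k ^ m * (C * (1 + R) ^ m))"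
      using assms(1) by (intro summable_mult2) (simp add: rapid_def)
    fix k and z :: complex assume z: "norm z \<le> R"
    have l: "l k \<ge> 1" using assms(1) by (simp add: rapid_def)
    have "1 + norm (l k *\<^sub>R z) \<le> l k * (1 + R)"
      using l mult_left_mono[OF z, of "l k"] by (simp only: norm_scaleR distrib_left) linarith
    then have "(1 + norm (l k *\<^sub>R z)) ^ m \<le> l k ^ m * (1 + R) ^ m"
      unfolding power_mult_distrib[symmetric] by (intro power_mono) auto
    then have "\<bar>f (l k *\<^sub>R z)\<bar> \<le> C * (l k ^ m * (1 + R) ^ m)"
      using C[of "l k *\<^sub>R z"] mult_left_mono \<open>C \<ge> 0\<close> by (meson order_trans)
    then have "\<bar>a k\<bar> * \<bar>f (l k *\<^sub>R z)\<bar> \<le> \<bar>a k\<bar> * (C * (l k ^ m * (1 + R) ^ m))"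
      by (intro mult_left_mono) auto
    then show "norm (a k * f (l k *\<^sub>R z)) \<le> \<bar>a k\<bar> * l k ^ m * (C * (1 + R) ^ m)"
      by (simp add: abs_mult mult_ac)
  qed
qed

lemma dsum_summable:
  assumes "rapid a l" "f \<in> tempered"
  shows "summable (\<lambda>k. a k * f (l k *\<^sub>R z))"
proof -
  obtain M where M: "summable M" "\<And>k w. norm w \<le> norm z \<Longrightarrow> norm (a k * f (l k *\<^sub>R w)) \<le> M k"
    using rapid_dominated[OF assms, of "norm z"] by auto
  show ?thesis by (rule summable_comparison_test'[OF M(1)]) (use M(2) in simp)
qed

lemma dsum_continuous:
  assumes "rapid a l" "f \<in> tempered"
  shows "continuous_on UNIV (dsum a l f)"
proof -
  have "continuous_on (ball 0 R) (dsum a l f)" if R: "R > 0" for R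
  proof -
    obtain M where M: "summable M" "\<And>k w. norm w \<le> R \<Longrightarrow> norm (a k * f (l k *\<^sub>R w)) \<le> M k"
      using rapid_dominated[OF assms less_imp_le[OF R]] by blast
    have ul: "uniform_limit (ball 0 R) (\<lambda>n z. \<Sum>k<n. a k * f (l k *\<^sub>R z)) (\<lambda>z. \<Sum>k. a k * f (l k *\<^sub>R z)) sequentially"
      by (rule Weierstrass_m_test[OF M(2) M(1)]) simp
    have "continuous_on UNIV (\<lambda>z. f (l k *\<^sub>R z))" for k
    proof (rule continuous_on_compose2[of UNIV f])
      show "continuous_on UNIV f" using assms(2) by (simp add: tempered_def)
      show "continuous_on UNIV (\<lambda>z::complex. l k *\<^sub>R z)" by (intro continuous_intros)
    qed simp
    then have "continuous_on (ball 0 R) (\<lambda>z. \<Sum>k<n. a k * f (l k *\<^sub>R z))" for n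
      by (intro continuous_on_sum continuous_on_mult continuous_on_const) (rule continuous_on_subset[OF _ subset_UNIV])
    then have "eventually (\<lambda>n. continuous_on (ball 0 R) (\<lambda>z. \<Sum>k<n. a k * f (l k *\<^sub>R z))) sequentially"
      by simp
    then show ?thesis
      unfolding dsum_def[abs_def] by (rule uniform_limit_theorem[OF _ ul]) simp
  qed
  then have "isCont (dsum a l f) z" for z
    using continuous_on_interior[of "ball 0 (norm z + 1)" "dsum a l f" z]
    by (simp add: add_nonneg_pos)
  then show ?thesis by (simp add: continuous_at_imp_continuous_on)
qed

lemma dsum_has_dd:
  assumes ra: "rapid a l" and f: "f \<in> tempered" and g: "g \<in> tempered" and fg: "has_dd f v g"
  shows "has_dd (dsum a l f) v (dsum (\<lambda>k. a k * l k) l g)"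
  unfolding has_dd_def
proof
  fix x :: complex
  \<comment> \<open>For |t| \<le> 1 the segment x + t v stays in the ball of this radius, so one
    majorant serves the entire parameter interval.\<close>
  define R where "R = norm x + norm v"
  have "R \<ge> 0" by (simp add: R_def)
  obtain M where M: "summable M" "\<And>k w. norm w \<le> R \<Longrightarrow> norm (a k * l k * g (l k *\<^sub>R w)) \<le> M k"
    using rapid_dominated[OF rapid_times[OF ra] g \<open>R \<ge> 0\<close>] by auto
  have "((\<lambda>t. \<Sum>k. a k * f (l k *\<^sub>R (x + t *\<^sub>R v))) has_real_derivative
        (\<Sum>k. a k * l k * g (l k *\<^sub>R (x + 0 *\<^sub>R v)))) (at 0)"
  proof (rule has_field_derivative_series'(2)[where S = "cball (0::real) 1" and f = "\<lambda>k t. a k * f (l k *\<^sub>R (x + t *\<^sub>R v))"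
        and f' = "\<lambda>k t. a k * l k * g (l k *\<^sub>R (x + t *\<^sub>R v))" and ?x0.0 = 0])
    show "uniformly_convergent_on (cball 0 1) (\<lambda>n t. \<Sum>i<n. a i * l i * g (l i *\<^sub>R (x + t *\<^sub>R v)))"
    proof (rule Weierstrass_m_test'[OF _ M(1)])
      fix k and t :: real assume t: "t \<in> cball 0 1"
      have "norm (x + t *\<^sub>R v) \<le> norm x + \<bar>t\<bar> * norm v"
        using norm_triangle_ineq[of x "t *\<^sub>R v"] by simp
      also have "\<dots> \<le> R" using t by (auto simp: R_def mult_left_le_one_le)
      finally show "norm (a k * l k * g (l k *\<^sub>R (x + t *\<^sub>R v))) \<le> M k" by (rule M(2))
    qed
    show "summable (\<lambda>n. a n * f (l n *\<^sub>R (x + 0 *\<^sub>R v)))" by (rule dsum_summable[OF ra f])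
  next
    fix k and t :: real
    have "((\<lambda>s. f (l k *\<^sub>R x + s *\<^sub>R v)) has_real_derivative g (l k *\<^sub>R x + (l k * t) *\<^sub>R v)) (at (l k * t))"
      by (rule has_dd_at[OF fg])
    from DERIV_chain2[OF this DERIV_cmult_Id]
    have "((\<lambda>t. f (l k *\<^sub>R x + (l k * t) *\<^sub>R v)) has_real_derivative g (l k *\<^sub>R x + (l k * t) *\<^sub>R v) * l k) (at t)" .
    then have "((\<lambda>t. a k * f (l k *\<^sub>R (x + t *\<^sub>R v))) has_real_derivative a k * l k * g (l k *\<^sub>R (x + t *\<^sub>R v))) (at t)"
      by (auto intro!: derivative_eq_intros simp: scaleR_add_right)
    then show "((\<lambda>t. a k * f (l k *\<^sub>R (x + t *\<^sub>R v))) has_real_derivative a k * l k * g (l k *\<^sub>R (x + t *\<^sub>R v))) (at t within cball 0 1)"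
      by (rule has_field_derivative_at_within)
  qed auto
  then show "((\<lambda>t. dsum a l f (x + t *\<^sub>R v)) has_real_derivative dsum (\<lambda>k. a k * l k) l g x) (at 0)"
    by (simp add: dsum_def)
qed

lemma dsum_iter_dd:
  assumes "rapid a l" "smooth_in tempered f"
  shows "iter_dd [v] (dsum a l f) = dsum (\<lambda>k. a k * l k) l (iter_dd [v] f)"
  by (rule has_dd_imp_iter_dd dsum_has_dd assms smooth_in_mem smooth_in_deriv)+

lemma dsum_smooth:
  assumes "rapid a l" "smooth_in tempered f"
  shows "smooth_in cont_funs (dsum a l f)"
proof -
  have "smoothK cont_funs k (dsum a l f)" if "rapid a l" "smooth_in tempered f" for k a f
    using that
  proof (induction k arbitrary: a f)
    case 0
    then show ?case using dsum_continuous[OF 0(1) smooth_in_mem[OF 0(2)]] by (simp add: cont_funs_def)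
  next
    case (Suc k)
    have "has_dd (dsum a l f) v (dsum (\<lambda>k. a k * l k) l (iter_dd [v] f))" for v
      by (rule dsum_has_dd[OF Suc.prems(1) smooth_in_mem[OF Suc.prems(2)]
            smooth_in_mem[OF smooth_in_deriv(1)[OF Suc.prems(2)]] smooth_in_deriv(2)[OF Suc.prems(2)]])
    moreover have "smoothK cont_funs k (dsum (\<lambda>k. a k * l k) l (iter_dd [v] f))" for v
      by (rule Suc.IH[OF rapid_times[OF Suc.prems(1)] smooth_in_deriv(1)[OF Suc.prems(2)]])
    ultimately show ?case
      using dsum_continuous[OF Suc.prems(1) smooth_in_mem[OF Suc.prems(2)]]
      unfolding smoothK.simps cont_funs_def by blast
  qed
  with assms show ?thesis by (simp add: smooth_in_def)
qed

section \<open>Choice of the dilations and growth of the coefficients\<close>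

definition lam :: "nat \<Rightarrow> real" where "lam k = 2 * (fact (Suc k))\<^sup>2"
text \<open>For k \<ge> m the product \<open>eps k * lam k ^ m\<close> is
  \<open>1 / lam k ^ (k - m)\<close>, at most 2^(m - k), hence summable; the factor 2 in
  \<open>lam\<close> provides this ratio. For m = k + 1 the product is \<open>lam k\<close> = 2 ((k
  + 1)!)^2: one factorial is spent on the division by \<open>fact j\<close> in \<open>ucoef\<close>,
  the other makes the coefficients grow factorially.\<close>

definition eps :: "nat \<Rightarrow> real" where "eps k = 1 / lam k ^ k"

lemma lam_ge: "lam k \<ge> 2"
  by (simp add: lam_def fact_ge_1 del: fact_Suc)

lemma eps_pos: "eps k > 0"
  using lam_ge[of k] by (simp add: eps_def)

lemma rapid_eps_lam: "rapid eps lam"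
  unfolding rapid_def
proof (intro conjI allI)
  show "lam k \<ge> 1" for k using lam_ge[of k] by simp
  fix m
  show "summable (\<lambda>k. \<bar>eps k\<bar> * lam k ^ m)"
  proof (rule summable_comparison_test'[where N = m and g = "\<lambda>k. 2 ^ m * (1 / 2) ^ k"])
    show "summable (\<lambda>k. 2 ^ m * (1 / 2 :: real) ^ k)"
      by (intro summable_mult summable_geometric) simp
    fix k assume k: "k \<ge> m"
    have l: "lam k > 0" using lam_ge[of k] by simp
    have "norm (\<bar>eps k\<bar> * lam k ^ m) = 1 / lam k ^ (k - m)"
      using l k by (simp add: eps_def power_diff)
    also have "\<dots> \<le> 1 / 2 ^ (k - m)"
      using lam_ge[of k] l by (intro frac_le power_mono) auto
    also have "\<dots> = 2 ^ m * (1 / 2) ^ k"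
      using k by (simp add: power_diff power_divide)
    finally show "norm (\<bar>eps k\<bar> * lam k ^ m) \<le> 2 ^ m * (1 / 2) ^ k" .
  qed
qed

definition usum :: "complex \<Rightarrow> real" where "usum = dsum eps lam phi"

definition moment :: "nat \<Rightarrow> real" where "moment j = (\<Sum>k. eps k * lam k ^ j)"

text \<open>The coefficient of z^j obtained by formally summing the expansions of
  \<open>eps k\<close> (exp (i \<open>lam k\<close> z) - 1) over k.\<close>

definition ucoef :: "nat \<Rightarrow> complex" where "ucoef j = \<i> ^ j / fact j * of_real (moment j)"

lemma usum_smooth: "smooth_in cont_funs usum"
  unfolding usum_def by (rule dsum_smooth[OF rapid_eps_lam smooth_phi])

lemma usum_iter_dd2:
  "iter_dd [v, w] usum = dsum (\<lambda>k. eps k * lam k * lam k) lam (iter_dd [v, w] phi)"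
  using dsum_iter_dd[OF rapid_eps_lam smooth_phi, of w]
    dsum_iter_dd[OF rapid_times[OF rapid_eps_lam] smooth_in_deriv(1)[OF smooth_phi, of w], of v]
  by (simp only: usum_def iter_dd_Cons[of v "[w]"])

lemma usum_subharmonic: "iter_dd [1, 1] usum z + iter_dd [\<i>, \<i>] usum z \<ge> 0"
proof -
  have t: "iter_dd [v, w] phi \<in> tempered" for v w
    by (intro smooth_in_mem smooth_in_iter_dd smooth_phi)
  note s = dsum_summable[OF rapid_times[OF rapid_times[OF rapid_eps_lam]] t]
  have "iter_dd [1, 1] usum z + iter_dd [\<i>, \<i>] usum z =
     (\<Sum>k. eps k * lam k * lam k * iter_dd [1, 1] phi (lam k *\<^sub>R z) + eps k * lam k * lam k * iter_dd [\<i>, \<i>] phi (lam k *\<^sub>R z))"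
    unfolding usum_iter_dd2 dsum_def by (rule suminf_add[OF s s])
  also have "\<dots> \<ge> 0"
  proof (rule suminf_nonneg)
    show "summable (\<lambda>k. eps k * lam k * lam k * iter_dd [1, 1] phi (lam k *\<^sub>R z) + eps k * lam k * lam k * iter_dd [\<i>, \<i>] phi (lam k *\<^sub>R z))"
      by (rule summable_add[OF s s])
    fix k
    have "eps k * lam k * lam k * (iter_dd [1, 1] phi (lam k *\<^sub>R z) + iter_dd [\<i>, \<i>] phi (lam k *\<^sub>R z)) \<ge> 0"
      using eps_pos[of k] lam_ge[of k] phi_subharmonic by (intro mult_nonneg_nonneg) auto
    then show "eps k * lam k * lam k * iter_dd [1, 1] phi (lam k *\<^sub>R z) + eps k * lam k * lam k * iter_dd [\<i>, \<i>] phi (lam k *\<^sub>R z) \<ge> 0"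
      by (simp add: distrib_left)
  qed
  finally show ?thesis .
qed

lemma moment_sums: "(\<lambda>k. eps k * lam k ^ j) sums moment j"
  using rapid_eps_lam eps_pos unfolding rapid_def moment_def
  by (simp add: summable_sums abs_of_pos)

text \<open>The global bound of \<open>phi_taylor\<close> is applied at \<open>lam k\<close> z and
  summed with the weights; the factors \<open>lam k ^ N\<close> add up to
  \<open>moment N\<close>.\<close>

lemma usum_taylor:
  assumes "N \<ge> 2"
  shows "\<exists>C. \<forall>z. \<bar>usum z - Re (\<Sum>j\<in>{1..<N}. ucoef j * z ^ j)\<bar> \<le> C * norm z ^ N"
proof -
  obtain C where C: "\<And>z. \<bar>phi z - Re (\<Sum>j\<in>{1..<N}. (\<i> * z) ^ j / fact j)\<bar> \<le> C * norm z ^ N"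
    using phi_taylor[OF assms] by blast
  have "\<bar>usum z - Re (\<Sum>j\<in>{1..<N}. ucoef j * z ^ j)\<bar> \<le> moment N * (C * norm z ^ N)" for z
  proof -
    have p: "(\<lambda>k. eps k * phi (lam k *\<^sub>R z)) sums usum z"
      unfolding usum_def dsum_def
      by (intro summable_sums dsum_summable rapid_eps_lam smooth_in_mem smooth_phi)
    have "(\<lambda>k. \<Sum>j\<in>{1..<N}. of_real (eps k * lam k ^ j) * (\<i> ^ j / fact j * z ^ j)) sums
        (\<Sum>j\<in>{1..<N}. of_real (moment j) * (\<i> ^ j / fact j * z ^ j))"
      by (intro sums_sum sums_mult2 sums_of_real moment_sums)
    also have "(\<Sum>j\<in>{1..<N}. of_real (moment j) * (\<i> ^ j / fact j * z ^ j)) = (\<Sum>j\<in>{1..<N}. ucoef j * z ^ j)"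
      by (simp add: ucoef_def mult_ac)
    also have "(\<lambda>k. \<Sum>j\<in>{1..<N}. of_real (eps k * lam k ^ j) * (\<i> ^ j / fact j * z ^ j)) =
        (\<lambda>k. eps k *\<^sub>R (\<Sum>j\<in>{1..<N}. (\<i> * (lam k *\<^sub>R z)) ^ j / fact j))"
      by (simp add: scaleR_conv_of_real sum_distrib_left power_mult_distrib mult_ac)
    finally have q: "(\<lambda>k. eps k * Re (\<Sum>j\<in>{1..<N}. (\<i> * (lam k *\<^sub>R z)) ^ j / fact j)) sums
        Re (\<Sum>j\<in>{1..<N}. ucoef j * z ^ j)"
      by (auto dest: sums_Re simp del: Re_sum)
    have d: "(\<lambda>k. eps k * phi (lam k *\<^sub>R z) - eps k * Re (\<Sum>j\<in>{1..<N}. (\<i> * (lam k *\<^sub>R z)) ^ j / fact j)) sums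
        (usum z - Re (\<Sum>j\<in>{1..<N}. ucoef j * z ^ j))"
      by (rule sums_diff[OF p q])
    have m: "(\<lambda>k. eps k * lam k ^ N * (C * norm z ^ N)) sums (moment N * (C * norm z ^ N))"
      by (intro sums_mult2 moment_sums)
    have "norm (usum z - Re (\<Sum>j\<in>{1..<N}. ucoef j * z ^ j)) \<le> moment N * (C * norm z ^ N)"
      unfolding sums_unique[OF d] sums_unique[OF m]
    proof (rule norm_suminf_le)
      show "summable (\<lambda>k. eps k * lam k ^ N * (C * norm z ^ N))" using m by (rule sums_summable)
      fix k
      have "norm (eps k * phi (lam k *\<^sub>R z) - eps k * Re (\<Sum>j\<in>{1..<N}. (\<i> * (lam k *\<^sub>R z)) ^ j / fact j))
        = eps k * \<bar>phi (lam k *\<^sub>R z) - Re (\<Sum>j\<in>{1..<N}. (\<i> * (lam k *\<^sub>R z)) ^ j / fact j)\<bar>"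
        using eps_pos[of k] by (simp only: right_diff_distrib[symmetric] real_norm_def abs_mult abs_of_pos)
      also have "\<dots> \<le> eps k * (C * norm (lam k *\<^sub>R z) ^ N)"
        using eps_pos[of k] by (intro mult_left_mono C) auto
      also have "\<dots> = eps k * lam k ^ N * (C * norm z ^ N)"
        using lam_ge[of k] by (simp add: power_mult_distrib)
      finally show "norm (eps k * phi (lam k *\<^sub>R z) - eps k * Re (\<Sum>j\<in>{1..<N}. (\<i> * (lam k *\<^sub>R z)) ^ j / fact j))
        \<le> eps k * lam k ^ N * (C * norm z ^ N)" .
    qed
    then show ?thesis by simp
  qed
  then have "\<bar>usum z - Re (\<Sum>j\<in>{1..<N}. ucoef j * z ^ j)\<bar> \<le> (moment N * C) * norm z ^ N" for z
    by (simp add: mult_ac)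
  then show ?thesis by blast
qed

text \<open>All terms of \<open>moment j\<close> are positive, and the one of index j - 1 alone
  equals \<open>lam (j - 1)\<close> = 2 (j!)^2.\<close>

lemma ucoef_ge:
  assumes "j \<ge> 1"
  shows "norm (ucoef j) \<ge> fact j"
proof -
  obtain i where j: "j = Suc i" using assms by (cases j) auto
  have l: "lam i > 0" using lam_ge[of i] by simp
  have "eps i * lam i ^ j \<le> moment j"
    using moment_sums[of j] eps_pos lam_ge unfolding sums_iff
    using sum_le_suminf[of "\<lambda>k. eps k * lam k ^ j" "{i}"]
    by (simp add: less_imp_le order_trans[of 0 2])
  also have "eps i * lam i ^ j = lam i" using l by (simp add: eps_def j)
  finally have "moment j \<ge> 2 * (fact j)\<^sup>2" by (simp add: lam_def j)
  then have "moment j \<ge> fact j * fact j" by (simp add: power2_eq_square) (smt (verit) fact_ge_zero mult_nonneg_nonneg)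
  then have "\<bar>moment j\<bar> / fact j \<ge> fact j" by (simp add: field_simps)
  then show ?thesis by (simp add: ucoef_def norm_mult norm_divide norm_power)
qed

lemma usum_0: "usum 0 = 0"
  by (simp add: usum_def dsum_def phi_def damp_def fix_up_def)

section \<open>Comparison of defining functions\<close>

lemma Cinf_on_has_derivative:
  assumes "Cinf_on U r" "x + s *\<^sub>R e \<in> U"
  shows "((\<lambda>t. r (x + t *\<^sub>R e)) has_real_derivative iter_dd [e] r (x + s *\<^sub>R e)) (at s)"
proof -
  have r: "iter_dd [] r = r" by (rule ext) simp
  let ?y = "x + s *\<^sub>R e"
  have "(\<lambda>t::real. iter_dd [] r (?y + t *\<^sub>R e)) differentiable (at 0)"
    using assms unfolding Cinf_on_def by blast
  then have "((\<lambda>t. r (?y + t *\<^sub>R e)) has_real_derivative iter_dd [e] r ?y) (at 0)"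
    unfolding r by (simp add: iter_dd.simps DERIV_deriv_iff_real_differentiable)
  then have "((\<lambda>t. r (?y + (t - s) *\<^sub>R e)) has_real_derivative iter_dd [e] r ?y) (at s)"
    using DERIV_shift[of "\<lambda>t. r (?y + (t - s) *\<^sub>R e)" "iter_dd [e] r ?y" 0 s]
    by (simp add: add.commute)
  then show ?thesis by (simp add: algebra_simps)
qed

text \<open>\<open>r0 z\<close> is the distance from \<open>z\<close> to the hypersurface measured in the direction \<open>e\<close>, so the
  mean value theorem along \<open>e\<close> replaces the division of \<open>r\<close> by \<open>r0\<close>.\<close>
lemma defining_function_factor:
  fixes r0 :: "complex^'n \<Rightarrow> real"
  assumes shift: "\<And>z s. r0 (z + s *\<^sub>R e) = r0 z + s"
    and ldf: "local_defining_function {z. r0 z = 0} p U r"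
    and ball: "ball 0 \<rho> \<subseteq> U" and z: "norm z + \<bar>r0 z\<bar> * norm e < \<rho>"
  shows "\<exists>\<xi>. norm \<xi> \<le> norm z + \<bar>r0 z\<bar> * norm e \<and> r z = r0 z * iter_dd [e] r \<xi>"
proof -
  define \<sigma> where "\<sigma> = r0 z"
  have C: "Cinf_on U r" and M: "\<And>w. w \<in> U \<Longrightarrow> r0 w = 0 \<Longrightarrow> r w = 0"
    using ldf unfolding local_defining_function_def by auto
  have nb: "norm (z + (- (\<tau> * \<sigma>)) *\<^sub>R e) \<le> norm z + \<bar>\<sigma>\<bar> * norm e" if "0 \<le> \<tau>" "\<tau> \<le> 1" for \<tau>
  proof -
    have "norm (z + (- (\<tau> * \<sigma>)) *\<^sub>R e) \<le> norm z + (\<tau> * \<bar>\<sigma>\<bar>) * norm e"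
      using norm_triangle_ineq[of z "(- (\<tau> * \<sigma>)) *\<^sub>R e"] that by (simp add: abs_mult)
    also have "\<dots> \<le> norm z + (1 * \<bar>\<sigma>\<bar>) * norm e"
      using that by (intro add_left_mono mult_right_mono) auto
    finally show ?thesis by simp
  qed
  have inU: "z + (- (\<tau> * \<sigma>)) *\<^sub>R e \<in> U" if "0 \<le> \<tau>" "\<tau> \<le> 1" for \<tau>
    using nb[OF that] z ball by (auto simp: \<sigma>_def)
  have der: "((\<lambda>\<tau>. r (z + (- (\<tau> * \<sigma>)) *\<^sub>R e)) has_real_derivative
      iter_dd [e] r (z + (- (\<tau> * \<sigma>)) *\<^sub>R e) * (- \<sigma>)) (at \<tau>)" if "0 \<le> \<tau>" "\<tau> \<le> 1" for \<tau>
  proof (rule DERIV_chain2[where f = "\<lambda>t. r (z + t *\<^sub>R e)" and g = "\<lambda>\<tau>. - (\<tau> * \<sigma>)",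
        OF Cinf_on_has_derivative[OF C inU[OF that]]])
    show "((\<lambda>\<tau>. - (\<tau> * \<sigma>)) has_real_derivative - \<sigma>) (at \<tau>)"
      by (auto intro!: derivative_eq_intros)
  qed
  obtain \<tau> where \<tau>: "0 < \<tau>" "\<tau> < 1"
    and mvt: "r (z + (- (1 * \<sigma>)) *\<^sub>R e) - r (z + (- (0 * \<sigma>)) *\<^sub>R e) =
      (1 - 0) * (iter_dd [e] r (z + (- (\<tau> * \<sigma>)) *\<^sub>R e) * (- \<sigma>))"
    using MVT2[where f = "\<lambda>\<tau>. r (z + (- (\<tau> * \<sigma>)) *\<^sub>R e)", OF zero_less_one der] by blast
  have "r0 (z + (- (1 * \<sigma>)) *\<^sub>R e) = 0" by (simp only: shift) (simp add: \<sigma>_def)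
  then have "r (z + (- (1 * \<sigma>)) *\<^sub>R e) = 0" using M inU[of 1] by simp
  with mvt have "r z = r0 z * iter_dd [e] r (z + (- (\<tau> * \<sigma>)) *\<^sub>R e)"
    by (simp add: \<sigma>_def algebra_simps)
  then show ?thesis using nb[of \<tau>] \<tau> \<sigma>_def by (intro exI conjI) auto
qed

text \<open>Near 0, r is r0 times the e-derivative of r at an intermediate point, and the
  intermediate point tends to 0 with z. Everything reduces to this derivative being nonzero at 0,
  after which continuity bounds it above and away from zero.\<close>

lemma defining_functions_comparable:
  fixes r0 :: "complex^'n \<Rightarrow> real"
  assumes shift: "\<And>z s. r0 (z + s *\<^sub>R e) = r0 z + s"
    and smooth: "smooth_in cont_funs r0" and r00: "r0 0 = 0"
    and ldf: "local_defining_function {z. r0 z = 0} 0 U r"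
  shows "\<exists>c C \<delta>. c > 0 \<and> C > 0 \<and> \<delta> > 0 \<and> (\<forall>z. norm z < \<delta> \<longrightarrow> c * \<bar>r0 z\<bar> \<le> \<bar>r z\<bar> \<and> \<bar>r z\<bar> \<le> C * \<bar>r0 z\<bar>)"
proof -
  let ?D = "iter_dd [e] r"
  have C: "Cinf_on U r" and U: "open U" "0 \<in> U"
    using ldf by (auto simp: local_defining_function_def)
  obtain v where v: "iter_dd [v] r 0 \<noteq> 0"
    using ldf r00 unfolding local_defining_function_def by blast
  obtain \<rho> where \<rho>: "\<rho> > 0" "ball 0 \<rho> \<subseteq> U" using U open_contains_ball by blast
  have "continuous_on U ?D" using C unfolding Cinf_on_def by blast
  then have Dcont: "isCont ?D 0" using U continuous_on_eq_continuous_at by blast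
  define s where "s z = norm z + \<bar>r0 z\<bar> * norm e" for z
  have r0cont: "isCont r0 0"
    using smooth_in_mem[OF smooth] by (simp add: cont_funs_def continuous_on_eq_continuous_at)
  have "(s \<longlongrightarrow> norm (0::complex^'n) + \<bar>r0 0\<bar> * norm e) (at 0)"
    unfolding s_def[abs_def] by (intro tendsto_intros isContD[OF r0cont])
  then have s0: "(s \<longlongrightarrow> 0) (at 0)" using r00 by simp
  have s_small: "\<exists>\<delta>>0. \<forall>z. norm z < \<delta> \<longrightarrow> s z < \<eta>" if "\<eta> > 0" for \<eta>
  proof -
    have "eventually (\<lambda>z. s z < \<eta>) (at 0)" using s0 that by (rule order_tendstoD)
    then obtain d where d: "d > 0" "\<And>z. z \<noteq> 0 \<Longrightarrow> norm z < d \<Longrightarrow> s z < \<eta>"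
      by (auto simp: eventually_at)
    moreover have "s 0 < \<eta>" using that by (simp add: s_def r00)
    ultimately show ?thesis by metis
  qed
  obtain \<delta>1 where \<delta>1: "\<delta>1 > 0" "\<And>z. norm z < \<delta>1 \<Longrightarrow> s z < \<rho>" using s_small[OF \<rho>(1)] by blast
  have "\<exists>\<xi>. norm \<xi> \<le> s z \<and> r z = r0 z * ?D \<xi>" if "norm z < \<delta>1" for z
    unfolding s_def using \<delta>1(2)[OF that]
    by (intro defining_function_factor[OF shift ldf \<rho>(2)]) (simp add: s_def)
  then obtain X where X: "\<And>z. norm z < \<delta>1 \<Longrightarrow> norm (X z) \<le> s z" "\<And>z. norm z < \<delta>1 \<Longrightarrow> r z = r0 z * ?D (X z)"
    by metis
  \<comment> \<open>If the e-derivative vanished at 0, then r(t v) = r0(t v) o(1) = o(t) in the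
    direction v, contradicting the choice of v with nonzero derivative of r.\<close>
  have D0: "?D 0 \<noteq> 0"
  proof
    assume D0: "?D 0 = 0"
    have tv: "((\<lambda>t::real. t *\<^sub>R v) \<longlongrightarrow> 0) (at 0)" by (auto intro!: tendsto_eq_intros)
    have small: "eventually (\<lambda>t::real. norm (t *\<^sub>R v) < \<delta>1) (at 0)"
      using order_tendstoD(2)[OF tendsto_norm[OF tv], of \<delta>1] \<delta>1(1) by simp
    have "isCont s 0" unfolding s_def[abs_def] by (intro isCont_add isCont_mult isCont_rabs isCont_norm continuous_ident continuous_const r0cont)
    from isCont_tendsto_compose[OF this tv] have sv: "((\<lambda>t::real. s (t *\<^sub>R v)) \<longlongrightarrow> 0) (at 0)"
      by (simp add: s_def r00)
    have "eventually (\<lambda>t::real. norm (X (t *\<^sub>R v)) \<le> s (t *\<^sub>R v)) (at 0)"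
      by (rule eventually_mono[OF small X(1)])
    from Lim_null_comparison[OF this sv] have "((\<lambda>t::real. X (t *\<^sub>R v)) \<longlongrightarrow> 0) (at 0)" .
    from isCont_tendsto_compose[OF Dcont this] have DX: "((\<lambda>t::real. ?D (X (t *\<^sub>R v))) \<longlongrightarrow> 0) (at 0)"
      using D0 by simp
    obtain L where "((\<lambda>t. r0 (0 + t *\<^sub>R v)) has_real_derivative L) (at 0)"
      using smooth_in_deriv(2)[OF smooth] unfolding has_dd_def by blast
    then have "((\<lambda>t. r0 (t *\<^sub>R v) / t) \<longlongrightarrow> L) (at 0)"
      by (simp add: has_field_derivative_iff r00)
    from tendsto_mult[OF this DX] have "((\<lambda>t. r0 (t *\<^sub>R v) / t * ?D (X (t *\<^sub>R v))) \<longlongrightarrow> 0) (at 0)"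
      by simp
    moreover have "eventually (\<lambda>t. r0 (t *\<^sub>R v) / t * ?D (X (t *\<^sub>R v)) = (r (0 + t *\<^sub>R v) - r (0 + 0 *\<^sub>R v)) / (t - 0)) (at 0)"
      using small by eventually_elim (use X(2)[of 0] \<delta>1(1) in \<open>simp add: X(2) r00\<close>)
    ultimately have "((\<lambda>t. (r (0 + t *\<^sub>R v) - r (0 + 0 *\<^sub>R v)) / (t - 0)) \<longlongrightarrow> 0) (at 0)"
      by (rule Lim_transform_eventually)
    then have "((\<lambda>t. r (0 + t *\<^sub>R v)) has_real_derivative 0) (at 0)"
      by (simp only: has_field_derivative_iff)
    then have "iter_dd [v] r 0 = 0"
      by (simp add: iter_dd.simps DERIV_imp_deriv)
    with v show False by simp
  qed
  have "eventually (\<lambda>x. dist (?D x) (?D 0) < \<bar>?D 0\<bar> / 2) (at 0)"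
    using isContD[OF Dcont] D0 by (intro tendstoD) auto
  then obtain \<eta> where \<eta>: "\<eta> > 0" "\<And>x. x \<noteq> 0 \<Longrightarrow> norm x < \<eta> \<Longrightarrow> dist (?D x) (?D 0) < \<bar>?D 0\<bar> / 2"
    by (auto simp: eventually_at)
  then have \<eta>': "\<And>x. norm x < \<eta> \<Longrightarrow> \<bar>?D 0\<bar> / 2 \<le> \<bar>?D x\<bar> \<and> \<bar>?D x\<bar> \<le> 2 * \<bar>?D 0\<bar>"
    unfolding dist_real_def by (smt (verit) field_sum_of_halves)
  obtain \<delta>2 where \<delta>2: "\<delta>2 > 0" "\<And>z. norm z < \<delta>2 \<Longrightarrow> s z < \<eta>" using s_small[OF \<eta>(1)] by blast
  have "\<bar>?D 0\<bar> / 2 * \<bar>r0 z\<bar> \<le> \<bar>r z\<bar> \<and> \<bar>r z\<bar> \<le> (2 * \<bar>?D 0\<bar>) * \<bar>r0 z\<bar>" if z: "norm z < min \<delta>1 \<delta>2" for z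
  proof -
    have "norm (X z) < \<eta>" using X(1)[of z] \<delta>2(2)[of z] z by simp
    from \<eta>'[OF this] have "\<bar>?D 0\<bar> / 2 * \<bar>r0 z\<bar> \<le> \<bar>?D (X z)\<bar> * \<bar>r0 z\<bar>"
      "\<bar>?D (X z)\<bar> * \<bar>r0 z\<bar> \<le> (2 * \<bar>?D 0\<bar>) * \<bar>r0 z\<bar>"
      by (simp_all only: mult_right_mono abs_ge_zero)
    moreover have "\<bar>r z\<bar> = \<bar>?D (X z)\<bar> * \<bar>r0 z\<bar>" using X(2)[of z] z by (simp add: abs_mult)
    ultimately show ?thesis by simp
  qed
  then show ?thesis
    using D0 \<delta>1 \<delta>2 by (intro exI[of _ "\<bar>?D 0\<bar> / 2"] exI[of _ "2 * \<bar>?D 0\<bar>"] exI[of _ "min \<delta>1 \<delta>2"]) auto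
qed

section \<open>The hypersurface\<close>

definition cusp :: "'n \<Rightarrow> 'n \<Rightarrow> complex^'n \<Rightarrow> complex" where
  "cusp a b z = (z $ b)\<^sup>2 - (z $ a) ^ 3"

definition psh_part :: "'n \<Rightarrow> 'n \<Rightarrow> 'n \<Rightarrow> complex^'n::finite \<Rightarrow> real" where
  "psh_part a b c z = (norm (cusp a b z))\<^sup>2 + (\<Sum>j\<in>- {a, b, c}. (norm (z $ j))\<^sup>2)"

definition rdef :: "'n \<Rightarrow> 'n \<Rightarrow> 'n \<Rightarrow> complex^'n::finite \<Rightarrow> real" where
  "rdef a b c z = Re (z $ c) + usum (z $ a) + psh_part a b c z"

lemma psh_part_shift: "psh_part a b c (z + s *\<^sub>R axis c 1) = psh_part a b c z" if "a \<noteq> c" "b \<noteq> c"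
proof -
  have *: "(z + s *\<^sub>R axis c 1) $ j = z $ j" if "j \<noteq> c" for j
    using that by (simp add: axis_def)
  have "(\<Sum>j\<in>- {a, b, c}. (norm ((z + s *\<^sub>R axis c 1) $ j))\<^sup>2) = (\<Sum>j\<in>- {a, b, c}. (norm (z $ j))\<^sup>2)"
    by (intro sum.cong refl) (subst *, auto)
  then show ?thesis by (simp only: psh_part_def cusp_def *[OF that(1)] *[OF that(2)])
qed

lemma rdef_shift: "rdef a b c (z + s *\<^sub>R axis c 1) = rdef a b c z + s" if "a \<noteq> c" "b \<noteq> c"
  using that by (simp add: rdef_def psh_part_shift) (simp add: axis_def)

lemma rdef_0: "rdef a b c 0 = 0"
  by (simp add: rdef_def psh_part_def cusp_def usum_0)

lemma smooth_component:
  "smooth_in cont_funs (\<lambda>z::complex^'n. Re (z $ j))" "smooth_in cont_funs (\<lambda>z::complex^'n. Im (z $ j))"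
  by (intro smooth_in_bounded_linear fun_algebra_cont_funs bounded_linear_compose[OF bounded_linear_Re]
      bounded_linear_compose[OF bounded_linear_Im] bounded_linear_vec_nth;
      simp add: cont_funs_def continuous_intros)+

lemma rdef_smooth: "smooth_in cont_funs (rdef a b c :: complex^'n::finite \<Rightarrow> real)"
proof -
  have "smooth_in cont_funs (\<lambda>z::complex^'n. usum (z $ a))"
    by (rule smooth_in_linear_comp[OF bounded_linear_vec_nth usum_smooth])
  then show ?thesis
    unfolding rdef_def[abs_def] psh_part_def cusp_def cmod_power2 power2_eq_square[where 'a = complex]
      power3_eq_cube minus_complex.sel times_complex.sel
    by (intro smooth_in_add smooth_in_diff smooth_in_mult smooth_in_power smooth_in_sum
        smooth_component fun_algebra_cont_funs)
qed

subsection \<open>Second derivatives\<close>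

text \<open>Differentiation in a real direction, taken on real and imaginary parts because
  \<open>iter_dd\<close> concerns real-valued functions; it allows the cusp polynomial to be
  differentiated by complex product rules.\<close>

definition has_cdd :: "('a::real_normed_vector \<Rightarrow> complex) \<Rightarrow> 'a \<Rightarrow> ('a \<Rightarrow> complex) \<Rightarrow> bool" where
  "has_cdd f v g \<longleftrightarrow> has_dd (\<lambda>x. Re (f x)) v (\<lambda>x. Re (g x)) \<and> has_dd (\<lambda>x. Im (f x)) v (\<lambda>x. Im (g x))"

lemma has_dd_diff:
  "has_dd f v f' \<Longrightarrow> has_dd g v g' \<Longrightarrow> has_dd (\<lambda>x. f x - g x) v (\<lambda>x. f' x - g' x)"
  unfolding has_dd_def by (auto intro!: derivative_eq_intros)

lemma has_dd_sum:
  "(\<And>i. i \<in> A \<Longrightarrow> has_dd (f i) v (g i)) \<Longrightarrow> has_dd (\<lambda>x. \<Sum>i\<in>A. f i x) v (\<lambda>x. \<Sum>i\<in>A. g i x)"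
  unfolding has_dd_def by (auto intro!: derivative_eq_intros)

lemma has_cdd_const: "has_cdd (\<lambda>_. k) v (\<lambda>_. 0)"
  by (simp add: has_cdd_def has_dd_const)

lemma has_cdd_component: "has_cdd (\<lambda>x. x $ j) v (\<lambda>_. v $ j)"
  unfolding has_cdd_def
  by (intro conjI has_dd_bounded_linear bounded_linear_compose[OF bounded_linear_Re]
      bounded_linear_compose[OF bounded_linear_Im] bounded_linear_vec_nth)

lemma has_cdd_diff:
  "has_cdd f v f' \<Longrightarrow> has_cdd g v g' \<Longrightarrow> has_cdd (\<lambda>x. f x - g x) v (\<lambda>x. f' x - g' x)"
  by (simp add: has_cdd_def has_dd_diff)

lemma has_cdd_mult:
  assumes "has_cdd f v f'" "has_cdd g v g'"
  shows "has_cdd (\<lambda>x. f x * g x) v (\<lambda>x. f' x * g x + f x * g' x)"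
proof -
  note m = has_dd_mult[where v = v]
  have "has_dd (\<lambda>x. Re (f x) * Re (g x) - Im (f x) * Im (g x)) v
      (\<lambda>x. (Re (f' x) * Re (g x) + Re (f x) * Re (g' x)) - (Im (f' x) * Im (g x) + Im (f x) * Im (g' x)))"
    using assms unfolding has_cdd_def by (intro has_dd_diff m) auto
  moreover have "has_dd (\<lambda>x. Re (f x) * Im (g x) + Im (f x) * Re (g x)) v
      (\<lambda>x. (Re (f' x) * Im (g x) + Re (f x) * Im (g' x)) + (Im (f' x) * Re (g x) + Im (f x) * Re (g' x)))"
    using assms unfolding has_cdd_def by (intro has_dd_add m) auto
  ultimately show ?thesis
    unfolding has_cdd_def by (simp add: algebra_simps)
qed

lemma has_cdd_cnj:
  assumes "has_cdd f v f'"
  shows "has_cdd (\<lambda>x. cnj (f x)) v (\<lambda>x. cnj (f' x))"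
proof -
  have "has_dd (\<lambda>x. 0 - Im (f x)) v (\<lambda>x. 0 - Im (f' x))"
    using assms unfolding has_cdd_def by (intro has_dd_diff has_dd_const) auto
  with assms show ?thesis by (simp add: has_cdd_def)
qed

lemma has_dd_norm_sq:
  assumes "has_cdd f v f'"
  shows "has_dd (\<lambda>x. (norm (f x))\<^sup>2) v (\<lambda>x. 2 * Re (cnj (f x) * f' x))"
proof -
  have "has_dd (\<lambda>x. Re (f x) * Re (f x) + Im (f x) * Im (f x)) v
    (\<lambda>x. (Re (f' x) * Re (f x) + Re (f x) * Re (f' x)) + (Im (f' x) * Im (f x) + Im (f x) * Im (f' x)))"
    using assms unfolding has_cdd_def by (intro has_dd_add has_dd_mult) auto
  then show ?thesis unfolding cmod_power2 by (simp add: power2_eq_square algebra_simps)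
qed

definition cusp_d :: "'n \<Rightarrow> 'n \<Rightarrow> complex^'n \<Rightarrow> complex^'n \<Rightarrow> complex" where
  "cusp_d a b w z = 2 * z $ b * w $ b - 3 * (z $ a)\<^sup>2 * w $ a"

definition cusp_dd :: "'n \<Rightarrow> 'n \<Rightarrow> complex^'n \<Rightarrow> complex^'n \<Rightarrow> complex^'n \<Rightarrow> complex" where
  "cusp_dd a b v w z = 2 * v $ b * w $ b - 6 * z $ a * v $ a * w $ a"

lemma has_cdd_cusp: "has_cdd (cusp a b) w (cusp_d a b w)"
proof -
  have "has_cdd (\<lambda>z. z $ b * z $ b - z $ a * (z $ a * z $ a)) w
     (\<lambda>z. (w $ b * z $ b + z $ b * w $ b) - (w $ a * (z $ a * z $ a) + z $ a * (w $ a * z $ a + z $ a * w $ a)))"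
    by (intro has_cdd_diff has_cdd_mult has_cdd_component)
  then show ?thesis
    unfolding cusp_def[abs_def] cusp_d_def[abs_def]
    by (simp add: power2_eq_square power3_eq_cube algebra_simps)
qed

lemma has_cdd_cusp_d: "has_cdd (cusp_d a b w) v (cusp_dd a b v w)"
proof -
  have "has_cdd (\<lambda>z. 2 * z $ b * w $ b - 3 * (z $ a * z $ a) * w $ a) v
     (\<lambda>z. ((0 * z $ b + 2 * v $ b) * w $ b + 2 * z $ b * 0) -
       ((0 * (z $ a * z $ a) + 3 * (v $ a * z $ a + z $ a * v $ a)) * w $ a + 3 * (z $ a * z $ a) * 0))"
    by (intro has_cdd_diff has_cdd_mult has_cdd_component has_cdd_const)
  then show ?thesis
    unfolding cusp_d_def[abs_def] cusp_dd_def[abs_def]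
    by (simp add: power2_eq_square algebra_simps)
qed

lemma rdef_dd:
  "iter_dd [w] (rdef a b c) = (\<lambda>z. Re (w $ c) + iter_dd [w $ a] usum (z $ a) +
     (2 * Re (cnj (cusp a b z) * cusp_d a b w z) + (\<Sum>j\<in>- {a, b, c}. 2 * Re (cnj (z $ j) * w $ j))))"
  unfolding rdef_def[abs_def] psh_part_def[abs_def]
  by (intro has_dd_imp_iter_dd has_dd_add has_dd_sum has_dd_norm_sq has_cdd_cusp has_cdd_component
      has_dd_linear_comp[OF smooth_in_deriv(2)[OF usum_smooth] bounded_linear.linear[OF bounded_linear_vec_nth]]
      has_dd_bounded_linear bounded_linear_compose[OF bounded_linear_Re] bounded_linear_vec_nth)

lemma rdef_dd2:
  "iter_dd [v, w] (rdef a b c) z = iter_dd [v $ a, w $ a] usum (z $ a) +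
     (Re (2 * cnj (cusp a b z) * cusp_dd a b v w z) + (2 * Re (cnj (cusp_d a b v z) * cusp_d a b w z) +
       (\<Sum>j\<in>- {a, b, c}. 2 * Re (cnj (v $ j) * w $ j))))"
proof -
  have re: "has_dd (\<lambda>x. 2 * Re (f x)) v (\<lambda>x. 2 * Re (g x))" if "has_cdd f v g" for f g
    using has_dd_mult[OF has_dd_const[of 2], of "\<lambda>x. Re (f x)" v "\<lambda>x. Re (g x)"] that
    by (simp add: has_cdd_def)
  have us: "smooth_in cont_funs (iter_dd [w $ a] usum)" by (rule smooth_in_deriv(1)[OF usum_smooth])
  have "has_dd (\<lambda>z. Re (w $ c) + iter_dd [w $ a] usum (z $ a) +
     (2 * Re (cnj (cusp a b z) * cusp_d a b w z) + (\<Sum>j\<in>- {a, b, c}. 2 * Re (cnj (z $ j) * w $ j)))) v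
     (\<lambda>z. 0 + iter_dd [v $ a] (iter_dd [w $ a] usum) (z $ a) +
     (2 * Re (cnj (cusp_d a b v z) * cusp_d a b w z + cnj (cusp a b z) * cusp_dd a b v w z) +
       (\<Sum>j\<in>- {a, b, c}. 2 * Re (cnj (v $ j) * w $ j + cnj (z $ j) * 0))))"
    by (intro has_dd_add has_dd_const has_dd_sum re has_cdd_mult has_cdd_cnj has_cdd_cusp has_cdd_cusp_d
      has_dd_linear_comp[OF smooth_in_deriv(2)[OF us] bounded_linear.linear[OF bounded_linear_vec_nth]]
      has_cdd_component has_cdd_const)
  then have "iter_dd [v] (iter_dd [w] (rdef a b c)) = (\<lambda>z. 0 + iter_dd [v $ a] (iter_dd [w $ a] usum) (z $ a) +
     (2 * Re (cnj (cusp_d a b v z) * cusp_d a b w z + cnj (cusp a b z) * cusp_dd a b v w z) +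
       (\<Sum>j\<in>- {a, b, c}. 2 * Re (cnj (v $ j) * w $ j + cnj (z $ j) * 0))))"
    unfolding rdef_dd by (rule has_dd_imp_iter_dd)
  then show ?thesis
    unfolding iter_dd_Cons[of v "[w]"] iter_dd_Cons[of "v $ a" "[w $ a]"]
    by (simp add: algebra_simps)
qed

subsection \<open>The Levi form\<close>

text \<open>The (1,1)-part of a real bilinear form, evaluated on the diagonal. Its additivity in
  \<open>D\<close> lets each summand of the Hessian of \<open>rdef\<close> be treated by
  itself.\<close>

definition hermitian_part :: "(complex^'n \<Rightarrow> complex^'n \<Rightarrow> real) \<Rightarrow> complex^'n::finite \<Rightarrow> complex" where
  "hermitian_part D w = (\<Sum>j\<in>UNIV. \<Sum>k\<in>UNIV.
     (of_real (D (axis j 1) (axis k 1)) + \<i> * of_real (D (axis j 1) (axis k \<i>))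
      - \<i> * of_real (D (axis j \<i>) (axis k 1)) + of_real (D (axis j \<i>) (axis k \<i>))) / 4 * w $ j * cnj (w $ k))"

lemma levi_form_eq: "levi_form r x w = hermitian_part (\<lambda>v w. iter_dd [v, w] r x) w"
  by (simp add: levi_form_def dzdzbar_def hermitian_part_def)

lemma hermitian_part_add:
  "hermitian_part (\<lambda>v w. D v w + D' v w) x = hermitian_part D x + hermitian_part D' x"
  unfolding hermitian_part_def sum.distrib[symmetric]
  by (intro sum.cong refl) (simp add: field_simps)

lemma hermitian_part_zero: "hermitian_part (\<lambda>v w. 0) x = 0"
  by (simp add: hermitian_part_def)

lemma hermitian_part_sum:
  "finite A \<Longrightarrow> hermitian_part (\<lambda>v w. \<Sum>i\<in>A. D i v w) x = (\<Sum>i\<in>A. hermitian_part (D i) x)"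
  by (induction A rule: finite_induct) (simp_all add: hermitian_part_zero hermitian_part_add)

text \<open>The real part of a complex bilinear form is of type (2,0) + (0,2) and has no
  (1,1)-component. This removes the term with the second derivatives of the cusp polynomial, whose
  sign is uncontrolled.\<close>

lemma hermitian_part_bilinear:
  assumes "\<And>j k s t. q (axis j s) (axis k t) = Q j k * s * t"
  shows "hermitian_part (\<lambda>v w. Re (q v w)) x = 0"
  unfolding hermitian_part_def assms by (intro sum.neutral ballI) (simp add: complex_eq_iff)

text \<open>For complex-linear p the form is the real Hessian of |p|^2, and the Levi form of |p|^2
  is |p|^2 itself.\<close>

lemma hermitian_part_rank_one:
  fixes x :: "complex^'n::finite"
  assumes "\<And>j s. p (axis j s) = P j * s" "p x = (\<Sum>j\<in>UNIV. P j * x $ j)"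
  shows "hermitian_part (\<lambda>v w. 2 * Re (cnj (p v) * p w)) x = of_real ((norm (p x))\<^sup>2)"
proof -
  have "hermitian_part (\<lambda>v w. 2 * Re (cnj (p v) * p w)) x =
     (\<Sum>j\<in>UNIV. \<Sum>k\<in>UNIV. (P j * x $ j) * cnj (P k * x $ k))"
    unfolding hermitian_part_def assms(1)
    by (intro sum.cong refl) (simp add: complex_eq_iff field_simps)
  also have "\<dots> = p x * cnj (p x)"
    by (simp only: assms(2) cnj_sum sum_product)
  finally show ?thesis by (simp only: complex_norm_square)
qed

text \<open>Only the entry j = k = a survives. Its mixed terms are purely imaginary, so the real
  part sees a quarter of the Laplacian.\<close>

lemma hermitian_part_component:
  fixes x :: "complex^'n::finite"
  assumes "\<And>s. B s 0 = 0" "\<And>s. B 0 s = 0"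
  shows "Re (hermitian_part (\<lambda>v w. B (v $ a) (w $ a)) x) = (B 1 1 + B \<i> \<i>) / 4 * (norm (x $ a))\<^sup>2"
proof -
  let ?X = "(of_real (B 1 1) + \<i> * of_real (B 1 \<i>) - \<i> * of_real (B \<i> 1) + of_real (B \<i> \<i>)) / 4 * x $ a * cnj (x $ a)"
  have ax: "axis j s $ a = (if j = a then s else 0)" for j and s :: complex
    by (auto simp: axis_def)
  have "hermitian_part (\<lambda>v w. B (v $ a) (w $ a)) x = (\<Sum>j\<in>UNIV. \<Sum>k\<in>UNIV. if j = a then if k = a then ?X else 0 else 0)"
    unfolding hermitian_part_def ax by (intro sum.cong refl) (auto simp: assms)
  also have "\<dots> = (\<Sum>j\<in>UNIV. if j = a then ?X else 0)"
    by (intro sum.cong refl) simp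
  also have "\<dots> = ?X" by simp
  also have "Re ?X = (B 1 1 + B \<i> \<i>) / 4 * (norm (x $ a))\<^sup>2"
    unfolding cmod_power2 by (simp add: power2_eq_square field_simps)
  finally show ?thesis .
qed

lemma iter_dd_zero_direction:
  "iter_dd [0] f = (\<lambda>_. 0)" "iter_dd [v, 0] f = (\<lambda>_. 0)" "iter_dd [0, v] f = (\<lambda>_. 0)"
  by (rule ext, simp add: iter_dd.simps)+

lemma rdef_levi_nonneg:
  assumes "a \<noteq> b"
  shows "Re (levi_form (rdef a b c) z w) \<ge> 0"
proof -
  have 1: "Re (hermitian_part (\<lambda>v w. iter_dd [v $ a, w $ a] usum (z $ a)) w) =
      (iter_dd [1, 1] usum (z $ a) + iter_dd [\<i>, \<i>] usum (z $ a)) / 4 * (norm (w $ a))\<^sup>2"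
    by (rule hermitian_part_component) (simp_all add: iter_dd_zero_direction)
  have 2: "hermitian_part (\<lambda>v w. Re (2 * cnj (cusp a b z) * cusp_dd a b v w z)) w = 0"
  proof (rule hermitian_part_bilinear)
    show "2 * cnj (cusp a b z) * cusp_dd a b (axis j s) (axis k t) z =
      (2 * cnj (cusp a b z) * cusp_dd a b (axis j 1) (axis k 1) z) * s * t" for j k s t
      by (simp add: cusp_dd_def axis_def algebra_simps)
  qed
  have 3: "hermitian_part (\<lambda>v w. 2 * Re (cnj (cusp_d a b v z) * cusp_d a b w z)) w = of_real ((norm (cusp_d a b w z))\<^sup>2)"
  proof (rule hermitian_part_rank_one)
    show "cusp_d a b (axis j s) z = (if j = b then 2 * z $ b else if j = a then - 3 * (z $ a)\<^sup>2 else 0) * s" for j s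
      using assms by (auto simp: cusp_d_def axis_def)
    have "(\<Sum>j\<in>UNIV. (if j = b then 2 * z $ b else if j = a then - 3 * (z $ a)\<^sup>2 else 0) * w $ j) =
      (\<Sum>j\<in>UNIV. (if j = b then 2 * z $ b * w $ b else 0) + (if j = a then - 3 * (z $ a)\<^sup>2 * w $ a else 0))"
      using assms by (intro sum.cong refl) auto
    also have "\<dots> = cusp_d a b w z" by (simp add: sum.distrib cusp_d_def)
    finally show "cusp_d a b w z = (\<Sum>j\<in>UNIV. (if j = b then 2 * z $ b else if j = a then - 3 * (z $ a)\<^sup>2 else 0) * w $ j)"
      by simp
  qed
  have 4: "hermitian_part (\<lambda>v w. 2 * Re (cnj (v $ i) * w $ i)) w = of_real ((norm (w $ i))\<^sup>2)" for i
  proof (rule hermitian_part_rank_one)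
    show "axis j s $ i = (if j = i then 1 else 0) * s" for j and s :: complex by (simp add: axis_def)
    show "w $ i = (\<Sum>j\<in>UNIV. (if j = i then 1 else 0) * w $ j)"
      by (simp add: if_distrib[where f = "\<lambda>x. x * _"] cong: if_cong)
  qed
  have "Re (levi_form (rdef a b c) z w) = (iter_dd [1, 1] usum (z $ a) + iter_dd [\<i>, \<i>] usum (z $ a)) / 4 * (norm (w $ a))\<^sup>2
      + (norm (cusp_d a b w z))\<^sup>2 + (\<Sum>j\<in>- {a, b, c}. (norm (w $ j))\<^sup>2)"
    unfolding levi_form_eq rdef_dd2 hermitian_part_add 2 3 plus_complex.sel 1
    by (simp only: hermitian_part_sum[OF finite] 4 Re_sum Re_complex_of_real zero_complex.sel add_0 add.assoc)
  also have "\<dots> \<ge> 0"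
    using usum_subharmonic[of "z $ a"] by (intro add_nonneg_nonneg mult_nonneg_nonneg sum_nonneg) auto
  finally show ?thesis .
qed

lemma rdef_local_defining_function:
  assumes "a \<noteq> c" "b \<noteq> c"
  shows "local_defining_function {z. rdef a b c z = 0} q UNIV (rdef a b c)"
proof -
  have "has_dd (rdef a b c) (axis c 1) (\<lambda>_. 1)"
    unfolding has_dd_def rdef_shift[OF assms] by (auto intro!: derivative_eq_intros)
  then have "iter_dd [axis c 1] (rdef a b c) z \<noteq> 0" for z by (simp add: has_dd_imp_iter_dd)
  then show ?thesis
    unfolding local_defining_function_def
    using smooth_in_imp_Cinf_on[OF rdef_smooth] by blast
qed

section \<open>Order of vanishing\<close>

lemma vanishes_toI: "\<delta> > 0 \<Longrightarrow> (\<And>t. norm t < \<delta> \<Longrightarrow> norm (f t) \<le> C * norm t ^ k) \<Longrightarrow> vanishes_to k f"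
  unfolding vanishes_to_def by blast

lemma vanishes_toE:
  assumes "vanishes_to k f"
  obtains C \<delta> where "C > 0" "\<delta> > 0" "\<delta> \<le> 1" "\<And>t. norm t < \<delta> \<Longrightarrow> norm (f t) \<le> C * norm t ^ k"
proof -
  obtain C \<delta> where *: "\<delta> > 0" "\<And>t. norm t < \<delta> \<Longrightarrow> norm (f t) \<le> C * norm t ^ k"
    using assms unfolding vanishes_to_def by blast
  have "norm (f t) \<le> (\<bar>C\<bar> + 1) * norm t ^ k" if "norm t < min \<delta> 1" for t
  proof -
    have "norm (f t) \<le> C * norm t ^ k" using * that by simp
    also have "\<dots> \<le> (\<bar>C\<bar> + 1) * norm t ^ k" by (intro mult_right_mono) auto
    finally show ?thesis .
  qed
  then show ?thesis by (intro that[of "\<bar>C\<bar> + 1" "min \<delta> 1"]) (use * in auto)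
qed

lemma vanishes_to_dominated:
  assumes "vanishes_to k f" "\<eta> > 0" "\<And>t. norm t < \<eta> \<Longrightarrow> norm (g t) \<le> K * norm (f t)" "K \<ge> 0"
  shows "vanishes_to k g"
proof -
  obtain C \<delta> where *: "C > 0" "\<delta> > 0" "\<And>t. norm t < \<delta> \<Longrightarrow> norm (f t) \<le> C * norm t ^ k"
    by (rule vanishes_toE[OF assms(1)]) (rule that; blast)
  show ?thesis
  proof (rule vanishes_toI[of "min \<delta> \<eta>"])
    fix t :: complex assume t: "norm t < min \<delta> \<eta>"
    have "norm (g t) \<le> K * norm (f t)" using assms(3) t by simp
    also have "\<dots> \<le> K * (C * norm t ^ k)" using * t assms(4) by (intro mult_left_mono) auto
    finally show "norm (g t) \<le> (K * C) * norm t ^ k" by simp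
  qed (use * assms in auto)
qed

lemma vanishes_to_norm_le:
  "vanishes_to k f \<Longrightarrow> (\<And>t. norm (g t) \<le> norm (f t)) \<Longrightarrow> vanishes_to k g"
  by (rule vanishes_to_dominated[of k f 1 g 1]) auto

lemma vanishes_to_eventually_eq:
  assumes "vanishes_to k f" "\<eta> > 0" "\<And>t. norm t < \<eta> \<Longrightarrow> g t = f t"
  shows "vanishes_to k g"
  by (rule vanishes_to_dominated[OF assms(1,2), of g 1]) (use assms in auto)

lemma vanishes_to_antimono:
  assumes "vanishes_to k f" "l \<le> k"
  shows "vanishes_to l f"
proof -
  obtain C \<delta> where *: "C > 0" "\<delta> > 0" "\<delta> \<le> 1" "\<And>t. norm t < \<delta> \<Longrightarrow> norm (f t) \<le> C * norm t ^ k"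
    by (rule vanishes_toE[OF assms(1)]) (rule that; blast)
  show ?thesis
  proof (rule vanishes_toI[of \<delta>])
    fix t :: complex assume t: "norm t < \<delta>"
    have "norm (f t) \<le> C * norm t ^ k" using * t by simp
    also have "\<dots> \<le> C * norm t ^ l" using * t assms(2) by (intro mult_left_mono power_decreasing) auto
    finally show "norm (f t) \<le> C * norm t ^ l" .
  qed (use * in auto)
qed

lemma vanishes_to_add:
  assumes "vanishes_to k f" "vanishes_to k g"
  shows "vanishes_to k (\<lambda>t. f t + g t)"
proof -
  obtain C \<delta> where C: "\<delta> > 0" "\<And>t. norm t < \<delta> \<Longrightarrow> norm (f t) \<le> C * norm t ^ k"
    by (rule vanishes_toE[OF assms(1)]) (rule that; blast)
  obtain D \<eta> where D: "\<eta> > 0" "\<And>t. norm t < \<eta> \<Longrightarrow> norm (g t) \<le> D * norm t ^ k"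
    by (rule vanishes_toE[OF assms(2)]) (rule that; blast)
  show ?thesis
    by (rule vanishes_toI[of "min \<delta> \<eta>" _ "C + D"])
       (use C D in \<open>auto intro!: norm_triangle_le add_mono simp: distrib_right\<close>)
qed

lemma vanishes_to_uminus: "vanishes_to k f \<Longrightarrow> vanishes_to k (\<lambda>t. - f t)"
  by (rule vanishes_to_norm_le) auto

lemma vanishes_to_diff:
  "vanishes_to k f \<Longrightarrow> vanishes_to k g \<Longrightarrow> vanishes_to k (\<lambda>t. f t - g t)"
  using vanishes_to_add[OF _ vanishes_to_uminus] by fastforce

lemma vanishes_to_zero: "vanishes_to k (\<lambda>_. 0)"
  by (rule vanishes_toI[of 1 _ 0]) auto

lemma vanishes_to_sum:
  "(\<And>i. i \<in> A \<Longrightarrow> vanishes_to k (f i)) \<Longrightarrow> vanishes_to k (\<lambda>t. \<Sum>i\<in>A. f i t)"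
  by (induction A rule: infinite_finite_induct) (auto simp: vanishes_to_zero intro: vanishes_to_add)

lemma vanishes_to_mult:
  fixes f g :: "complex \<Rightarrow> complex"
  assumes "vanishes_to k f" "vanishes_to l g"
  shows "vanishes_to (k + l) (\<lambda>t. f t * g t)"
proof -
  obtain C \<delta> where C: "C > 0" "\<delta> > 0" "\<And>t. norm t < \<delta> \<Longrightarrow> norm (f t) \<le> C * norm t ^ k"
    by (rule vanishes_toE[OF assms(1)]) (rule that; blast)
  obtain D \<eta> where D: "\<eta> > 0" "\<And>t. norm t < \<eta> \<Longrightarrow> norm (g t) \<le> D * norm t ^ l"
    by (rule vanishes_toE[OF assms(2)]) (rule that; blast)
  show ?thesis
  proof (rule vanishes_toI[of "min \<delta> \<eta>"])
    fix t :: complex assume t: "norm t < min \<delta> \<eta>"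
    have "norm (f t) * norm (g t) \<le> (C * norm t ^ k) * (D * norm t ^ l)"
      using t C D by (intro mult_mono) auto
    then show "norm (f t * g t) \<le> (C * D) * norm t ^ (k + l)"
      by (simp add: norm_mult power_add mult_ac)
  qed (use C D in auto)
qed

lemma vanishes_to_power:
  fixes f :: "complex \<Rightarrow> complex"
  assumes "vanishes_to k f"
  shows "vanishes_to (k * m) (\<lambda>t. f t ^ m)"
proof (induction m)
  case 0
  show ?case by (rule vanishes_toI[of 1 _ 1]) auto
next
  case (Suc m)
  then show ?case using vanishes_to_mult[OF assms Suc] by simp
qed

lemma vanishes_to_const_mult:
  fixes f :: "complex \<Rightarrow> complex"
  shows "vanishes_to k f \<Longrightarrow> vanishes_to k (\<lambda>t. c * f t)"
  by (rule vanishes_to_dominated[of k f 1 _ "norm c"]) (auto simp: norm_mult)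

lemma vanishes_to_Re:
  "vanishes_to k f \<Longrightarrow> vanishes_to k (\<lambda>t. Re (f t))"
  by (rule vanishes_to_norm_le) (auto simp: abs_Re_le_cmod)

lemma vanishes_to_sqrt:
  assumes "vanishes_to (2 * k) (\<lambda>t. (norm (f t))\<^sup>2)"
  shows "vanishes_to k f"
proof -
  obtain C \<delta> where C: "C > 0" "\<delta> > 0" "\<And>t. norm t < \<delta> \<Longrightarrow> norm ((norm (f t))\<^sup>2) \<le> C * norm t ^ (2 * k)"
    by (rule vanishes_toE[OF assms]) (rule that; blast)
  show ?thesis
  proof (rule vanishes_toI[of \<delta>])
    fix t :: complex assume t: "norm t < \<delta>"
    have "(norm (f t))\<^sup>2 \<le> (sqrt C * norm t ^ k)\<^sup>2"
      using C(3)[OF t] C(1) by (simp add: power_mult_distrib power_mult[symmetric] mult.commute)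
    then show "norm (f t) \<le> sqrt C * norm t ^ k"
      by (rule power2_le_imp_le) (use C(1) in simp)
  qed (use C in auto)
qed

lemma norm_vec_le_sum: "norm (x :: complex^'n::finite) \<le> (\<Sum>i\<in>UNIV. norm (x $ i))"
  by (simp add: norm_vec_def L2_set_le_sum)

lemma vanishes_to_vec:
  fixes f :: "complex \<Rightarrow> complex^'n::finite"
  assumes "\<And>i. vanishes_to k (\<lambda>t. f t $ i)"
  shows "vanishes_to k f"
proof (rule vanishes_to_norm_le)
  show "vanishes_to k (\<lambda>t. \<Sum>i\<in>UNIV. norm (f t $ i))"
  proof (rule vanishes_to_sum)
    show "vanishes_to k (\<lambda>t. norm (f t $ i))" for i
      using assms[of i] by (rule vanishes_to_norm_le) auto
  qed
  show "norm (f t) \<le> norm (\<Sum>i\<in>UNIV. norm (f t $ i))" for t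
    using norm_vec_le_sum[of "f t"] by simp
qed

lemma vanishes_to_component:
  fixes f :: "complex \<Rightarrow> complex^'n::finite"
  shows "vanishes_to k f \<Longrightarrow> vanishes_to k (\<lambda>t. f t $ i)"
  by (rule vanishes_to_norm_le[of k f]) (simp_all add: Finite_Cartesian_Product.norm_nth_le)

lemma power_le_power_imp_ge:
  assumes "c > 0" "\<delta> > 0" and le: "\<And>\<rho>::real. 0 < \<rho> \<Longrightarrow> \<rho> < \<delta> \<Longrightarrow> c * \<rho> ^ a \<le> C * \<rho> ^ b"
  shows "a \<ge> b"
proof (rule ccontr)
  assume "\<not> a \<ge> b"
  then have ab: "b = a + Suc (b - a - 1)" by simp
  have ev: "eventually (\<lambda>\<rho>. c \<le> C * \<rho> ^ Suc (b - a - 1)) (at_right 0)"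
    unfolding eventually_at_right_field
  proof (intro exI conjI allI impI)
    fix \<rho> :: real assume \<rho>: "0 < \<rho>" "\<rho> < \<delta>"
    have "c * \<rho> ^ a \<le> (C * \<rho> ^ Suc (b - a - 1)) * \<rho> ^ a"
      using le[OF \<rho>] by (subst (asm) ab) (simp only: power_add mult_ac)
    then show "c \<le> C * \<rho> ^ Suc (b - a - 1)" using \<rho> by simp
  qed (rule assms)
  have "((\<lambda>\<rho>::real. C * \<rho> ^ Suc (b - a - 1)) \<longlongrightarrow> C * 0 ^ Suc (b - a - 1)) (at_right 0)"
    by (intro tendsto_intros)
  then have "c \<le> C * 0 ^ Suc (b - a - 1)"
    by (rule tendsto_lowerbound[OF _ ev]) simp
  with assms(1) show False by simp
qed

lemma vanishes_to_lower_bound: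
  assumes "vanishes_to k f" "c > 0" "\<eta> > 0" "\<And>t. norm t < \<eta> \<Longrightarrow> c * norm t ^ n \<le> norm (f t)"
  shows "k \<le> n"
proof -
  obtain C \<delta> where C: "C > 0" "\<delta> > 0" "\<And>t. norm t < \<delta> \<Longrightarrow> norm (f t) \<le> C * norm t ^ k"
    by (rule vanishes_toE[OF assms(1)]) (rule that; blast)
  show ?thesis
  proof (rule power_le_power_imp_ge[OF assms(2), of "min \<eta> \<delta>" n C k])
    fix \<rho> :: real assume \<rho>: "0 < \<rho>" "\<rho> < min \<eta> \<delta>"
    show "c * \<rho> ^ n \<le> C * \<rho> ^ k"
      using assms(4)[of "of_real \<rho>"] C(3)[of "of_real \<rho>"] \<rho> by simp
  qed (use assms C in auto)
qed

lemma ord_ge: "vanishes_to k f \<Longrightarrow> enat k \<le> ord f"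
  unfolding ord_def by (rule Sup_upper) auto

lemma ord_le:
  assumes "\<not> vanishes_to (Suc N) f"
  shows "ord f \<le> enat N"
  unfolding ord_def
proof (rule Sup_least)
  fix x assume "x \<in> {enat k |k. vanishes_to k f}"
  then obtain k where "x = enat k" "vanishes_to k f" by blast
  with assms vanishes_to_antimono[of k f "Suc N"] show "x \<le> enat N"
    by (cases "Suc N \<le> k") auto
qed

section \<open>Vanishing of holomorphic functions\<close>

lemma holomorphic_order:
  assumes f: "f holomorphic_on ball 0 \<epsilon>" and e: "\<epsilon> > 0" and f0: "f 0 = 0"
    and nz: "\<not> (\<forall>t\<in>ball 0 \<epsilon>. f t = 0)"
  obtains n g r where "n > 0" "r > 0" "r \<le> \<epsilon>" "g holomorphic_on ball 0 r" "g 0 \<noteq> 0"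
    "\<And>t. norm t < r \<Longrightarrow> f t = t ^ n * g t"
proof -
  have "\<not> f constant_on ball 0 \<epsilon>"
    using nz f0 e unfolding constant_on_def by (metis centre_in_ball)
  moreover have "0 \<in> ball (0::complex) \<epsilon>" using e by simp
  ultimately obtain g r n where "0 < n" "0 < r" "ball 0 r \<subseteq> ball (0::complex) \<epsilon>" "g holomorphic_on ball 0 r"
     "\<And>w. w \<in> ball 0 r \<Longrightarrow> f w = (w - 0) ^ n * g w" "\<And>w. w \<in> ball 0 r \<Longrightarrow> g w \<noteq> 0"
    using holomorphic_factor_zero_nonconstant[OF f open_ball connected_ball _ f0] by metis
  then show ?thesis
    by (intro that[of n r g]) (auto simp: ball_subset_ball_iff)
qed

lemma holomorphic_order_bounds:
  assumes g: "g holomorphic_on ball 0 r" and r: "r > 0" and g0: "g 0 \<noteq> (0::complex)"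
    and f: "\<And>t. norm t < r \<Longrightarrow> f t = t ^ n * g t"
  shows "\<exists>c C \<delta>. c > 0 \<and> \<delta> > 0 \<and> \<delta> \<le> r \<and>
    (\<forall>t. norm t < \<delta> \<longrightarrow> c * norm t ^ n \<le> norm (f t) \<and> norm (f t) \<le> C * norm t ^ n)"
proof -
  have "isCont g 0"
    using holomorphic_on_imp_continuous_on[OF g] r by (simp add: continuous_on_interior)
  then have "eventually (\<lambda>t. dist (g t) (g 0) < norm (g 0) / 2) (at 0)"
    using g0 by (intro tendstoD isContD) auto
  then obtain d where d: "d > 0" "\<And>t. t \<noteq> 0 \<Longrightarrow> norm t < d \<Longrightarrow> dist (g t) (g 0) < norm (g 0) / 2"
    by (auto simp: eventually_at)
  have gb: "norm (g 0) / 2 \<le> norm (g t) \<and> norm (g t) \<le> 2 * norm (g 0)" if "norm t < d" for t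
  proof (cases "t = 0")
    case False
    have "norm (g t - g 0) < norm (g 0) / 2" using d(2)[OF False that] by (simp add: dist_norm)
    then show ?thesis
      using norm_triangle_ineq2[of "g t" "g 0"] norm_triangle_ineq2[of "g 0" "g t"] norm_ge_zero[of "g 0"]
      by (simp add: norm_minus_commute)
  qed auto
  have *: "norm (f t) = norm (g t) * norm t ^ n" if "norm t < r" for t
    using f[OF that] by (simp add: norm_mult norm_power)
  show ?thesis
  proof (intro exI conjI allI impI)
    fix t :: complex assume t: "norm t < min d r"
    then have t': "norm t < d" "norm t < r" by auto
    show "norm (g 0) / 2 * norm t ^ n \<le> norm (f t)"
      unfolding *[OF t'(2)] using gb[OF t'(1)] by (intro mult_right_mono) auto
    show "norm (f t) \<le> 2 * norm (g 0) * norm t ^ n"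
      unfolding *[OF t'(2)] using gb[OF t'(1)] by (intro mult_right_mono) auto
  qed (use g0 d r in auto)
qed

lemma holomorphic_vanishes_to_1:
  assumes f: "f holomorphic_on ball 0 \<epsilon>" and e: "\<epsilon> > 0" and f0: "f 0 = 0"
  shows "vanishes_to 1 f"
proof (cases "\<forall>t\<in>ball 0 \<epsilon>. f t = 0")
  case True
  then show ?thesis by (intro vanishes_to_eventually_eq[OF vanishes_to_zero e]) auto
next
  case False
  obtain n g r where *: "n > 0" "r > 0" "g holomorphic_on ball 0 r" "g 0 \<noteq> 0" "\<And>t. norm t < r \<Longrightarrow> f t = t ^ n * g t"
    by (rule holomorphic_order[OF f e f0 False]) (rule that; blast)
  obtain c C \<delta> where b: "c > 0" "\<delta> > 0" "\<delta> \<le> r"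
    "\<And>t. norm t < \<delta> \<Longrightarrow> c * norm t ^ n \<le> norm (f t)" "\<And>t. norm t < \<delta> \<Longrightarrow> norm (f t) \<le> C * norm t ^ n"
    using holomorphic_order_bounds[OF *(3,2,4,5)] by blast
  have "vanishes_to n f" by (rule vanishes_toI[OF b(2) b(5)])
  then show ?thesis by (rule vanishes_to_antimono) (use *(1) in linarith)
qed

lemma holomorphic_flat_zero:
  assumes f: "f holomorphic_on ball 0 \<epsilon>" and e: "\<epsilon> > 0" and f0: "f 0 = 0" and flat: "\<And>N. vanishes_to N f"
  shows "\<forall>t\<in>ball 0 \<epsilon>. f t = 0"
proof (rule ccontr)
  assume False: "\<not> ?thesis"
  obtain n g r where *: "n > 0" "r > 0" "g holomorphic_on ball 0 r" "g 0 \<noteq> 0" "\<And>t. norm t < r \<Longrightarrow> f t = t ^ n * g t"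
    by (rule holomorphic_order[OF f e f0 False]) (rule that; blast)
  obtain c \<delta> where "c > 0" "\<delta> > 0" "\<And>t. norm t < \<delta> \<Longrightarrow> c * norm t ^ n \<le> norm (f t)"
    using holomorphic_order_bounds[OF *(3,2,4,5)] by blast
  from vanishes_to_lower_bound[OF flat[of "Suc n"] this] show False by simp
qed

text \<open>The order n of f is an integer and f^m has order n m, so n m > m k already gives n \<ge>
  k + 1. This gains a full order from a single extra order of the power.\<close>

lemma holomorphic_root_vanishes:
  assumes f: "f holomorphic_on ball 0 \<epsilon>" and e: "\<epsilon> > 0" and f0: "f 0 = 0"
    and v: "vanishes_to (m * k + 1) (\<lambda>t. f t ^ m)"
  shows "vanishes_to (Suc k) f"
proof (cases "\<forall>t\<in>ball 0 \<epsilon>. f t = 0")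
  case True
  then show ?thesis by (intro vanishes_to_eventually_eq[OF vanishes_to_zero e]) auto
next
  case False
  obtain n g r where *: "n > 0" "r > 0" "g holomorphic_on ball 0 r" "g 0 \<noteq> 0" "\<And>t. norm t < r \<Longrightarrow> f t = t ^ n * g t"
    by (rule holomorphic_order[OF f e f0 False]) (rule that; blast)
  obtain c C \<delta> where b: "c > 0" "\<delta> > 0" "\<delta> \<le> r"
    "\<And>t. norm t < \<delta> \<Longrightarrow> c * norm t ^ n \<le> norm (f t)" "\<And>t. norm t < \<delta> \<Longrightarrow> norm (f t) \<le> C * norm t ^ n"
    using holomorphic_order_bounds[OF *(3,2,4,5)] by blast
  have "m * k + 1 \<le> n * m"
  proof (rule vanishes_to_lower_bound[OF v, of "c ^ m" \<delta>])
    fix t :: complex assume "norm t < \<delta>"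
    then have "(c * norm t ^ n) ^ m \<le> norm (f t) ^ m" using b by (intro power_mono) auto
    then show "c ^ m * norm t ^ (n * m) \<le> norm (f t ^ m)"
      by (simp add: power_mult_distrib power_mult norm_power)
  qed (use b in auto)
  then have "Suc k \<le> n" by (metis Suc_eq_plus1 Suc_leI leD leI mult.commute mult_le_mono2 not_less_eq_eq)
  moreover have "vanishes_to n f" by (rule vanishes_toI[OF b(2) b(5)])
  ultimately show ?thesis by (rule vanishes_to_antimono[rotated])
qed

text \<open>Along a ray on which the leading term of f is positive, the real part has the full size
  of f, so it cannot vanish to higher order than f does.\<close>

lemma holomorphic_vanishes_to_Re:
  assumes f: "f holomorphic_on ball 0 \<epsilon>" and e: "\<epsilon> > 0" and f0: "f 0 = 0"
    and v: "vanishes_to N (\<lambda>t. Re (f t))"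
  shows "vanishes_to N f"
proof (cases "\<forall>t\<in>ball 0 \<epsilon>. f t = 0")
  case True
  then show ?thesis by (intro vanishes_to_eventually_eq[OF vanishes_to_zero e]) auto
next
  case False
  obtain n g r where *: "n > 0" "r > 0" "g holomorphic_on ball 0 r" "g 0 \<noteq> 0" "\<And>t. norm t < r \<Longrightarrow> f t = t ^ n * g t"
    by (rule holomorphic_order[OF f e f0 False]) (rule that; blast)
  obtain c C \<delta> where b: "c > 0" "\<delta> > 0" "\<delta> \<le> r"
    "\<And>t. norm t < \<delta> \<Longrightarrow> c * norm t ^ n \<le> norm (f t)" "\<And>t. norm t < \<delta> \<Longrightarrow> norm (f t) \<le> C * norm t ^ n"
    using holomorphic_order_bounds[OF *(3,2,4,5)] by blast
  \<comment> \<open>The direction is chosen so that \<omega>^n g(0) is the positive number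
    |g(0)|.\<close>
  define \<omega> where "\<omega> = cis (- Arg (g 0) / n)"
  have \<omega>: "norm \<omega> = 1" "\<omega> ^ n * g 0 = of_real (norm (g 0))"
  proof -
    have "\<omega> ^ n = cis (real n * (- Arg (g 0) / n))" unfolding \<omega>_def by (rule Complex.DeMoivre)
    also have "real n * (- Arg (g 0) / n) = - Arg (g 0)" using *(1) by simp
    finally have "\<omega> ^ n = cis (- Arg (g 0))" .
    then have "\<omega> ^ n * g 0 = cis (- Arg (g 0)) * (of_real (norm (g 0)) * cis (Arg (g 0)))"
      using rcis_cmod_Arg[of "g 0"] by (simp add: rcis_def)
    also have "\<dots> = of_real (norm (g 0))" by (simp add: mult.left_commute[of "cis (- Arg (g 0))"] cis_mult)
    finally show "\<omega> ^ n * g 0 = of_real (norm (g 0))" .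
  qed (simp add: \<omega>_def)
  obtain D \<eta> where D: "\<eta> > 0" "\<And>t. norm t < \<eta> \<Longrightarrow> norm (Re (f t)) \<le> D * norm t ^ N"
    by (rule vanishes_toE[OF v]) (rule that; blast)
  have gc: "isCont g 0"
    using holomorphic_on_imp_continuous_on[OF *(3)] *(2) by (simp add: continuous_on_interior)
  have lim: "((\<lambda>\<rho>::real. Re (\<omega> ^ n * g (of_real \<rho> * \<omega>))) \<longlongrightarrow> norm (g 0)) (at_right 0)"
  proof -
    have "((\<lambda>\<rho>::real. of_real \<rho> * \<omega>) \<longlongrightarrow> 0) (at_right 0)" by (auto intro!: tendsto_eq_intros)
    from tendsto_Re[OF tendsto_mult[OF tendsto_const isCont_tendsto_compose[OF gc this]], of "\<omega> ^ n"]
    show ?thesis unfolding \<omega>(2) by simp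
  qed
  have "eventually (\<lambda>\<rho>::real. norm (g 0) / 2 < Re (\<omega> ^ n * g (of_real \<rho> * \<omega>))) (at_right 0)"
    by (rule order_tendstoD(1)[OF lim]) (use *(4) in simp)
  then obtain \<delta>' where d': "\<delta>' > 0" "\<And>\<rho>. 0 < \<rho> \<Longrightarrow> \<rho> < \<delta>' \<Longrightarrow> norm (g 0) / 2 < Re (\<omega> ^ n * g (of_real \<rho> * \<omega>))"
    unfolding eventually_at_right_field by blast
  have "N \<le> n"
  proof (rule power_le_power_imp_ge[of "norm (g 0) / 2" "min \<delta>' (min r \<eta>)"])
    fix \<rho> :: real assume \<rho>: "0 < \<rho>" "\<rho> < min \<delta>' (min r \<eta>)"
    let ?t = "of_real \<rho> * \<omega>"
    have nt: "norm ?t = \<rho>" using \<rho> \<omega> by (simp add: norm_mult)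
    have ft: "f ?t = of_real (\<rho> ^ n) * (\<omega> ^ n * g ?t)"
      using *(5)[of ?t] \<rho> nt by (simp add: power_mult_distrib)
    have Ref: "Re (f ?t) = \<rho> ^ n * Re (\<omega> ^ n * g ?t)"
      by (subst ft) (simp only: scaleR_conv_of_real[symmetric] scaleR_complex.sel)
    have "norm (g 0) / 2 * \<rho> ^ n \<le> Re (\<omega> ^ n * g ?t) * \<rho> ^ n"
      using d'(2)[of \<rho>] \<rho> by (intro mult_right_mono) auto
    also have "\<dots> = Re (f ?t)" unfolding Ref by (rule mult.commute)
    also have "\<dots> \<le> D * \<rho> ^ N" using D(2)[of ?t] nt \<rho> by auto
    finally show "norm (g 0) / 2 * \<rho> ^ n \<le> D * \<rho> ^ N" .
  qed (use *(2,4) d' D in auto)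
  moreover have "vanishes_to n f" by (rule vanishes_toI[OF b(2) b(5)])
  ultimately show ?thesis by (rule vanishes_to_antimono[rotated])
qed

text \<open>The remainders identify the coefficients, and the geometric bound is what collides with
  the factorial growth of \<open>ucoef\<close>.\<close>

lemma holomorphic_taylor:
  assumes f: "f holomorphic_on ball 0 \<epsilon>" and e: "\<epsilon> > 0"
  shows "\<exists>R a A. R > 0 \<and> (\<forall>n. norm (a n) \<le> A * R ^ n) \<and> a 0 = f 0 \<and>
    (\<forall>N. vanishes_to N (\<lambda>t. f t - (\<Sum>n<N. a n * t ^ n)))"
proof -
  define a where "a n = (deriv ^^ n) f 0 / fact n" for n
  have sub: "cball 0 (\<epsilon> / 2) \<subseteq> ball (0::complex) \<epsilon>" using e by auto
  have fc: "continuous_on (cball 0 (\<epsilon> / 2)) f"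
    using holomorphic_on_imp_continuous_on[OF f] sub continuous_on_subset by blast
  have fh: "f holomorphic_on ball 0 (\<epsilon> / 2)"
    using f by (rule holomorphic_on_subset) (use e in auto)
  have "compact (f ` cball 0 (\<epsilon> / 2))" by (rule compact_continuous_image[OF fc compact_cball])
  then obtain A where A: "\<And>x. x \<in> cball 0 (\<epsilon> / 2) \<Longrightarrow> norm (f x) \<le> A"
    using compact_imp_bounded bounded_iff by (metis imageI)
  have A0: "A \<ge> 0" using A[of 0] e norm_ge_zero[of "f 0"] by (simp del: norm_ge_zero)
  define R where "R = 2 / \<epsilon>"
  have R: "R > 0" using e by (simp add: R_def)
  have an: "norm (a n) \<le> A * R ^ n" for n
  proof -
    have "norm ((deriv ^^ n) f 0) \<le> fact n * A / (\<epsilon> / 2) ^ n"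
      by (rule Cauchy_inequality[OF fh fc]) (use e A in auto)
    then show ?thesis by (simp add: a_def norm_divide R_def power_divide field_simps)
  qed
  have sums: "(\<lambda>n. a n * t ^ n) sums f t" if "norm t < \<epsilon>" for t
    using holomorphic_power_series[OF f, of t] that by (simp add: a_def)
  \<comment> \<open>On the disc of radius 1 / (2 R) the tail is dominated by a geometric series of
    ratio 1/2.\<close>
  have "vanishes_to N (\<lambda>t. f t - (\<Sum>n<N. a n * t ^ n))" for N
  proof (rule vanishes_toI[of "1 / (2 * R)"])
    fix t :: complex assume t: "norm t < 1 / (2 * R)"
    then have tR: "R * norm t \<le> 1 / 2" using R by (simp add: field_simps)
    have te: "norm t < \<epsilon>" using t e by (simp add: R_def field_simps)
    have s: "(\<lambda>n. a (n + N) * t ^ (n + N)) sums (f t - (\<Sum>n<N. a n * t ^ n))"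
      using sums_iff_shift[of "\<lambda>n. a n * t ^ n" N] sums[OF te] by simp
    have g: "(\<lambda>n. A * (R * norm t) ^ N * (1 / 2) ^ n) sums (A * (R * norm t) ^ N * 2)"
      using sums_mult[OF geometric_sums[of "1 / 2 :: real"]] by simp
    have "norm (f t - (\<Sum>n<N. a n * t ^ n)) \<le> A * (R * norm t) ^ N * 2"
      unfolding sums_unique[OF s] sums_unique[OF g]
    proof (rule norm_suminf_le)
      fix n
      have "norm (a (n + N) * t ^ (n + N)) \<le> (A * R ^ (n + N)) * norm t ^ (n + N)"
        unfolding norm_mult norm_power by (intro mult_right_mono an) auto
      also have "\<dots> = A * (R * norm t) ^ N * (R * norm t) ^ n"
        by (simp add: power_add power_mult_distrib mult_ac)
      also have "\<dots> \<le> A * (R * norm t) ^ N * (1 / 2) ^ n"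
        using A0 R tR by (intro mult_left_mono power_mono) auto
      finally show "norm (a (n + N) * t ^ (n + N)) \<le> A * (R * norm t) ^ N * (1 / 2) ^ n" .
    qed (use g in \<open>rule sums_summable\<close>)
    then show "norm (f t - (\<Sum>n<N. a n * t ^ n)) \<le> (A * R ^ N * 2) * norm t ^ N"
      by (simp add: power_mult_distrib mult_ac)
  qed (use R in auto)
  moreover have "a 0 = f 0" by (simp add: a_def)
  ultimately show ?thesis using R an by blast
qed

text \<open>The j-th power of the l-th root equals the l-th power of the j-th root, so the sum is
  geometric with ratio \<zeta> \<noteq> 1 and \<zeta>^N = 1.\<close>

lemma sum_root_of_unity_powers:
  assumes "1 \<le> j" "j < N"
  shows "(\<Sum>l<N. (exp (2 * of_real pi * \<i> * of_nat l / of_nat N)) ^ j) = 0"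
proof -
  define \<zeta> where "\<zeta> = exp (2 * of_real pi * \<i> * of_nat j / of_nat N)"
  have "\<zeta> \<noteq> 1"
    using complex_root_unity_eq_1[of N j] assms nat_dvd_not_less[of j N] by (simp add: \<zeta>_def)
  have "\<zeta> ^ N = exp (of_nat N * (2 * of_real pi * \<i> * of_nat j / of_nat N))"
    unfolding \<zeta>_def by (rule exp_of_nat_mult[symmetric])
  also have "\<dots> = 1" using assms exp_2pi_1_int[of "int j"] by (simp add: mult_ac)
  finally have "(\<Sum>l<N. \<zeta> ^ l) = 0" using geometric_sum[OF \<open>\<zeta> \<noteq> 1\<close>, of N] by simp
  moreover have "(exp (2 * of_real pi * \<i> * of_nat l / of_nat N)) ^ j = \<zeta> ^ l" for l
    unfolding \<zeta>_def exp_of_nat_mult[symmetric] by (simp add: mult_ac)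
  ultimately show ?thesis by simp
qed

text \<open>Averaging over the rotations by \<open>N\<close>-th roots of unity kills the harmonic part up to order
  \<open>N\<close>; as \<open>P\<close> is nonnegative it is bounded by \<open>N\<close> times its own average.\<close>
lemma vanishes_to_nonneg_part:
  assumes f: "f holomorphic_on ball 0 \<epsilon>" and e: "\<epsilon> > 0" and f0: "f 0 = 0" and N: "N \<ge> 1"
    and P: "\<And>t. P t \<ge> 0" and v: "vanishes_to N (\<lambda>t. Re (f t) + P t)"
  shows "vanishes_to N P"
proof -
  obtain R a A where a': "R > 0" "\<And>n. norm (a n) \<le> A * R ^ n" "a 0 = f 0"
    "\<And>N. vanishes_to N (\<lambda>t. f t - (\<Sum>n<N. a n * t ^ n))"
    using holomorphic_taylor[OF f e] by blast
  note a = a'(3) a'(4)[of N]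
  \<comment> \<open>Replacing f by its Taylor polynomial of degree below N costs O(t^N), and the
    average over N-th roots of unity kills exactly the powers 1, ..., N - 1; the constant term is
    f(0) = 0.\<close>
  define p where "p t = (\<Sum>n<N. a n * t ^ n)" for t
  have "vanishes_to N (\<lambda>t. (Re (f t) + P t) - Re (f t - p t))"
    by (rule vanishes_to_diff[OF v vanishes_to_Re]) (use a in \<open>simp add: p_def\<close>)
  then have v2: "vanishes_to N (\<lambda>t. Re (p t) + P t)" by (simp add: add.commute)
  define \<omega> where "\<omega> l = exp (2 * of_real pi * \<i> * of_nat l / of_nat N)" for l
  have n\<omega>: "norm (\<omega> l) = 1" for l unfolding \<omega>_def norm_exp_eq_Re by simp
  have p0: "(\<Sum>l<N. p (\<omega> l * t)) = 0" for t
  proof -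
    have "(\<Sum>l<N. p (\<omega> l * t)) = (\<Sum>n<N. a n * t ^ n * (\<Sum>l<N. \<omega> l ^ n))"
      unfolding p_def by (subst sum.swap) (simp add: sum_distrib_left power_mult_distrib mult_ac)
    also have "\<dots> = 0"
    proof (rule sum.neutral, rule ballI)
      fix n assume "n \<in> {..<N}"
      then show "a n * t ^ n * (\<Sum>l<N. \<omega> l ^ n) = 0"
        using sum_root_of_unity_powers[of n N] a(1) f0 unfolding \<omega>_def by (cases "n = 0") auto
    qed
    finally show ?thesis .
  qed
  have rot: "vanishes_to N (\<lambda>t. Re (p (\<omega> l * t)) + P (\<omega> l * t))" for l
  proof -
    obtain C \<delta> where "\<delta> > 0" "\<And>t. norm t < \<delta> \<Longrightarrow> norm (Re (p t) + P t) \<le> C * norm t ^ N"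
      by (rule vanishes_toE[OF v2]) (rule that; blast)
    note d = this
    show ?thesis
    proof (rule vanishes_toI[OF d(1)])
      fix t :: complex assume "norm t < \<delta>"
      then show "norm (Re (p (\<omega> l * t)) + P (\<omega> l * t)) \<le> C * norm t ^ N"
        using d(2)[of "\<omega> l * t"] by (simp add: norm_mult n\<omega>)
    qed
  qed
  have "vanishes_to N (\<lambda>t. \<Sum>l<N. Re (p (\<omega> l * t)) + P (\<omega> l * t))"
    by (rule vanishes_to_sum) (rule rot)
  then show ?thesis
  proof (rule vanishes_to_norm_le)
    fix t
    have "P t = P (\<omega> 0 * t)" by (simp add: \<omega>_def)
    also have "\<dots> \<le> (\<Sum>l<N. P (\<omega> l * t))"
      using N P by (intro member_le_sum) auto
    also have "\<dots> = (\<Sum>l<N. Re (p (\<omega> l * t)) + P (\<omega> l * t))"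
      using p0[of t] by (simp add: sum.distrib Re_sum[symmetric] del: Re_sum)
    finally show "norm (P t) \<le> norm (\<Sum>l<N. Re (p (\<omega> l * t)) + P (\<omega> l * t))"
      using P[of t] by simp
  qed
qed

lemma poly_vanishes_to:
  fixes q :: "complex poly"
  assumes "vanishes_to N (poly q)" "k < N"
  shows "coeff q k = 0"
proof (cases "q = 0")
  case False
  obtain h where h: "q = [:- 0, 1:] ^ order 0 q * h" "\<not> [:- 0, 1:] dvd h"
    using order_decomp[OF False, of 0] by blast
  then have h0: "poly h 0 \<noteq> 0" by (simp add: poly_eq_0_iff_dvd)
  have qt: "poly q t = t ^ order 0 q * poly h t" for t
    by (subst h(1)) (simp add: poly_power)
  have "poly h holomorphic_on ball 0 1"
    by (intro holomorphic_intros)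
  obtain c \<delta> where "c > 0" "\<delta> > 0" "\<And>t. norm t < \<delta> \<Longrightarrow> c * norm t ^ order 0 q \<le> norm (poly q t)"
    using holomorphic_order_bounds[OF \<open>poly h holomorphic_on ball 0 1\<close> zero_less_one h0 qt] by blast
  note b = this
  from vanishes_to_lower_bound[OF assms(1) b] have "N \<le> order 0 q" .
  then have "monom 1 N dvd q" using False by (simp add: monom_1_dvd_iff)
  then show ?thesis using assms(2) by (simp add: monom_1_dvd_iff')
qed simp

section \<open>Contact with holomorphic curves\<close>

definition tay :: "nat \<Rightarrow> complex \<Rightarrow> complex" where
  "tay N \<zeta> = (\<Sum>j\<in>{1..<N}. ucoef j * \<zeta> ^ j)"

lemma tay_0: "tay N 0 = 0"
  by (auto simp: tay_def intro!: sum.neutral)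

lemma vanishes_to_tay:
  assumes "vanishes_to k f"
  shows "vanishes_to k (\<lambda>t. tay N (f t))"
  unfolding tay_def
proof (intro vanishes_to_sum vanishes_to_const_mult)
  fix j assume "j \<in> {1..<N}"
  then have "k \<le> k * j" by simp
  then show "vanishes_to k (\<lambda>t. f t ^ j)"
    by (rule vanishes_to_antimono[OF vanishes_to_power[OF assms]])
qed

lemma vanishes_to_usum_tay:
  assumes "vanishes_to k f" "N \<ge> 2"
  shows "vanishes_to (k * N) (\<lambda>t. usum (f t) - Re (tay N (f t)))"
proof -
  obtain C where C: "\<And>z. \<bar>usum z - Re (tay N z)\<bar> \<le> C * norm z ^ N"
    using usum_taylor[OF assms(2)] unfolding tay_def by blast
  have "C \<ge> 0" using order_trans[OF abs_ge_zero C[of 1]] by simp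
  show ?thesis
  proof (rule vanishes_to_dominated[OF vanishes_to_power[OF assms(1), of N] zero_less_one])
    fix t :: complex
    show "norm (usum (f t) - Re (tay N (f t))) \<le> C * norm (f t ^ N)"
      using C[of "f t"] by (simp add: norm_power)
  qed fact
qed

lemma psh_part_bounds:
  "(norm (cusp a b z))\<^sup>2 \<le> psh_part a b c z"
  "j \<notin> {a, b, c} \<Longrightarrow> (norm (z $ j))\<^sup>2 \<le> psh_part a b c z"
  "0 \<le> psh_part a b c z"
proof -
  have s: "(\<Sum>j\<in>- {a, b, c}. (norm (z $ j))\<^sup>2) \<ge> 0" by (intro sum_nonneg) auto
  then show "(norm (cusp a b z))\<^sup>2 \<le> psh_part a b c z" "0 \<le> psh_part a b c z"
    by (auto simp: psh_part_def)
  assume "j \<notin> {a, b, c}"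
  then have "(norm (z $ j))\<^sup>2 \<le> (\<Sum>j\<in>- {a, b, c}. (norm (z $ j))\<^sup>2)"
    by (intro member_le_sum[of j "- {a, b, c}" "\<lambda>j. (norm (z $ j))\<^sup>2"]) auto
  then show "(norm (z $ j))\<^sup>2 \<le> psh_part a b c z" by (simp add: psh_part_def add_increasing)
qed

lemma curve_split:
  fixes \<gamma> :: "complex \<Rightarrow> complex^'n::finite"
  assumes e: "\<epsilon> > 0" and hol: "\<And>i. (\<lambda>t. \<gamma> t $ i) holomorphic_on ball 0 \<epsilon>" and g0: "\<gamma> 0 = 0"
    and N: "N \<ge> 2" and v: "vanishes_to N (\<lambda>t. rdef a b c (\<gamma> t))"
  shows "vanishes_to N (\<lambda>t. psh_part a b c (\<gamma> t))"
    and "vanishes_to N (\<lambda>t. \<gamma> t $ c + tay N (\<gamma> t $ a))"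
proof -
  define g where "g t = \<gamma> t $ c + tay N (\<gamma> t $ a)" for t
  have gh: "g holomorphic_on ball 0 \<epsilon>"
    unfolding g_def tay_def by (intro holomorphic_intros hol)
  have g00: "g 0 = 0" by (simp add: g_def g0 tay_0)
  have za: "vanishes_to 1 (\<lambda>t. \<gamma> t $ a)"
    by (rule holomorphic_vanishes_to_1[OF hol e]) (simp add: g0)
  have "vanishes_to N (\<lambda>t. rdef a b c (\<gamma> t) - (usum (\<gamma> t $ a) - Re (tay N (\<gamma> t $ a))))"
    using vanishes_to_usum_tay[OF za N] by (intro vanishes_to_diff[OF v]) simp
  then have s: "vanishes_to N (\<lambda>t. Re (g t) + psh_part a b c (\<gamma> t))"
    by (simp add: rdef_def g_def algebra_simps)
  show *: "vanishes_to N (\<lambda>t. psh_part a b c (\<gamma> t))"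
    by (rule vanishes_to_nonneg_part[OF gh e g00 _ psh_part_bounds(3) s]) (use N in simp)
  have "vanishes_to N (\<lambda>t. Re (g t))"
    using vanishes_to_diff[OF s *] by simp
  from holomorphic_vanishes_to_Re[OF gh e g00 this]
  show "vanishes_to N (\<lambda>t. \<gamma> t $ c + tay N (\<gamma> t $ a))" by (simp add: g_def[abs_def])
qed

lemma curve_psh_part:
  assumes "vanishes_to (2 * k) (\<lambda>t. psh_part a b c (\<gamma> t))"
  shows "vanishes_to k (\<lambda>t. cusp a b (\<gamma> t))"
    and "j \<notin> {a, b, c} \<Longrightarrow> vanishes_to k (\<lambda>t. \<gamma> t $ j)"
proof -
  have le: "norm ((norm x)\<^sup>2) \<le> norm (psh_part a b c z)" if "(norm x)\<^sup>2 \<le> psh_part a b c z" for x :: complex and z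
    using that psh_part_bounds(3)[of a b c z] by simp
  show "vanishes_to k (\<lambda>t. cusp a b (\<gamma> t))"
    by (rule vanishes_to_sqrt[OF vanishes_to_norm_le[OF assms le[OF psh_part_bounds(1)]]])
  show "vanishes_to k (\<lambda>t. \<gamma> t $ j)" if "j \<notin> {a, b, c}"
    by (rule vanishes_to_sqrt[OF vanishes_to_norm_le[OF assms le[OF psh_part_bounds(2)[OF that]]]])
qed

text \<open>A cusp \<open>z_b^2 = z_a^3\<close> met to order \<open>4\<close> forces \<open>z_b'(0) = 0\<close> from the order two terms and then
  \<open>z_a'(0) = 0\<close> from the order three terms.\<close>
lemma regular_curve_contact:
  fixes \<gamma> :: "complex \<Rightarrow> complex^'n::finite"
  assumes e: "\<epsilon> > 0" and hol: "\<And>i. (\<lambda>t. \<gamma> t $ i) holomorphic_on ball 0 \<epsilon>" and g0: "\<gamma> 0 = 0"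
    and v: "vanishes_to 8 (\<lambda>t. rdef a b c (\<gamma> t))"
  shows "vanishes_to 2 (\<lambda>t. \<gamma> t $ i)"
proof -
  \<comment> \<open>The square of the norm halves the order 8, which leaves order 4 for the cusp;
    the step for z_a uses it in the form 3 * 1 + 1.\<close>
  have split: "vanishes_to (2 * 4) (\<lambda>t. psh_part a b c (\<gamma> t))" "vanishes_to 8 (\<lambda>t. \<gamma> t $ c + tay 8 (\<gamma> t $ a))"
    using curve_split[OF e hol g0 _ v] by auto
  note cv = curve_psh_part[OF split(1)]
  have z1: "vanishes_to 1 (\<lambda>t. \<gamma> t $ j)" for j
    by (rule holomorphic_vanishes_to_1[OF hol e]) (simp add: g0)
  have "vanishes_to 3 (\<lambda>t. cusp a b (\<gamma> t) + (\<gamma> t $ a) ^ 3)"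
    using vanishes_to_add[OF vanishes_to_antimono[OF cv(1), of 3]] vanishes_to_power[OF z1, of 3] by simp
  then have "vanishes_to (2 * 1 + 1) (\<lambda>t. (\<gamma> t $ b) ^ 2)"
    by (simp add: cusp_def numeral_3_eq_3)
  then have zb: "vanishes_to 2 (\<lambda>t. \<gamma> t $ b)"
    using holomorphic_root_vanishes[OF hol e, of b 2 1] g0 by (simp add: numeral_2_eq_2)
  have "vanishes_to 4 (\<lambda>t. (\<gamma> t $ b) ^ 2 - cusp a b (\<gamma> t))"
    using vanishes_to_diff[OF _ cv(1)] vanishes_to_power[OF zb, of 2] by simp
  then have "vanishes_to (3 * 1 + 1) (\<lambda>t. (\<gamma> t $ a) ^ 3)"
    by (simp add: cusp_def)
  then have za: "vanishes_to 2 (\<lambda>t. \<gamma> t $ a)"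
    using holomorphic_root_vanishes[OF hol e, of a 3 1] g0 by (simp add: numeral_2_eq_2)
  have "vanishes_to 2 (\<lambda>t. (\<gamma> t $ c + tay 8 (\<gamma> t $ a)) - tay 8 (\<gamma> t $ a))"
    by (rule vanishes_to_diff[OF vanishes_to_antimono[OF split(2)] vanishes_to_tay[OF za]]) simp
  then have zc: "vanishes_to 2 (\<lambda>t. \<gamma> t $ c)" by simp
  show ?thesis
  proof (cases "i \<in> {a, b, c}")
    case True
    then show ?thesis using za zb zc by auto
  next
    case False
    then show ?thesis by (intro vanishes_to_antimono[OF cv(2)]) auto
  qed
qed

text \<open>The hypothesis forces the coefficient of s^(d j) in W to be - c_j. Its absolute value is
  at least j!, whereas Cauchy estimates allow only A R^(d j). The exponent d allows for curves whose
  a-component has multiplicity d.\<close>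

lemma tay_divergent:
  assumes W: "W holomorphic_on ball 0 \<eta>" and e: "\<eta> > 0" and d: "d > 0"
    and v: "\<And>N. N \<ge> 2 \<Longrightarrow> vanishes_to N (\<lambda>s. W s + tay N (s ^ d))"
  shows False
proof -
  obtain R a A where R: "R > 0" and an: "\<And>n. norm (a n) \<le> A * R ^ n"
    and tl: "\<And>N. vanishes_to N (\<lambda>t. W t - (\<Sum>n<N. a n * t ^ n))"
    using holomorphic_taylor[OF W e] by blast
  have bound: "fact j \<le> A * (R ^ d) ^ j" if j: "j \<ge> 1" for j
  proof -
    \<comment> \<open>The least order of vanishing that controls the coefficient of s^(d j).\<close>
    define N where "N = d * j + 1"
    have dj: "j \<le> d * j" using d by simp
    have N: "N \<ge> 2" "j < N" "d * j < N" unfolding N_def using j dj by linarith+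
    \<comment> \<open>Modulo O(s^N) this polynomial is W(s) + tay N (s^d), so its coefficients below
      degree N vanish. In degree d j only the monomials with n = d j and i = j contribute, because d
      > 0.\<close>
    define q where "q = (\<Sum>n<N. monom (a n) n) + (\<Sum>i\<in>{1..<N}. monom (ucoef i) (d * i))"
    have q: "poly q s = (W s + tay N (s ^ d)) - (W s - (\<Sum>n<N. a n * s ^ n))" for s
      by (simp add: q_def poly_sum poly_monom tay_def power_mult)
    have "vanishes_to N (poly q)"
      using vanishes_to_diff[OF v[OF N(1)] tl[of N]] unfolding q[symmetric] .
    then have "coeff q (d * j) = 0" using N(3) by (rule poly_vanishes_to)
    moreover have "coeff q (d * j) = a (d * j) + ucoef j"
      using N j d by (simp add: q_def coeff_sum coeff_monom if_distrib cong: if_cong)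
    ultimately have "ucoef j = - a (d * j)" by (simp add: eq_neg_iff_add_eq_0 add.commute)
    then have "norm (ucoef j) \<le> A * R ^ (d * j)" using an[of "d * j"] by simp
    with ucoef_ge[OF j] show ?thesis by (simp add: power_mult)
  qed
  have "(\<lambda>n. A * (inverse (fact n) * (R ^ d) ^ n)) \<longlonglongrightarrow> A * 0"
    by (intro tendsto_mult tendsto_const summable_LIMSEQ_zero summable_exp)
  then have "eventually (\<lambda>n. A * (inverse (fact n) * (R ^ d) ^ n) < 1) sequentially"
    by (intro order_tendstoD) auto
  then obtain n where n: "n \<ge> 1" "A * (inverse (fact n) * (R ^ d) ^ n) < 1"
    unfolding eventually_sequentially by (metis le_cases)
  then have "A * (R ^ d) ^ n < fact n" by (simp add: field_simps)
  with bound[OF n(1)] show False by simp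
qed

lemma vanishes_to_compose:
  assumes f: "vanishes_to N f" and \<tau>: "vanishes_to 1 \<tau>"
  shows "vanishes_to N (\<lambda>s. f (\<tau> s))"
proof -
  obtain C \<delta> where C: "C > 0" "\<delta> > 0" "\<And>t. norm t < \<delta> \<Longrightarrow> norm (f t) \<le> C * norm t ^ N"
    by (rule vanishes_toE[OF f]) (rule that; blast)
  obtain D \<eta> where D: "D > 0" "\<eta> > 0" "\<And>t. norm t < \<eta> \<Longrightarrow> norm (\<tau> t) \<le> D * norm t ^ 1"
    by (rule vanishes_toE[OF \<tau>]) (rule that; blast)
  show ?thesis
  proof (rule vanishes_toI[of "min \<eta> (\<delta> / D)"])
    fix s :: complex assume s: "norm s < min \<eta> (\<delta> / D)"
    have 1: "norm (\<tau> s) \<le> D * norm s" using D(3)[of s] s by simp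
    also have "\<dots> < \<delta>" using s D(1) by (simp add: field_simps)
    finally have "norm (f (\<tau> s)) \<le> C * norm (\<tau> s) ^ N" by (rule C(3))
    also have "\<dots> \<le> C * (D * norm s) ^ N" using 1 C(1) by (intro mult_left_mono power_mono) auto
    finally show "norm (f (\<tau> s)) \<le> (C * D ^ N) * norm s ^ N" by (simp add: power_mult_distrib)
  qed (use C D in auto)
qed

text \<open>If f has order d at 0, then f = \<sigma>^d with \<sigma>(t) = t g(t) and g(0) \<noteq>
  0. Thus \<sigma> is a local coordinate, and \<tau> is its inverse.\<close>

lemma holomorphic_local_power:
  assumes f: "f holomorphic_on ball 0 \<epsilon>" and e: "\<epsilon> > 0" and f0: "f 0 = 0"
    and nz: "\<not> (\<forall>t\<in>ball 0 \<epsilon>. f t = 0)"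
  shows "\<exists>d \<tau> \<eta>. d > 0 \<and> \<eta> > 0 \<and> \<tau> holomorphic_on ball 0 \<eta> \<and> \<tau> 0 = 0 \<and>
     (\<forall>s\<in>ball 0 \<eta>. \<tau> s \<in> ball 0 \<epsilon> \<and> f (\<tau> s) = s ^ d)"
proof -
  let ?P = "\<lambda>n. n > 0 \<and> (deriv ^^ n) f 0 \<noteq> 0"
  have "\<exists>n. ?P n"
  proof (rule ccontr)
    assume "\<not> ?thesis"
    then have "(deriv ^^ n) f 0 = 0" if "0 < n" for n using that by blast
    then have "f t = f 0" if "t \<in> ball 0 \<epsilon>" for t
      by (rule holomorphic_fun_eq_const_on_connected[OF f open_ball connected_ball]) (use that e in auto)
    with nz f0 show False by simp
  qed
  define d where "d = (LEAST n. ?P n)"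
  have d: "?P d" unfolding d_def by (rule LeastI_ex) fact
  have least: "\<not> ?P i" if "i < d" for i using not_less_Least[of i ?P] that unfolding d_def by blast
  have z0: "0 \<in> ball (0::complex) \<epsilon>" and d1: "0 < d" and d2: "(deriv ^^ d) f 0 \<noteq> 0"
    and d3: "\<And>i. 0 < i \<Longrightarrow> i < d \<Longrightarrow> (deriv ^^ i) f 0 = 0"
    using e d least by auto
  obtain g r where r: "0 < r" and gh: "g holomorphic_on ball 0 r"
     and fg: "\<And>w. w \<in> ball 0 r \<Longrightarrow> f w - f 0 = ((w - 0) * g w) ^ d"
     and gnz: "\<And>w. w \<in> ball 0 r \<Longrightarrow> g w \<noteq> 0"
    using holomorphic_factor_order_of_zero_strong[OF f open_ball z0 d1 d2 d3] by metis
  define \<sigma> where "\<sigma> t = t * g t" for t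
  define r' where "r' = min r \<epsilon>"
  have r': "r' > 0" using r e by (simp add: r'_def)
  have gh': "g holomorphic_on ball 0 r'" by (rule holomorphic_on_subset[OF gh]) (auto simp: r'_def)
  have sh: "\<sigma> holomorphic_on ball 0 r'" unfolding \<sigma>_def by (intro holomorphic_intros gh')
  have "(g has_field_derivative deriv g 0) (at 0)"
    using gh' r' by (intro holomorphic_derivI[of g "ball 0 r'"]) auto
  then have "(\<sigma> has_field_derivative g 0) (at 0)"
    unfolding \<sigma>_def[abs_def] by (auto intro!: derivative_eq_intros)
  then have ds: "deriv \<sigma> 0 \<noteq> 0" using gnz[of 0] r by (simp add: DERIV_imp_deriv)
  obtain \<rho> where \<rho>: "\<rho> > 0" "ball 0 \<rho> \<subseteq> ball (0::complex) r'" "open (\<sigma> ` ball 0 \<rho>)" "inj_on \<sigma> (ball 0 \<rho>)"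
    using has_complex_derivative_locally_invertible[OF sh _ open_ball ds] r' by (metis centre_in_ball)
  obtain \<tau> where \<tau>: "\<tau> holomorphic_on \<sigma> ` ball 0 \<rho>" "\<And>z. z \<in> ball 0 \<rho> \<Longrightarrow> \<tau> (\<sigma> z) = z"
    using holomorphic_has_inverse[OF holomorphic_on_subset[OF sh \<rho>(2)] open_ball \<rho>(4)] by metis
  have "\<sigma> 0 = 0" by (simp add: \<sigma>_def)
  then have "0 \<in> \<sigma> ` ball 0 \<rho>" using \<rho>(1) by (metis centre_in_ball imageI)
  then obtain \<eta> where \<eta>: "\<eta> > 0" "ball 0 \<eta> \<subseteq> \<sigma> ` ball 0 \<rho>"
    using \<rho>(3) open_contains_ball by blast
  have "\<tau> s \<in> ball 0 \<epsilon> \<and> f (\<tau> s) = s ^ d" if s: "s \<in> ball 0 \<eta>" for s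
  proof -
    obtain t where t: "t \<in> ball 0 \<rho>" "s = \<sigma> t" using s \<eta>(2) by blast
    then have "\<tau> s = t" using \<tau>(2) by simp
    moreover have "t \<in> ball 0 r" "t \<in> ball 0 \<epsilon>" using t(1) \<rho>(2) by (auto simp: r'_def)
    ultimately show ?thesis using fg[of t] f0 t(2) by (simp add: \<sigma>_def)
  qed
  moreover have "\<tau> 0 = 0" using \<tau>(2)[of 0] \<open>\<sigma> 0 = 0\<close> \<rho>(1) by simp
  moreover have "\<tau> holomorphic_on ball 0 \<eta>" by (rule holomorphic_on_subset[OF \<tau>(1) \<eta>(2)])
  ultimately show ?thesis using d \<eta>(1) by blast
qed

text \<open>The cusp and the remaining coordinates vanish identically, being flat and holomorphic.
  If z_a were not identically zero, reparametrizing it as s^d would give the c-component the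
  divergent expansion - \<Sum> c_j s^(d j). With z_a = 0, the cusp equation gives z_b = 0, and
  flatness then gives z_c = 0.\<close>

lemma flat_curve_constant:
  fixes \<gamma> :: "complex \<Rightarrow> complex^'n::finite"
  assumes e: "\<epsilon> > 0" and hol: "\<And>i. (\<lambda>t. \<gamma> t $ i) holomorphic_on ball 0 \<epsilon>" and g0: "\<gamma> 0 = 0"
    and flat: "\<And>N. vanishes_to N (\<lambda>t. rdef a b c (\<gamma> t))"
  shows "\<forall>t\<in>ball 0 \<epsilon>. \<gamma> t = 0"
proof -
  have psh: "vanishes_to N (\<lambda>t. psh_part a b c (\<gamma> t))" if "N \<ge> 2" for N
    by (rule curve_split(1)[OF e hol g0 that flat])
  have w: "vanishes_to N (\<lambda>t. \<gamma> t $ c + tay N (\<gamma> t $ a))" if "N \<ge> 2" for N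
    by (rule curve_split(2)[OF e hol g0 that flat])
  have psh': "vanishes_to (2 * N) (\<lambda>t. psh_part a b c (\<gamma> t))" for N
    by (rule vanishes_to_antimono[OF psh[of "2 * N + 2"]]) auto
  have others: "\<forall>t\<in>ball 0 \<epsilon>. \<gamma> t $ j = 0" if "j \<notin> {a, b, c}" for j
    by (rule holomorphic_flat_zero[OF hol e]) (use g0 curve_psh_part(2)[OF psh' that] in auto)
  have "\<forall>t\<in>ball 0 \<epsilon>. cusp a b (\<gamma> t) = 0"
  proof (rule holomorphic_flat_zero[OF _ e])
    show "(\<lambda>t. cusp a b (\<gamma> t)) holomorphic_on ball 0 \<epsilon>"
      unfolding cusp_def by (intro holomorphic_intros hol)
  qed (use g0 curve_psh_part(1)[OF psh'] in \<open>auto simp: cusp_def\<close>)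
  then have cusp0: "(\<gamma> t $ b)\<^sup>2 = (\<gamma> t $ a) ^ 3" if "t \<in> ball 0 \<epsilon>" for t
    using that by (simp add: cusp_def)
  have za: "\<forall>t\<in>ball 0 \<epsilon>. \<gamma> t $ a = 0"
  proof (rule ccontr)
    assume nz: "\<not> ?thesis"
    obtain d \<tau> \<eta> where d: "d > 0" and \<eta>: "\<eta> > 0" and \<tau>: "\<tau> holomorphic_on ball 0 \<eta>" "\<tau> 0 = 0"
      and \<tau>f: "\<And>s. s \<in> ball 0 \<eta> \<Longrightarrow> \<tau> s \<in> ball 0 \<epsilon>" "\<And>s. s \<in> ball 0 \<eta> \<Longrightarrow> \<gamma> (\<tau> s) $ a = s ^ d"
      using holomorphic_local_power[OF hol e _ nz] g0 by (metis zero_index)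
    have \<tau>1: "vanishes_to 1 \<tau>" by (rule holomorphic_vanishes_to_1[OF \<tau>(1) \<eta> \<tau>(2)])
    have "(\<lambda>s. \<gamma> (\<tau> s) $ c) holomorphic_on ball 0 \<eta>"
      using holomorphic_on_compose_gen[OF \<tau>(1) hol[of c]] \<tau>f(1) by (auto simp: o_def image_subset_iff)
    then show False
    proof (rule tay_divergent[OF _ \<eta> d])
      fix N :: nat assume "N \<ge> 2"
      from vanishes_to_compose[OF w[OF this] \<tau>1]
      show "vanishes_to N (\<lambda>s. \<gamma> (\<tau> s) $ c + tay N (s ^ d))"
        by (rule vanishes_to_eventually_eq[OF _ \<eta>]) (use \<tau>f(2) in auto)
    qed
  qed
  have zb: "\<gamma> t $ b = 0" if "t \<in> ball 0 \<epsilon>" for t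
    using cusp0[OF that] za that by simp
  have zc: "\<forall>t\<in>ball 0 \<epsilon>. \<gamma> t $ c = 0"
  proof (rule holomorphic_flat_zero[OF hol e])
    show "vanishes_to N (\<lambda>t. \<gamma> t $ c)" for N
    proof -
      have "vanishes_to N (\<lambda>t. \<gamma> t $ c + tay (N + 2) (\<gamma> t $ a))"
        by (rule vanishes_to_antimono[OF w]) auto
      then show ?thesis
        by (rule vanishes_to_eventually_eq[OF _ e]) (use za in \<open>auto simp: tay_0\<close>)
    qed
  qed (simp add: g0)
  show ?thesis
  proof (intro ballI)
    fix t :: complex assume t: "t \<in> ball 0 \<epsilon>"
    have "\<gamma> t $ j = 0" for j
      using za zb[OF t] zc others[of j] t by (cases "j \<in> {a, b, c}") auto
    then show "\<gamma> t = 0" by (simp add: vec_eq_iff)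
  qed
qed

section \<open>Curves in complex hypersurfaces\<close>

lemma bounded_linear_vec_scale:
  fixes e :: "complex^'n::finite"
  shows "bounded_linear (\<lambda>\<zeta>. \<zeta> *s e)"
  unfolding linear_conv_bounded_linear[symmetric]
  by (rule linearI) (simp_all add: vec_eq_iff algebra_simps)

lemma cholo_on_has_derivative:
  "cholo_on U h \<Longrightarrow> z \<in> U \<Longrightarrow> (h has_derivative frechet_derivative h (at z)) (at z)"
  unfolding cholo_on_def by (simp add: frechet_derivative_works)

lemma cholo_on_line_derivative:
  fixes e z :: "complex^'n::finite"
  assumes h: "cholo_on U h" and z: "z + \<zeta> *s e \<in> U"
  shows "((\<lambda>\<zeta>. h (z + \<zeta> *s e)) has_field_derivative frechet_derivative h (at (z + \<zeta> *s e)) e) (at \<zeta>)"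
proof -
  let ?D = "frechet_derivative h (at (z + \<zeta> *s e))"
  have "((\<lambda>\<zeta>. z + \<zeta> *s e) has_derivative (\<lambda>\<delta>. \<delta> *s e)) (at \<zeta>)"
    using has_derivative_add[OF has_derivative_const bounded_linear_imp_has_derivative[OF bounded_linear_vec_scale]]
    by simp
  from has_derivative_compose[OF this cholo_on_has_derivative[OF h z]]
  have "((\<lambda>\<zeta>. h (z + \<zeta> *s e)) has_derivative (\<lambda>\<delta>. ?D (\<delta> *s e))) (at \<zeta>)" .
  moreover have "?D (\<delta> *s e) = ?D e * \<delta>" for \<delta>
    using h z unfolding cholo_on_def by (simp add: mult.commute)
  ultimately show ?thesis by (simp add: has_field_derivative_def)
qed

text \<open>Complex differentiability at each point suffices for continuous derivatives: apply the Cauchy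
  estimate to \<open>h (z + \<zeta> e) - h (\<zeta> e)\<close> and use the uniform continuity of \<open>h\<close>.\<close>
lemma cholo_on_derivative_continuous:
  fixes e :: "complex^'n::finite"
  assumes h: "cholo_on U h" and U: "0 \<in> U"
  shows "isCont (\<lambda>z. frechet_derivative h (at z) e) 0"
proof -
  obtain R where R: "R > 0" "cball 0 R \<subseteq> U"
    using h U open_contains_cball[of U] unfolding cholo_on_def by blast
  have "continuous_on U h"
    using cholo_on_has_derivative[OF h] has_derivative_continuous
    by (intro continuous_at_imp_continuous_on) blast
  then have "continuous_on (cball 0 R) h" using R(2) by (rule continuous_on_subset)
  then have uc: "uniformly_continuous_on (cball 0 R) h"
    by (intro compact_uniformly_continuous compact_cball)
  obtain \<rho> where \<rho>: "\<rho> > 0" "\<And>\<zeta>. norm \<zeta> \<le> \<rho> \<Longrightarrow> norm (\<zeta> *s e) \<le> R / 2"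
  proof -
    obtain K where K: "K > 0" "\<And>\<zeta>. norm (\<zeta> *s e) \<le> norm \<zeta> * K"
      using bounded_linear.pos_bounded[OF bounded_linear_vec_scale[of e]] by blast
    show ?thesis
    proof (rule that[of "R / (2 * K)"])
      fix \<zeta> :: complex assume \<zeta>: "norm \<zeta> \<le> R / (2 * K)"
      have "norm \<zeta> * K \<le> R / (2 * K) * K" using \<zeta> K(1) by (intro mult_right_mono) auto
      also have "\<dots> = R / 2" using K(1) by simp
      finally show "norm (\<zeta> *s e) \<le> R / 2" using K(2)[of \<zeta>] by linarith
    qed (use R K in auto)
  qed
  have "\<exists>d>0. \<forall>z. norm (z - 0) < d \<longrightarrow> norm (frechet_derivative h (at z) e - frechet_derivative h (at 0) e) < \<epsilon>" if \<epsilon>: "\<epsilon> > 0" for \<epsilon>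
  proof -
    \<comment> \<open>The Cauchy estimate divides by the radius \<rho>, which turns this bound on
      the difference into \<epsilon> / 2 for the derivatives.\<close>
    have "\<epsilon> * \<rho> / 2 > 0" using \<epsilon> \<rho> by simp
    then obtain d where d: "d > 0" "\<And>x y. x \<in> cball 0 R \<Longrightarrow> y \<in> cball 0 R \<Longrightarrow> dist y x < d \<Longrightarrow> dist (h y) (h x) < \<epsilon> * \<rho> / 2"
      using uc unfolding uniformly_continuous_on_def by metis
    have "norm (frechet_derivative h (at z) e - frechet_derivative h (at 0) e) < \<epsilon>" if z: "norm z < min d (R / 2)" for z
    proof -
      define k where "k \<zeta> = h (z + \<zeta> *s e) - h (0 + \<zeta> *s e)" for \<zeta>
      have in1: "z + \<zeta> *s e \<in> cball 0 R" and in2: "0 + \<zeta> *s e \<in> cball 0 R" if "norm \<zeta> \<le> \<rho>" for \<zeta>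
        using \<rho>(2)[OF that] z norm_triangle_ineq[of z "\<zeta> *s e"] R(1) by auto
      have kd: "(k has_field_derivative frechet_derivative h (at (z + \<zeta> *s e)) e - frechet_derivative h (at (0 + \<zeta> *s e)) e) (at \<zeta>)"
        if "norm \<zeta> \<le> \<rho>" for \<zeta>
        unfolding k_def using in1[OF that] in2[OF that] R(2)
        by (intro DERIV_diff cholo_on_line_derivative[OF h]) auto
      have kh: "k holomorphic_on ball 0 \<rho>"
        unfolding holomorphic_on_open[OF open_ball] using kd[OF less_imp_le] by (metis mem_ball_0)
      have kc: "continuous_on (cball 0 \<rho>) k"
        using DERIV_isCont[OF kd] by (intro continuous_at_imp_continuous_on) simp
      have "norm ((deriv ^^ 1) k 0) \<le> fact 1 * (\<epsilon> * \<rho> / 2) / \<rho> ^ 1"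
      proof (rule Cauchy_inequality[OF kh kc \<rho>(1)])
        fix \<zeta> :: complex assume "norm (0 - \<zeta>) = \<rho>"
        then have "norm \<zeta> \<le> \<rho>" by simp
        from d(2)[OF in2[OF this] in1[OF this]] show "norm (k \<zeta>) \<le> \<epsilon> * \<rho> / 2"
          using z by (simp add: k_def dist_norm)
      qed
      then have "norm (deriv k 0) \<le> \<epsilon> / 2" using \<rho> by simp
      moreover have "deriv k 0 = frechet_derivative h (at z) e - frechet_derivative h (at 0) e"
        using DERIV_imp_deriv[OF kd[of 0]] \<rho> by simp
      ultimately show ?thesis using \<epsilon> by simp
    qed
    then show ?thesis using d(1) R(1) by (intro exI[of _ "min d (R / 2)"]) auto
  qed
  then show ?thesis
    unfolding continuous_at_eps_delta dist_norm by blast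
qed

lemma cholo_on_derivative_axis:
  fixes h :: "complex^'n::finite \<Rightarrow> complex"
  assumes h: "cholo_on U h" and z: "z \<in> U" and v: "frechet_derivative h (at z) v \<noteq> 0"
  shows "\<exists>i. frechet_derivative h (at z) (axis i 1) \<noteq> 0"
proof (rule ccontr)
  let ?D = "frechet_derivative h (at z)"
  assume "\<not> ?thesis"
  then have *: "?D (axis i 1) = 0" for i by blast
  have lin: "linear ?D"
    using cholo_on_has_derivative[OF h z] has_derivative_linear by blast
  have "?D v = ?D (\<Sum>i\<in>UNIV. (v $ i) *s axis i 1)" by (simp only: basis_expansion)
  also have "\<dots> = (\<Sum>i\<in>UNIV. ?D ((v $ i) *s axis i 1))" by (rule linear_sum[OF lin])
  also have "\<dots> = 0" using h z * unfolding cholo_on_def by simp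
  finally show False using v by simp
qed

text \<open>A holomorphic implicit function theorem in the plane of the coordinates i and j: h = 0
  is solved for the i-th coordinate as a function of t = z_j, all others being 0. Having t itself as
  a component makes the curve regular.\<close>

lemma holomorphic_curve_in_zero_set:
  fixes h :: "complex^'n::finite \<Rightarrow> complex"
  assumes h: "cholo_on U h" and U: "0 \<in> U" and h0: "h 0 = 0"
    and i: "frechet_derivative h (at 0) (axis i 1) \<noteq> 0" and ij: "i \<noteq> j"
  shows "\<exists>\<gamma> \<epsilon>. \<epsilon> > 0 \<and> (\<forall>k. (\<lambda>t. \<gamma> t $ k) holomorphic_on ball 0 \<epsilon>) \<and> \<gamma> 0 = 0 \<and>
     (\<forall>t\<in>ball 0 \<epsilon>. \<gamma> t \<in> U \<and> h (\<gamma> t) = 0 \<and> \<gamma> t $ j = t)"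
proof -
  define D where "D z = frechet_derivative h (at z)" for z
  define l :: "complex \<times> complex \<Rightarrow> complex^'n" where "l x = fst x *s axis j 1 + snd x *s axis i 1" for x
  define Ht where "Ht x = D (l x) (axis j 1)" for x
  define Hs where "Hs x = D (l x) (axis i 1)" for x
  have bl: "bounded_linear l"
    unfolding l_def
    by (intro bounded_linear_add bounded_linear_compose[OF bounded_linear_vec_scale] bounded_linear_fst bounded_linear_snd)
  have l0: "l 0 = 0" by (simp add: l_def)
  have lcont: "isCont l x" for x using bl by (rule linear_continuous_at)
  have openU: "open U" using h by (simp add: cholo_on_def)
  have Dl: "D (l x) (l y) = fst y * Ht x + snd y * Hs x" if "l x \<in> U" for x y
  proof -
    have lin: "linear (D (l x))"
      unfolding D_def using cholo_on_has_derivative[OF h that] has_derivative_linear by blast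
    have "D (l x) (l y) = D (l x) (fst y *s axis j 1) + D (l x) (snd y *s axis i 1)"
      unfolding l_def[of y] by (rule linear_add[OF lin])
    then show ?thesis using h that unfolding cholo_on_def Ht_def Hs_def D_def by simp
  qed
  have Htc: "isCont Ht 0" and Hsc: "isCont Hs 0"
    unfolding Ht_def[abs_def] Hs_def[abs_def] D_def
    using isCont_o2[OF lcont[of 0], of "\<lambda>z. frechet_derivative h (at z) _"]
      cholo_on_derivative_continuous[OF h U] by (auto simp: l0)
  have Hs0: "Hs 0 \<noteq> 0" using i by (simp add: Hs_def D_def l0)
  have "open (l -` U)" by (rule continuous_open_vimage[OF openU]) (rule lcont)
  then have "eventually (\<lambda>x. x \<in> l -` U) (nhds 0)" using U l0 by (intro eventually_nhds_in_open) auto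
  moreover have "eventually (\<lambda>x. Hs x \<noteq> 0) (nhds 0)"
    using tendsto_imp_eventually_ne[OF isContD[OF Hsc] Hs0] Hs0 by (simp add: eventually_nhds_conv_at)
  ultimately have "eventually (\<lambda>x. l x \<in> U \<and> Hs x \<noteq> 0) (nhds 0)"
    by eventually_elim auto
  then obtain S where S: "open S" "0 \<in> S" "\<And>x. x \<in> S \<Longrightarrow> l x \<in> U" "\<And>x. x \<in> S \<Longrightarrow> Hs x \<noteq> 0"
    unfolding eventually_nhds by blast
  \<comment> \<open>Inverting this map solves h = 0. Local injectivity comes from continuity of its
    derivative at 0, openness of the image from invariance of domain.\<close>
  define \<Phi> where "\<Phi> x = (fst x, h (l x))" for x :: "complex \<times> complex"
  define \<Phi>' where "\<Phi>' x y = (fst y, fst y * Ht x + snd y * Hs x)" for x y :: "complex \<times> complex"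
  define \<Psi>' where "\<Psi>' x y = (fst y, (snd y - fst y * Ht x) / Hs x)" for x y :: "complex \<times> complex"
  have der: "(\<Phi> has_derivative \<Phi>' x) (at x)" if "x \<in> S" for x
  proof -
    have "(h has_derivative D (l x)) (at (l x))"
      unfolding D_def by (rule cholo_on_has_derivative[OF h S(3)[OF that]])
    from has_derivative_compose[OF bounded_linear_imp_has_derivative[OF bl] this]
    have "((\<lambda>x. h (l x)) has_derivative (\<lambda>y. D (l x) (l y))) (at x)" .
    then have "((\<lambda>x. h (l x)) has_derivative (\<lambda>y. fst y * Ht x + snd y * Hs x)) (at x)"
      by (simp add: Dl[OF S(3)[OF that]])
    then show ?thesis
      unfolding \<Phi>_def[abs_def] \<Phi>'_def[abs_def] by (intro has_derivative_Pair derivative_intros)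
  qed
  have inv1: "\<Psi>' 0 \<circ> \<Phi>' 0 = id" and inv2: "\<Phi>' x \<circ> \<Psi>' x = id" if "x \<in> S" for x
    using Hs0 S(4)[OF that] by (auto simp: \<Phi>'_def \<Psi>'_def fun_eq_iff)
  have bl\<Psi>: "bounded_linear (\<Psi>' 0)"
    unfolding linear_conv_bounded_linear[symmetric] \<Psi>'_def
    by (rule linearI) (auto simp: diff_divide_distrib add_divide_distrib algebra_simps scaleR_conv_of_real)
  have near: "\<exists>d>0. \<forall>x. dist 0 x < d \<longrightarrow> onorm (\<lambda>v. \<Phi>' x v - \<Phi>' 0 v) < e" if e: "e > 0" for e
  proof -
    have "eventually (\<lambda>x. dist (Ht x) (Ht 0) < e / 3) (nhds 0)" "eventually (\<lambda>x. dist (Hs x) (Hs 0) < e / 3) (nhds 0)"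
      using tendstoD[OF isContD[OF Htc], of "e / 3"] tendstoD[OF isContD[OF Hsc], of "e / 3"] e
      by (simp_all add: eventually_nhds_conv_at del: less_divide_eq_numeral1)
    then have "eventually (\<lambda>x. dist (Ht x) (Ht 0) < e / 3 \<and> dist (Hs x) (Hs 0) < e / 3) (nhds 0)"
      by eventually_elim auto
    then obtain d where d: "d > 0" "\<And>x. dist x 0 < d \<Longrightarrow> dist (Ht x) (Ht 0) < e / 3 \<and> dist (Hs x) (Hs 0) < e / 3"
      unfolding eventually_nhds_metric by blast
    have "onorm (\<lambda>v. \<Phi>' x v - \<Phi>' 0 v) < e" if "dist 0 x < d" for x
    proof -
      have "norm (\<Phi>' x v - \<Phi>' 0 v) \<le> 2 * e / 3 * norm v" for v
      proof -
        have "\<Phi>' x v - \<Phi>' 0 v = (0, fst v * (Ht x - Ht 0) + snd v * (Hs x - Hs 0))"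
          by (simp add: \<Phi>'_def algebra_simps)
        then have "norm (\<Phi>' x v - \<Phi>' 0 v) \<le> norm (fst v) * norm (Ht x - Ht 0) + norm (snd v) * norm (Hs x - Hs 0)"
          by (simp add: norm_Pair) (metis norm_mult norm_triangle_ineq)
        also have "\<dots> \<le> norm v * (e / 3) + norm v * (e / 3)"
          using d(2)[of x] that norm_fst_le[of "fst v" "snd v"] norm_snd_le[of "snd v" "fst v"]
          by (intro add_mono mult_mono) (auto simp: dist_norm norm_minus_commute)
        finally show ?thesis by simp
      qed
      then have "onorm (\<lambda>v. \<Phi>' x v - \<Phi>' 0 v) \<le> 2 * e / 3" by (rule onorm_le)
      then show ?thesis using e by simp
    qed
    then show ?thesis using d(1) by blast
  qed
  obtain r where r: "r > 0" "ball 0 r \<subseteq> S" "inj_on \<Phi> (ball 0 r)"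
    using has_derivative_locally_injective[OF S(2,1) bl\<Psi> inv1[OF S(2)] der near] by metis
  have der': "(\<Phi> has_derivative \<Phi>' x) (at x)" if "x \<in> ball 0 r" for x using der r(2) that by blast
  have cont: "continuous_on (ball 0 r) \<Phi>"
    by (intro continuous_at_imp_continuous_on ballI has_derivative_continuous[OF der'])
  have opn: "open (\<Phi> ` ball 0 r)" by (rule invariance_of_domain[OF cont open_ball r(3)])
  define \<Psi> where "\<Psi> = inv_into (ball 0 r) \<Phi>"
  have \<Psi>: "\<Psi> (\<Phi> x) = x" if "x \<in> ball 0 r" for x
    unfolding \<Psi>_def using r(3) that by (rule inv_into_f_f)
  have \<Phi>0: "\<Phi> 0 = 0" using l0 h0 by (simp add: \<Phi>_def zero_prod_def)
  then have "0 \<in> \<Phi> ` ball 0 r" using r(1) by (metis centre_in_ball imageI)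
  then obtain \<epsilon> where \<epsilon>: "\<epsilon> > 0" "ball 0 \<epsilon> \<subseteq> \<Phi> ` ball 0 r"
    using opn open_contains_ball by blast
  define s where "s t = snd (\<Psi> (t, 0))" for t
  have pt: "\<Psi> (t, 0) \<in> ball 0 r \<and> \<Phi> (\<Psi> (t, 0)) = (t, 0)" if "t \<in> ball 0 \<epsilon>" for t
  proof -
    have "(t, 0) \<in> ball (0 :: complex \<times> complex) \<epsilon>" using that by (simp add: zero_prod_def dist_Pair_Pair)
    then obtain x where "x \<in> ball 0 r" "\<Phi> x = (t, 0)" using \<epsilon>(2) by (metis imageE subsetD)
    then show ?thesis using \<Psi> by metis
  qed
  have eq: "\<Psi> (t, 0) = (t, s t)" "h (l (t, s t)) = 0" "l (t, s t) \<in> U" if "t \<in> ball 0 \<epsilon>" for t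
  proof -
    have f: "fst (\<Psi> (t, 0)) = t" "h (l (\<Psi> (t, 0))) = 0" using pt[OF that] by (auto simp: \<Phi>_def)
    then show 1: "\<Psi> (t, 0) = (t, s t)" by (simp add: s_def prod_eq_iff)
    show "h (l (t, s t)) = 0" using f(2) 1 by simp
    show "l (t, s t) \<in> U" using S(3) r(2) pt[OF that] 1 by auto
  qed
  \<comment> \<open>The real derivative of the solution, read off from \<Psi>', is multiplication by
    a complex number, so s is holomorphic.\<close>
  have "(s has_field_derivative - Ht (t, s t) / Hs (t, s t)) (at t)" if t: "t \<in> ball 0 \<epsilon>" for t
  proof -
    let ?x = "\<Psi> (t, 0)"
    have x: "?x \<in> ball 0 r" "\<Phi> ?x = (t, 0)" using pt[OF t] by auto
    have "(\<Psi> has_derivative \<Psi>' ?x) (at (\<Phi> ?x))"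
    proof (rule has_derivative_inverse_on[where S = "ball 0 r" and f' = \<Phi>' and g' = \<Psi>'])
      show "\<Phi>' ?x \<circ> \<Psi>' ?x = id" using inv2 x(1) r(2) by blast
    qed (use x(1) \<Psi> der' in auto)
    then have "(\<Psi> has_derivative \<Psi>' ?x) (at (t, 0))" by (simp only: x(2))
    moreover have "((\<lambda>t::complex. (t, 0::complex)) has_derivative (\<lambda>t. (t, 0))) (at t)"
      by (intro has_derivative_Pair derivative_intros)
    ultimately have "((\<lambda>t. \<Psi> (t, 0)) has_derivative (\<lambda>\<delta>. \<Psi>' ?x (\<delta>, 0))) (at t)"
      using has_derivative_compose by blast
    from has_derivative_snd[OF this]
    have "(s has_derivative (\<lambda>\<delta>. snd (\<Psi>' ?x (\<delta>, 0)))) (at t)" by (simp add: s_def[abs_def])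
    moreover have "(\<lambda>\<delta>. snd (\<Psi>' ?x (\<delta>, 0))) = (*) (- Ht (t, s t) / Hs (t, s t))"
      by (simp add: fun_eq_iff \<Psi>'_def eq(1)[OF t])
    ultimately show ?thesis by (simp only: has_field_derivative_def)
  qed
  then have sh: "s holomorphic_on ball 0 \<epsilon>"
    unfolding holomorphic_on_open[OF open_ball] by blast
  have s0: "s 0 = 0"
    using \<Psi>[of 0] r(1) \<Phi>0 by (simp add: s_def zero_prod_def)
  have comp: "l (t, s t) $ k = (if k = j then t else if k = i then s t else 0)" for t k
    using ij by (auto simp: l_def axis_def)
  show ?thesis
  proof (intro exI[of _ "\<lambda>t. l (t, s t)"] exI[of _ \<epsilon>] conjI allI ballI)
    show "(\<lambda>t. l (t, s t) $ k) holomorphic_on ball 0 \<epsilon>" for k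
      unfolding comp using sh by (cases "k = j"; cases "k = i") (auto intro: holomorphic_intros)
    show "l (0, s 0) = 0" using l0 by (simp add: s0 zero_prod_def)
  qed (use \<epsilon> eq comp in auto)
qed

section \<open>Orders of contact of an arbitrary defining function\<close>

lemma GammaE:
  fixes \<gamma> :: "complex \<Rightarrow> complex^'n::finite"
  assumes "\<gamma> \<in> Gamma 0"
  obtains \<epsilon> where "\<epsilon> > 0" "\<And>i. (\<lambda>t. \<gamma> t $ i) holomorphic_on ball 0 \<epsilon>" "\<gamma> 0 = 0"
    "\<And>\<eta>. \<eta> > 0 \<Longrightarrow> \<exists>t. norm t < \<eta> \<and> \<gamma> t \<noteq> 0"
  using assms that unfolding Gamma_def by blast

lemma curve_vanishes_to_1:
  fixes \<gamma> :: "complex \<Rightarrow> complex^'n::finite"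
  assumes "\<epsilon> > 0" "\<And>i. (\<lambda>t. \<gamma> t $ i) holomorphic_on ball 0 \<epsilon>" "\<gamma> 0 = 0"
  shows "vanishes_to 1 \<gamma>"
  by (intro vanishes_to_vec holomorphic_vanishes_to_1[OF assms(2,1)]) (simp add: assms(3))

lemma vanishes_to_comparable:
  fixes \<gamma> :: "complex \<Rightarrow> complex^'n::finite" and r r0 :: "complex^'n \<Rightarrow> real"
  assumes \<delta>: "\<delta> > 0" "K \<ge> 0" and le: "\<And>z. norm z < \<delta> \<Longrightarrow> \<bar>r z\<bar> \<le> K * \<bar>r0 z\<bar>"
    and \<gamma>: "vanishes_to 1 \<gamma>" and v: "vanishes_to k (\<lambda>t. r0 (\<gamma> t))"
  shows "vanishes_to k (\<lambda>t. r (\<gamma> t))"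
proof -
  obtain C \<eta> where C: "C > 0" "\<eta> > 0" "\<And>t. norm t < \<eta> \<Longrightarrow> norm (\<gamma> t) \<le> C * norm t ^ 1"
    by (rule vanishes_toE[OF \<gamma>]) (rule that; blast)
  show ?thesis
  proof (rule vanishes_to_dominated[OF v, of "min \<eta> (\<delta> / C)"])
    fix t :: complex assume t: "norm t < min \<eta> (\<delta> / C)"
    have "norm (\<gamma> t) \<le> C * norm t" using C(3)[of t] t by simp
    also have "\<dots> < \<delta>" using t C(1) by (simp add: field_simps)
    finally show "norm (r (\<gamma> t)) \<le> K * norm (r0 (\<gamma> t))" using le by simp
  qed (use C \<delta> in auto)
qed

section \<open>Truncated cusp curves with large contact\<close>

definition cusp_curve :: "'n \<Rightarrow> 'n \<Rightarrow> 'n \<Rightarrow> nat \<Rightarrow> complex \<Rightarrow> complex^'n::finite" where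
  "cusp_curve a b c N t = (\<chi> i. if i = a then t ^ 2 else if i = b then t ^ 3 else if i = c then - tay N (t ^ 2) else 0)"

lemma cusp_curve_components:
  assumes "a \<noteq> b" "a \<noteq> c" "b \<noteq> c"
  shows "cusp_curve a b c N t $ a = t ^ 2" "cusp_curve a b c N t $ b = t ^ 3"
    "cusp_curve a b c N t $ c = - tay N (t ^ 2)" "j \<notin> {a, b, c} \<Longrightarrow> cusp_curve a b c N t $ j = 0"
  using assms by (auto simp: cusp_curve_def)

lemma cusp_curve_holomorphic: "(\<lambda>t. cusp_curve a b c N t $ i) holomorphic_on S"
proof -
  have "(\<lambda>t. - tay N (t ^ 2)) holomorphic_on S"
    unfolding tay_def by (intro holomorphic_intros)
  then show ?thesis
    by (cases "i = a"; cases "i = b"; cases "i = c")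
       (auto simp: cusp_curve_def intro!: holomorphic_intros)
qed

lemma cusp_curve_0: "cusp_curve a b c N 0 = 0"
  by (simp add: cusp_curve_def vec_eq_iff tay_0)

lemma cusp_curve_in_Gamma: "cusp_curve a b c N \<in> Gamma 0"
  unfolding Gamma_def
proof (intro CollectI conjI allI impI)
  show "\<exists>\<epsilon>>0. \<forall>i. (\<lambda>t. cusp_curve a b c N t $ i) holomorphic_on ball 0 \<epsilon>"
    using cusp_curve_holomorphic zero_less_one by blast
  fix \<epsilon> :: real assume \<epsilon>: "\<epsilon> > 0"
  have "cusp_curve a b c N (of_real (\<epsilon> / 2)) $ a \<noteq> 0"
    using \<epsilon> by (simp add: cusp_curve_def)
  then have "cusp_curve a b c N (of_real (\<epsilon> / 2)) \<noteq> 0" by auto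
  then show "\<exists>t. norm t < \<epsilon> \<and> cusp_curve a b c N t \<noteq> 0"
    using \<epsilon> by (intro exI[of _ "of_real (\<epsilon> / 2)"]) auto
qed (rule cusp_curve_0)

lemma cusp_curve_contact:
  assumes "a \<noteq> b" "a \<noteq> c" "b \<noteq> c" "N \<ge> 2"
  shows "vanishes_to (2 * N) (\<lambda>t. rdef a b c (cusp_curve a b c N t))"
proof -
  note comp = cusp_curve_components[OF assms(1-3)]
  have "psh_part a b c (cusp_curve a b c N t) = 0" for t
    using comp(4) by (simp add: psh_part_def cusp_def comp(1,2) power_mult[symmetric] sum_nonneg_eq_0_iff)
  then have "rdef a b c (cusp_curve a b c N t) = usum (t ^ 2) - Re (tay N (t ^ 2))" for t
    by (simp add: rdef_def comp(1,3))
  moreover have "vanishes_to 2 (\<lambda>t::complex. t ^ 2)"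
    by (rule vanishes_toI[of 1 _ 1]) (auto simp: norm_power)
  ultimately show ?thesis using vanishes_to_usum_tay[OF _ assms(4)] by simp
qed

text \<open>A two-sided bound suffices for \<open>Delta1\<close>: m > 0 makes the quotient an honest
  one, and m \<le> 2 gives 2 N / m \<ge> N.\<close>

lemma ord_cusp_curve:
  fixes a b c :: "'n::finite"
  obtains m where "ord (cusp_curve a b c N) = enat m" "0 < m" "m \<le> 2"
proof -
  have "\<not> vanishes_to (Suc 2) (cusp_curve a b c N)"
  proof
    assume "vanishes_to (Suc 2) (cusp_curve a b c N)"
    then have "vanishes_to (Suc 2) (\<lambda>t. cusp_curve a b c N t $ a)" by (rule vanishes_to_component)
    then have "Suc 2 \<le> 2"
      by (rule vanishes_to_lower_bound[of _ _ 1 1]) (auto simp: cusp_curve_def norm_power)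
    then show False by simp
  qed
  then have le: "ord (cusp_curve a b c N) \<le> enat 2" by (rule ord_le)
  have "vanishes_to 1 (cusp_curve a b c N)"
    by (rule curve_vanishes_to_1[OF zero_less_one cusp_curve_holomorphic cusp_curve_0])
  then have ge: "enat 1 \<le> ord (cusp_curve a b c N)" by (rule ord_ge)
  show ?thesis
    using le ge that by (cases "ord (cusp_curve a b c N)") auto
qed

text \<open>An arbitrary defining function enters only through these two inequalities, which
  preserve the order of vanishing along every curve through 0.\<close>

locale comparable_defining_function =
  fixes a b c :: "'n::finite" and r :: "complex^'n \<Rightarrow> real" and k K \<delta> :: real
  assumes distinct: "a \<noteq> b" "a \<noteq> c" "b \<noteq> c"
    and pos: "k > 0" "K > 0" "\<delta> > 0"
    and lower: "\<And>z. norm z < \<delta> \<Longrightarrow> k * \<bar>rdef a b c z\<bar> \<le> \<bar>r z\<bar>"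
    and upper: "\<And>z. norm z < \<delta> \<Longrightarrow> \<bar>r z\<bar> \<le> K * \<bar>rdef a b c z\<bar>"
begin

lemma vanishes_to_iff:
  assumes "vanishes_to 1 \<gamma>"
  shows "vanishes_to m (\<lambda>t. r (\<gamma> t)) \<longleftrightarrow> vanishes_to m (\<lambda>t. rdef a b c (\<gamma> t))"
proof
  have "\<bar>rdef a b c z\<bar> \<le> (1 / k) * \<bar>r z\<bar>" if "norm z < \<delta>" for z
    using lower[OF that] pos by (simp add: field_simps)
  then show "vanishes_to m (\<lambda>t. rdef a b c (\<gamma> t))" if "vanishes_to m (\<lambda>t. r (\<gamma> t))"
    using vanishes_to_comparable[of \<delta> "1 / k" "rdef a b c" r \<gamma> m] pos assms that by simp
  show "vanishes_to m (\<lambda>t. r (\<gamma> t))" if "vanishes_to m (\<lambda>t. rdef a b c (\<gamma> t))"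
    using vanishes_to_comparable[of \<delta> K r "rdef a b c" \<gamma> m] pos assms that upper by simp
qed

lemma Delta1_infinite: "Delta1 0 r = \<infinity>"
proof (rule ereal_top)
  fix B :: real
  obtain N0 :: nat where N0: "B \<le> real N0" using real_arch_simple by blast
  define N where "N = max 2 N0"
  have N: "N \<ge> 2" "B \<le> real N" using N0 by (auto simp: N_def)
  let ?g = "cusp_curve a b c N"
  obtain m where m: "ord ?g = enat m" "0 < m" "m \<le> 2" by (rule ord_cusp_curve)
  have "vanishes_to 1 ?g"
    by (rule curve_vanishes_to_1[OF zero_less_one cusp_curve_holomorphic cusp_curve_0])
  then have "vanishes_to (2 * N) (\<lambda>t. r (?g t))"
    using cusp_curve_contact[OF distinct N(1)] vanishes_to_iff by blast
  then have "enat (2 * N) \<le> ord (r \<circ> ?g)" unfolding o_def by (rule ord_ge)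
  then have "ereal_of_enat (enat (2 * N)) \<le> ereal_of_enat (ord (r \<circ> ?g))" by (simp only: ereal_of_enat_le_iff)
  then have "ereal (2 * N) / ereal m \<le> ereal_of_enat (ord (r \<circ> ?g)) / ereal m"
    using m(2) by (intro ereal_divide_right_mono) auto
  moreover have "ereal B \<le> ereal (2 * N) / ereal m"
  proof -
    have "B * m \<le> N * 2"
      using N m by (cases "B \<ge> 0") (auto intro: mult_mono order_trans[OF mult_nonpos_nonneg])
    then show ?thesis using m(2) by (simp add: field_simps)
  qed
  ultimately have "ereal B \<le> ereal_of_enat (ord (r \<circ> ?g)) / ereal_of_enat (ord (\<lambda>t. ?g t - 0))"
    using m(1) by simp
  then show "ereal B \<le> Delta1 0 r"
    unfolding Delta1_def by (rule SUP_upper2[OF cusp_curve_in_Gamma])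
qed

lemma contact_regular:
  assumes e: "\<epsilon> > 0" and hol: "\<And>i. (\<lambda>t. \<gamma> t $ i) holomorphic_on ball 0 \<epsilon>" and g0: "\<gamma> 0 = 0"
    and v: "vanishes_to 8 (\<lambda>t. r (\<gamma> t))"
  shows "vanishes_to 2 (\<lambda>t. \<gamma> t $ i)"
  using regular_curve_contact[OF e hol g0] vanishes_to_iff[OF curve_vanishes_to_1[OF e hol g0]] v by blast

lemma Delta1_reg_le: "Delta1_reg 0 r \<le> enat 7"
  unfolding Delta1_reg_def
proof (rule SUP_least)
  fix \<gamma> :: "complex \<Rightarrow> complex^'n"
  assume "\<gamma> \<in> {\<gamma> \<in> Gamma 0. ord (\<lambda>t. \<gamma> t - 0) = 1}"
  then have \<gamma>: "\<gamma> \<in> Gamma 0" and o: "ord \<gamma> = 1" by auto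
  obtain \<epsilon> where e: "\<epsilon> > 0" and hol: "\<And>i. (\<lambda>t. \<gamma> t $ i) holomorphic_on ball 0 \<epsilon>" and g0: "\<gamma> 0 = 0"
    by (rule GammaE[OF \<gamma>]) blast
  have "\<not> vanishes_to (Suc 7) (\<lambda>t. r (\<gamma> t))"
  proof
    assume "vanishes_to (Suc 7) (\<lambda>t. r (\<gamma> t))"
    then have "vanishes_to 8 (\<lambda>t. r (\<gamma> t))" by simp
    then have "vanishes_to 2 \<gamma>" by (intro vanishes_to_vec contact_regular[OF e hol g0])
    from ord_ge[OF this] o show False by (simp add: one_enat_def)
  qed
  then show "ord (r \<circ> \<gamma>) \<le> enat 7" unfolding o_def by (rule ord_le)
qed

lemma no_flat_curve: "\<not> (\<exists>\<gamma>\<in>Gamma 0. tangent_infinite_order r \<gamma>)"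
proof
  assume "\<exists>\<gamma>\<in>Gamma 0. tangent_infinite_order r \<gamma>"
  then obtain \<gamma> where \<gamma>: "\<gamma> \<in> Gamma 0" and flat: "\<And>N. vanishes_to N (\<lambda>t. r (\<gamma> t))"
    unfolding tangent_infinite_order_def o_def by blast
  obtain \<epsilon> where e: "\<epsilon> > 0" and hol: "\<And>i. (\<lambda>t. \<gamma> t $ i) holomorphic_on ball 0 \<epsilon>" and g0: "\<gamma> 0 = 0"
    and nc: "\<And>\<eta>. \<eta> > 0 \<Longrightarrow> \<exists>t. norm t < \<eta> \<and> \<gamma> t \<noteq> 0"
    by (rule GammaE[OF \<gamma>]) blast
  have "vanishes_to N (\<lambda>t. rdef a b c (\<gamma> t))" for N
    using vanishes_to_iff[OF curve_vanishes_to_1[OF e hol g0]] flat by blast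
  then have "\<forall>t\<in>ball 0 \<epsilon>. \<gamma> t = 0" by (rule flat_curve_constant[OF e hol g0])
  with nc[OF e] show False by auto
qed

text \<open>A complex hypersurface through 0 with contact 8 contains a curve with some component
  equal to t. This curve inherits the contact 8, against \<open>contact_regular\<close>.\<close>

lemma bg_vanish_le:
  assumes "bg_vanish 0 r m"
  shows "m \<le> 7"
proof (rule ccontr)
  assume "\<not> m \<le> 7"
  then have m: "8 \<le> m" by simp
  obtain U h v C \<eta> where h: "cholo_on U h" "0 \<in> U" "h 0 = 0" "frechet_derivative h (at 0) v \<noteq> 0"
    and \<eta>: "\<eta> > 0" and bd: "\<forall>z\<in>U. h z = 0 \<and> norm (z - 0) < \<eta> \<longrightarrow> \<bar>r z\<bar> \<le> C * norm (z - 0) ^ m"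
    using assms unfolding bg_vanish_def by blast
  obtain i where i: "frechet_derivative h (at 0) (axis i 1) \<noteq> 0"
    using cholo_on_derivative_axis[OF h(1,2,4)] by blast
  obtain j where ij: "i \<noteq> j" using distinct(1) by metis
  obtain \<gamma> \<epsilon> where e: "\<epsilon> > 0" and hol: "\<And>k. (\<lambda>t. \<gamma> t $ k) holomorphic_on ball 0 \<epsilon>" and g0: "\<gamma> 0 = 0"
    and \<gamma>: "\<And>t. t \<in> ball 0 \<epsilon> \<Longrightarrow> \<gamma> t \<in> U \<and> h (\<gamma> t) = 0 \<and> \<gamma> t $ j = t"
    using holomorphic_curve_in_zero_set[OF h(1-3) i ij] by blast
  obtain D \<rho> where D: "D > 0" "\<rho> > 0" "\<And>t. norm t < \<rho> \<Longrightarrow> norm (\<gamma> t) \<le> D * norm t ^ 1"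
    by (rule vanishes_toE[OF curve_vanishes_to_1[OF e hol g0]]) (rule that; blast)
  have "vanishes_to m (\<lambda>t. r (\<gamma> t))"
  proof (rule vanishes_toI[of "min \<epsilon> (min \<rho> (\<eta> / D))" _ "\<bar>C\<bar> * D ^ m"])
    fix t :: complex assume t: "norm t < min \<epsilon> (min \<rho> (\<eta> / D))"
    have le: "norm (\<gamma> t) \<le> D * norm t" using D(3)[of t] t by simp
    also have "\<dots> < \<eta>" using t D(1) by (simp add: field_simps)
    finally have "\<bar>r (\<gamma> t)\<bar> \<le> C * norm (\<gamma> t) ^ m" using bd \<gamma>[of t] t by simp
    also have "\<dots> \<le> \<bar>C\<bar> * (D * norm t) ^ m"
      using le by (intro mult_mono power_mono) auto
    finally show "norm (r (\<gamma> t)) \<le> \<bar>C\<bar> * D ^ m * norm t ^ m"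
      by (simp add: power_mult_distrib)
  qed (use e D \<eta> in auto)
  then have "vanishes_to 8 (\<lambda>t. r (\<gamma> t))" using m by (rule vanishes_to_antimono)
  then have v2: "vanishes_to 2 (\<lambda>t. \<gamma> t $ j)" by (rule contact_regular[OF e hol g0])
  have "(2::nat) \<le> 1"
    by (rule vanishes_to_lower_bound[OF v2 zero_less_one e]) (use \<gamma> in auto)
  then show False by simp
qed

text \<open>Order 0 is local boundedness, for which the hyperplane z_a = 0 serves. It makes the set
  of attained orders nonempty, so that the bound 7 yields a maximum.\<close>

lemma bg_vanish_0: "bg_vanish 0 r 0"
proof -
  let ?h = "\<lambda>z::complex^'n. z $ a"
  have fd: "frechet_derivative ?h (at z) = ?h" for z
    by (rule frechet_derivative_at[symmetric]) (rule bounded_linear_imp_has_derivative[OF bounded_linear_vec_nth])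
  have ch: "cholo_on UNIV ?h"
    unfolding cholo_on_def fd
    by (auto intro!: bounded_linear_imp_differentiable bounded_linear_vec_nth)
  have "isCont (rdef a b c) 0"
    using smooth_in_mem[OF rdef_smooth[of a b c]] by (simp add: cont_funs_def continuous_on_eq_continuous_at)
  then have "\<exists>d>0. \<forall>z. norm (z - 0) < d \<longrightarrow> norm (rdef a b c z - rdef a b c 0) < 1"
    unfolding continuous_at_eps_delta dist_norm using zero_less_one by blast
  then obtain d where d: "d > 0" "\<And>z. norm z < d \<Longrightarrow> \<bar>rdef a b c z\<bar> < 1"
    by (auto simp: rdef_0)
  have "\<bar>r z\<bar> \<le> K * norm (z - 0) ^ 0" if "norm (z - 0) < min d \<delta>" for z
  proof -
    have "\<bar>r z\<bar> \<le> K * \<bar>rdef a b c z\<bar>" using upper that by simp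
    also have "\<dots> \<le> K * 1" using pos d(2)[of z] that by (intro mult_left_mono) auto
    finally show ?thesis by simp
  qed
  then have "\<exists>C \<eta>. \<eta> > 0 \<and> (\<forall>z\<in>UNIV. ?h z = 0 \<and> norm (z - 0) < \<eta> \<longrightarrow> \<bar>r z\<bar> \<le> C * norm (z - 0) ^ 0)"
    using d(1) pos(3) by (intro exI[of _ K] exI[of _ "min d \<delta>"]) auto
  moreover have "\<exists>v. frechet_derivative ?h (at 0) v \<noteq> 0"
    unfolding fd by (intro exI[of _ "axis a 1"]) simp
  ultimately show ?thesis
    unfolding bg_vanish_def using ch by (intro exI[of _ UNIV] exI[of _ ?h]) simp
qed

lemma bloom_graham: "bloom_graham_finite 0 r"
  unfolding bloom_graham_finite_def
  using GreatestI_nat[of "bg_vanish 0 r" 0 7] Greatest_le_nat[of "bg_vanish 0 r" _ 7] bg_vanish_0 bg_vanish_le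
  by blast

end

section \<open>Existence of the hypersurface\<close>

theorem theorem6p6:
  assumes "CARD('n) \<ge> 3"
  shows "\<exists>(M :: (complex^'n::finite) set) p. p \<in> M \<and> smooth_real_hypersurface M \<and> pseudoconvex M \<and>
    (\<forall>U r. local_defining_function M p U r \<longrightarrow>
        Delta1 p r = \<infinity> \<and> Delta1_reg p r < \<infinity> \<and> bloom_graham_finite p r \<and>
        \<not> (\<exists>\<gamma>\<in>Gamma p. tangent_infinite_order r \<gamma>))"
proof -
  obtain T :: "'n set" where "card T = 3"
    using obtain_subset_with_card_n[OF assms] by blast
  then obtain a b c :: 'n where abc: "a \<noteq> b" "a \<noteq> c" "b \<noteq> c"
    by (auto simp: card_3_iff)
  let ?M = "{z. rdef a b c z = 0}"
  have ldf: "local_defining_function ?M q UNIV (rdef a b c)" for q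
    by (rule rdef_local_defining_function[OF abc(2,3)])
  have "smooth_real_hypersurface ?M"
    unfolding smooth_real_hypersurface_def using ldf by blast
  moreover have "pseudoconvex ?M"
    unfolding pseudoconvex_def using ldf rdef_levi_nonneg[OF abc(1)] by blast
  moreover have "Delta1 0 r = \<infinity> \<and> Delta1_reg 0 r < \<infinity> \<and> bloom_graham_finite 0 r \<and>
        \<not> (\<exists>\<gamma>\<in>Gamma 0. tangent_infinite_order r \<gamma>)" if r: "local_defining_function ?M 0 U r" for U r
  proof -
    obtain k K \<delta> where "k > 0" "K > 0" "\<delta> > 0"
      "\<forall>z. norm z < \<delta> \<longrightarrow> k * \<bar>rdef a b c z\<bar> \<le> \<bar>r z\<bar> \<and> \<bar>r z\<bar> \<le> K * \<bar>rdef a b c z\<bar>"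
      using defining_functions_comparable[OF rdef_shift[OF abc(2,3)] rdef_smooth rdef_0 r] by blast
    then interpret comparable_defining_function a b c r k K \<delta>
      using abc by unfold_locales auto
    have "Delta1_reg 0 r < \<infinity>" by (rule le_less_trans[OF Delta1_reg_le]) simp
    then show ?thesis using Delta1_infinite bloom_graham no_flat_curve by blast
  qed
  ultimately show ?thesis
    using rdef_0 by (intro exI[of _ ?M] exI[of _ 0]) blast
qed

end
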